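(* Let $G$ and $H$ be finitely generated groups with finite generating sets $S_G,S_H$, let $(\mathcal{G}_n)_n$ and $(\mathcal{H}_n)_n$ be sofic approximations of $(G,S_G)$ and $(H,S_H)$, let $\mathcal{U}$ be a non-principal ultrafilter on $\mathbb{N}$, and let $\mathfrak{u}_n\colon\mathcal{G}_n\to\mathcal{H}_n$ be a sequence of maps which is $\mathcal{U}$-statistically a coarse equivalence. Then there exists a measure equivalence coupling from $G$ to $H$ which moreover has the following properties: (1) if there exists $C>0$ such that every $\mathfrak{u}_n$ has $C$-dense image, then the coupling is cobounded from $G$ to $H$; (2) if there exists $C>0$ such that for every $n$ all point-preimages of $\mathfrak{u}_n$ have diameter at most $C$, then the coupling is cobounded from $H$ to $G$; (3) if the maps $\mathfrak{u}_n$ are bijective, then the coupling is an orbit equivalence coupling.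
   Context: Word metrics and Cayley graphs: $|g|$ is the word length; the Cayley graph has edges $(x,xs)$ labeled by $s$, so $d(x,y)=|x^{-1}y|$. Sofic approximation of $(G,S_G)$: a sequence $(\mathcal{G}_n)_n$ of finite directed graphs with edges labeled by $S_G$, of uniformly bounded degree, such that for every $r>0$ the set $\mathcal{G}_n^{(r)}$ of vertices $x$ for which the ball $B_{\mathcal{G}_n}(x,r)$ is isomorphic (as a directed labeled graph, $x$ corresponding to $e_G$) to $B_G(e_G,r)$ satisfies $\lim_n \#\mathcal{G}_n^{(r)}/\#\mathcal{G}_n=1$. A graph is identified with its vertex set, with the graph metric. $\mathbb{P}_X$ is the uniform probability measure on a finite set $X$. For maps $\mathfrak{u}_n\colon Y_n\to Z_n$ between finite metric spaces: - $\mathcal{U}$-statistically Lipschitz: for every $r>0$, $\lim_{C\to\infty}\lim_{\mathcal{U}}\mathbb{P}_{Y_n}(\{y\mid \operatorname{diam}_{Z_n}(\mathfrak{u}_n(B_{Y_n}(y,r)))\ge C\})=0$. - $\mathcal{U}$-statistically expansive: for every $r>0$, $\lim_{C\to\infty}\lim_{\mathcal{U}}\mathbb{P}_{Y_n}(\{y\mid \operatorname{diam}_{Y_n}(\mathfrak{u}_n^{-1}(B_{Z_n}(\mathfrak{u}_n(y),r)))\ge C\})=0$. - $\mathcal{U}$-statistically coarsely injective: $\lim_{C\to\infty}\lim_{\mathcal{U}}\mathbb{P}_{Y_n}(\{y\mid \operatorname{diam}_{Y_n}(\mathfrak{u}_n^{-1}(\mathfrak{u}_n(y)))\ge C\})=0$.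 - $\mathcal{U}$-statistically coarsely surjective: $\lim_{C\to\infty}\lim_{\mathcal{U}}\mathbb{P}_{Z_n}(\{z\mid d_{Z_n}(z,\mathfrak{u}_n(Y_n))\ge C\})=0$. - $\mathcal{U}$-statistically coarsely bijective: both of the previous two. - $\mathcal{U}$-statistically a coarse equivalence: $\mathcal{U}$-statistically Lipschitz, expansive and coarsely bijective. The image is $C$-dense if every point of $Z_n$ is at distance at most $C$ from it. Measure equivalence (ME) coupling from $G$ to $H$: a standard Borel $\sigma$-finite measure space $(\Omega,\mu)$ with commuting, free, measure preserving actions of $G$ and $H$ (denoted $*$) admitting Borel fundamental domains $X_G$ and $X_H$ (up to null sets) with $\mu(X_H)=1$ and $\mu(X_G)<\infty$. It is an orbit equivalence (OE) coupling if in addition $X_G=X_H$ (up to a null set). It is cobounded from $G$ to $H$ if, up to measure zero, $X_G$ is contained in the union of finitely many $H$-translates of $X_H$; cobounded from $H$ to $G$ if, up to measure zero, $X_H$ is contained in the union of finitely many $G$-translates of $X_G$. *)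

theory Defs
  imports "HOL-Analysis.Analysis" "HOL-Algebra.Group_Action" "HOL-Algebra.Generated_Groups"
begin

section \<open>Ultrafilters\<close>

definition ultrafilter :: "'a filter \<Rightarrow> bool" where
  "ultrafilter U \<longleftrightarrow> U \<noteq> bot \<and> (\<forall>P. eventually P U \<or> eventually (\<lambda>x. \<not> P x) U)"

definition nonprincipal_ultrafilter :: "'a filter \<Rightarrow> bool" where
  "nonprincipal_ultrafilter U \<longleftrightarrow> ultrafilter U \<and> (\<forall>a. U \<noteq> principal {a})"


section \<open>Extended metrics\<close>

text \<open>The graphs below need not be connected, so distances take values in \<^typ>\<open>ennreal\<close>, with
  \<open>\<infinity>\<close> between different components. Note \<open>INF\<close> over the empty set is \<open>\<infinity>\<close>, \<open>SUP\<close> over the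
  empty set is \<open>0\<close>. Balls are closed.\<close>

definition eball :: "'a set \<Rightarrow> ('a \<Rightarrow> 'a \<Rightarrow> ennreal) \<Rightarrow> 'a \<Rightarrow> real \<Rightarrow> 'a set" where
  "eball X d x r = {y \<in> X. d x y \<le> ennreal r}"

definition ediam :: "('a \<Rightarrow> 'a \<Rightarrow> ennreal) \<Rightarrow> 'a set \<Rightarrow> ennreal" where
  "ediam d A = (SUP x\<in>A. SUP y\<in>A. d x y)"

definition esetdist :: "('a \<Rightarrow> 'a \<Rightarrow> ennreal) \<Rightarrow> 'a \<Rightarrow> 'a set \<Rightarrow> ennreal" where
  "esetdist d x A = (INF y\<in>A. d x y)"


section \<open>Statistical properties of sequences of maps\<close>

text \<open>\<open>bad C n\<close> is a subset of the finite set \<open>X n\<close>. The inner limit is the limit of a bounded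
  real sequence along an ultrafilter, which always exists.\<close>

definition stat_negligible :: "nat filter \<Rightarrow> (nat \<Rightarrow> 'a set) \<Rightarrow> (real \<Rightarrow> nat \<Rightarrow> 'a set) \<Rightarrow> bool" where
  "stat_negligible U X bad \<longleftrightarrow>
     ((\<lambda>C. Lim U (\<lambda>n. measure (uniform_count_measure (X n)) (bad C n))) \<longlongrightarrow> 0) at_top"

locale map_sequence =
  fixes U :: "nat filter"
    and Y :: "nat \<Rightarrow> 'y set" and dY :: "nat \<Rightarrow> 'y \<Rightarrow> 'y \<Rightarrow> ennreal"
    and Z :: "nat \<Rightarrow> 'z set" and dZ :: "nat \<Rightarrow> 'z \<Rightarrow> 'z \<Rightarrow> ennreal"
    and u :: "nat \<Rightarrow> 'y \<Rightarrow> 'z"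
begin

definition stat_lipschitz :: bool where
  "stat_lipschitz \<longleftrightarrow> (\<forall>r>0. stat_negligible U Y
     (\<lambda>C n. {y \<in> Y n. ediam (dZ n) (u n ` eball (Y n) (dY n) y r) \<ge> ennreal C}))"

definition stat_expansive :: bool where
  "stat_expansive \<longleftrightarrow> (\<forall>r>0. stat_negligible U Y
     (\<lambda>C n. {y \<in> Y n.
        ediam (dY n) (u n -` eball (Z n) (dZ n) (u n y) r \<inter> Y n) \<ge> ennreal C}))"

definition stat_coarsely_injective :: bool where
  "stat_coarsely_injective \<longleftrightarrow> stat_negligible U Y
     (\<lambda>C n. {y \<in> Y n. ediam (dY n) (u n -` {u n y} \<inter> Y n) \<ge> ennreal C})"

definition stat_coarsely_surjective :: bool where
  "stat_coarsely_surjective \<longleftrightarrow> stat_negligible U Z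
     (\<lambda>C n. {z \<in> Z n. esetdist (dZ n) z (u n ` Y n) \<ge> ennreal C})"

definition stat_coarsely_bijective :: bool where
  "stat_coarsely_bijective \<longleftrightarrow> stat_coarsely_injective \<and> stat_coarsely_surjective"

definition stat_coarse_equivalence :: bool where
  "stat_coarse_equivalence \<longleftrightarrow> stat_lipschitz \<and> stat_expansive \<and> stat_coarsely_bijective"

end


section \<open>Labeled directed graphs\<close>

text \<open>An edge \<open>(x, s, y)\<close> goes from \<open>x\<close> to \<open>y\<close> and has label \<open>s\<close>.\<close>

record ('v, 's) lgraph =
  lverts :: "'v set"
  ledges :: "('v \<times> 's \<times> 'v) set"

definition finite_lgraph :: "'s set \<Rightarrow> ('v, 's) lgraph \<Rightarrow> bool" where
  "finite_lgraph S \<Gamma> \<longleftrightarrow> finite (lverts \<Gamma>) \<and> ledges \<Gamma> \<subseteq> lverts \<Gamma> \<times> S \<times> lverts \<Gamma>"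

text \<open>As usual for Cayley graphs, the graph metric ignores the orientation of the edges.\<close>

definition adjacency :: "('v, 's) lgraph \<Rightarrow> 'v rel" where
  "adjacency \<Gamma> = {(x, y). \<exists>s. (x, s, y) \<in> ledges \<Gamma> \<or> (y, s, x) \<in> ledges \<Gamma>}"

definition gdist :: "('v, 's) lgraph \<Rightarrow> 'v \<Rightarrow> 'v \<Rightarrow> ennreal" where
  "gdist \<Gamma> x y = (INF k\<in>{k. (x, y) \<in> adjacency \<Gamma> ^^ k}. of_nat k)"

abbreviation gball :: "('v, 's) lgraph \<Rightarrow> 'v \<Rightarrow> real \<Rightarrow> 'v set" where
  "gball \<Gamma> \<equiv> eball (lverts \<Gamma>) (gdist \<Gamma>)"

text \<open>Balls in graphs are regarded as induced subgraphs.\<close>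

definition induced_lgraph :: "('v, 's) lgraph \<Rightarrow> 'v set \<Rightarrow> ('v, 's) lgraph" where
  "induced_lgraph \<Gamma> A =
     \<lparr>lverts = lverts \<Gamma> \<inter> A, ledges = {(x, s, y) \<in> ledges \<Gamma>. x \<in> A \<and> y \<in> A}\<rparr>"

definition rooted_iso :: "('v, 's) lgraph \<Rightarrow> 'v \<Rightarrow> ('w, 's) lgraph \<Rightarrow> 'w \<Rightarrow> bool" where
  "rooted_iso \<Gamma> x \<Delta> y \<longleftrightarrow> (\<exists>f. bij_betw f (lverts \<Gamma>) (lverts \<Delta>) \<and> f x = y \<and>
     (\<forall>a\<in>lverts \<Gamma>. \<forall>b\<in>lverts \<Gamma>. \<forall>s. (a, s, b) \<in> ledges \<Gamma> \<longleftrightarrow> (f a, s, f b) \<in> ledges \<Delta>))"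

definition uniformly_bounded_degree :: "(nat \<Rightarrow> ('v, 's) lgraph) \<Rightarrow> bool" where
  "uniformly_bounded_degree \<Gamma> \<longleftrightarrow> (\<exists>D. \<forall>n. \<forall>x\<in>lverts (\<Gamma> n).
     card {(a, s, b) \<in> ledges (\<Gamma> n). a = x \<or> b = x} \<le> D)"


section \<open>Cayley graphs and sofic approximations\<close>

definition finite_generating_set :: "('g, 'a) monoid_scheme \<Rightarrow> 'g set \<Rightarrow> bool" where
  "finite_generating_set G S \<longleftrightarrow> finite S \<and> S \<subseteq> carrier G \<and> generate G S = carrier G"

definition cayley_graph :: "('g, 'a) monoid_scheme \<Rightarrow> 'g set \<Rightarrow> ('g, 'g) lgraph" where
  "cayley_graph G S =
     \<lparr>lverts = carrier G, ledges = {(x, s, x \<otimes>\<^bsub>G\<^esub> s) | x s. x \<in> carrier G \<and> s \<in> S}\<rparr>"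

definition sofic_good_vertices ::
  "('g, 'a) monoid_scheme \<Rightarrow> 'g set \<Rightarrow> ('v, 'g) lgraph \<Rightarrow> real \<Rightarrow> 'v set" where
  "sofic_good_vertices G S \<Gamma> r = {x \<in> lverts \<Gamma>.
     rooted_iso (induced_lgraph \<Gamma> (gball \<Gamma> x r)) x
       (induced_lgraph (cayley_graph G S) (gball (cayley_graph G S) \<one>\<^bsub>G\<^esub> r)) \<one>\<^bsub>G\<^esub>}"

text \<open>Since \<open>0 / 0 = 0\<close>, the limit forces all but finitely many of the graphs to be nonempty.\<close>

definition sofic_approximation ::
  "('g, 'a) monoid_scheme \<Rightarrow> 'g set \<Rightarrow> (nat \<Rightarrow> ('v, 'g) lgraph) \<Rightarrow> bool" where
  "sofic_approximation G S \<Gamma> \<longleftrightarrow>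
     (\<forall>n. finite_lgraph S (\<Gamma> n)) \<and> uniformly_bounded_degree \<Gamma> \<and>
     (\<forall>r>0. (\<lambda>n. real (card (sofic_good_vertices G S (\<Gamma> n) r)) / real (card (lverts (\<Gamma> n))))
        \<longlonglongrightarrow> 1)"


section \<open>Measure equivalence couplings\<close>

text \<open>The topology is arbitrary, not the one of the ambient type. Since standard Borel spaces have
  at most continuum many points, all of them occur, up to isomorphism, on any type of cardinality
  continuum, e.g. \<^typ>\<open>nat \<Rightarrow> nat\<close>; existence statements can therefore use that type.\<close>

definition standard_borel :: "'a measure \<Rightarrow> bool" where
  "standard_borel M \<longleftrightarrow> (\<exists>T. topspace T = space M \<and> completely_metrizable_space T \<and>
     second_countable T \<and> sets M = sigma_sets (space M) {A. openin T A})"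

text \<open>Freeness is required at every point, not just almost everywhere. Elementwise measurability of the action is joint measurability, the groups being countable
  and discrete.\<close>

definition free_mp_action :: "('g, 'a) monoid_scheme \<Rightarrow> 'x measure \<Rightarrow> ('g \<Rightarrow> 'x \<Rightarrow> 'x) \<Rightarrow> bool" where
  "free_mp_action G M \<phi> \<longleftrightarrow> group_action G (space M) \<phi> \<and>
     (\<forall>g\<in>carrier G. \<phi> g \<in> measurable M M \<and> distr M M (\<phi> g) = M) \<and>
     (\<forall>x\<in>space M. stabilizer G \<phi> x = {\<one>\<^bsub>G\<^esub>})"

definition fundamental_domain ::
  "('g, 'a) monoid_scheme \<Rightarrow> 'x measure \<Rightarrow> ('g \<Rightarrow> 'x \<Rightarrow> 'x) \<Rightarrow> 'x set \<Rightarrow> bool" where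
  "fundamental_domain G M \<phi> X \<longleftrightarrow> X \<in> sets M \<and> (AE x in M. \<exists>!y. y \<in> orbit G \<phi> x \<inter> X)"

text \<open>The fundamental domains are part of the coupling data.\<close>

locale me_coupling =
  fixes G :: "('g, 'a) monoid_scheme" and H :: "('h, 'b) monoid_scheme"
    and M :: "'x measure"
    and \<phi> :: "'g \<Rightarrow> 'x \<Rightarrow> 'x" and \<psi> :: "'h \<Rightarrow> 'x \<Rightarrow> 'x"
    and X\<^sub>G :: "'x set" and X\<^sub>H :: "'x set"
  assumes standard_borel: "standard_borel M"
    and sigma_finite: "sigma_finite_measure M"
    and action_G: "free_mp_action G M \<phi>"
    and action_H: "free_mp_action H M \<psi>"
    and commute: "\<And>g h x. g \<in> carrier G \<Longrightarrow> h \<in> carrier H \<Longrightarrow> x \<in> space M \<Longrightarrow>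
      \<phi> g (\<psi> h x) = \<psi> h (\<phi> g x)"
    and domain_G: "fundamental_domain G M \<phi> X\<^sub>G"
    and domain_H: "fundamental_domain H M \<psi> X\<^sub>H"
    and measure_X\<^sub>H: "emeasure M X\<^sub>H = 1"
    and measure_X\<^sub>G: "emeasure M X\<^sub>G < \<infinity>"

definition oe_coupling where
  "oe_coupling G H M \<phi> \<psi> X\<^sub>G X\<^sub>H \<longleftrightarrow>
     me_coupling G H M \<phi> \<psi> X\<^sub>G X\<^sub>H \<and> (AE x in M. x \<in> X\<^sub>G \<longleftrightarrow> x \<in> X\<^sub>H)"

definition ae_finitely_covered ::
  "('k, 'a) monoid_scheme \<Rightarrow> 'x measure \<Rightarrow> ('k \<Rightarrow> 'x \<Rightarrow> 'x) \<Rightarrow> 'x set \<Rightarrow> 'x set \<Rightarrow> bool" where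
  "ae_finitely_covered K M \<phi> A B \<longleftrightarrow>
     (\<exists>F. finite F \<and> F \<subseteq> carrier K \<and> (AE x in M. x \<in> A \<longrightarrow> x \<in> (\<Union>k\<in>F. \<phi> k ` B)))"

definition cobounded_G_to_H where
  "cobounded_G_to_H G H M \<phi> \<psi> X\<^sub>G X\<^sub>H \<longleftrightarrow>
     me_coupling G H M \<phi> \<psi> X\<^sub>G X\<^sub>H \<and> ae_finitely_covered H M \<psi> X\<^sub>G X\<^sub>H"

definition cobounded_H_to_G where
  "cobounded_H_to_G G H M \<phi> \<psi> X\<^sub>G X\<^sub>H \<longleftrightarrow>
     me_coupling G H M \<phi> \<psi> X\<^sub>G X\<^sub>H \<and> ae_finitely_covered G M \<phi> X\<^sub>H X\<^sub>G"

end

theory Submission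
  imports Defs
begin

text \<open>
  Call a map \<open>f\<close> from \<open>G\<close> to \<open>H\<close> a configuration. Pick a uniformly random vertex \<open>x\<close> of \<open>\<G> n\<close>. Near
  most vertices \<open>\<G> n\<close> looks like \<open>G\<close>, so \<open>x \<cdot> k\<close> makes sense for \<open>k\<close> in \<open>G\<close>, and one can look at the
  configuration sending \<open>k\<close> to the element of \<open>H\<close> that leads from \<open>u x\<close> to \<open>u (x \<cdot> k)\<close>. Along the
  ultrafilter the joint distributions of finitely many of these values converge. Since the maps are
  statistically Lipschitz no mass escapes to infinity, so the limits are the marginals of a
  probability measure \<open>\<nu>\<close> on configurations with \<open>f 1 = 1\<close> (\<open>tight_charge_extends\<close>, \<open>law\<close>).

  On all configurations \<open>G\<close> acts by translating the argument and \<open>H\<close> by translating the value. The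
  coupling is \<open>\<mu>\<close>, the sum of all \<open>H\<close>-translates of \<open>\<nu>\<close>; it lives on a space on which
  \<open>XH = {f. f 1 = 1}\<close> is a fundamental domain of \<open>H\<close>. It is \<open>G\<close>-invariant because \<open>x\<close> and \<open>x \<cdot> g\<close> are
  both uniformly distributed up to a negligible set, so that \<open>\<nu>\<close> is invariant under translating by \<open>g\<close> and
  then moving back into \<open>XH\<close> (\<open>shift_invariant\<close>, \<open>mu_actG\<close>).

  The action of \<open>G\<close> on maps alone need not be free, and a fibre of \<open>f\<close> has no distinguished point.
  Therefore configurations also carry colours: a vertex of \<open>\<G> n\<close> gets for every \<open>r\<close> one of boundedly
  many colours so that distinct vertices at distance at most \<open>r\<close> differ. In the limit the colour
  sequences of distinct elements of \<open>G\<close> are distinct; this makes the action free at every point, and it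
  orders each fibre lexicographically.

  The fundamental domain \<open>XG\<close> of \<open>G\<close> consists of the configurations for which the unit of \<open>G\<close> is the
  first point of the fibre over that value in \<open>f(G)\<close> which comes first in a fixed enumeration of \<open>H\<close>
  starting with the unit. It works because expansiveness makes all fibres finite
  (\<open>AE_mu_finite_fibres\<close>). Its measure is bounded by a bound for \<open>card (\<H> n) / card (\<G> n)\<close>: counted in the finite
  graphs, each vertex of \<open>\<H> n\<close> is responsible for at most one leading vertex of \<open>\<G> n\<close>
  (\<open>sum_card_leading_le\<close>), and coarse surjectivity bounds the quotient (\<open>card_VH_le\<close>).

  If the images are uniformly dense, then almost every \<open>f(G)\<close> meets a fixed ball of \<open>H\<close>, so that on \<open>XG\<close>
  the value \<open>f 1\<close> is one of finitely many. If the fibres are uniformly bounded, then for \<open>f\<close> in \<open>XH\<close> the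
  leading point lies in a fixed ball of \<open>G\<close>. If the maps are bijective, both balls are trivial and
  \<open>XG\<close> and \<open>XH\<close> agree almost everywhere.
\<close>

section \<open>Tight charges on the Baire space\<close>

text \<open>These sets are clopen for a discrete \<open>'a\<close>. They carry all information that passes from the
  finite graphs to the limit.\<close>

definition cylinder :: "('i \<Rightarrow> 'a) set \<Rightarrow> bool" where
  "cylinder A \<longleftrightarrow>
     (\<exists>J. finite J \<and> (\<forall>w w'. (\<forall>i\<in>J. w i = w' i) \<longrightarrow> w \<in> A \<longrightarrow> w' \<in> A))"

lemma cylinderI:
  assumes "finite J" "\<And>w w'. (\<And>i. i \<in> J \<Longrightarrow> w i = w' i) \<Longrightarrow> w \<in> A \<Longrightarrow> w' \<in> A"
  shows "cylinder A"
  unfolding cylinder_def using assms by (intro exI[of _ J]) auto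

lemma cylinder_Collect:
  assumes "finite J" "\<And>w w'. (\<And>i. i \<in> J \<Longrightarrow> w i = w' i) \<Longrightarrow> P w = P w'"
  shows "cylinder {w. P w}"
proof (rule cylinderI[OF assms(1)])
  fix w w' assume "\<And>i. i \<in> J \<Longrightarrow> w i = w' i" "w \<in> {w. P w}"
  then show "w' \<in> {w. P w}" using assms(2)[of w w'] by simp
qed

lemma cylinder_UNIV: "cylinder UNIV"
  by (rule cylinderI[of "{}"]) simp_all

lemma cylinder_compl: "cylinder A \<Longrightarrow> cylinder (- A)"
proof -
  assume "cylinder A"
  then obtain J where J: "finite J" "\<And>w w'. (\<forall>i\<in>J. w i = w' i) \<Longrightarrow> w \<in> A \<Longrightarrow> w' \<in> A"
    unfolding cylinder_def by blast
  show ?thesis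
  proof (rule cylinderI[OF J(1)])
    fix w w' assume "\<And>i. i \<in> J \<Longrightarrow> w i = w' i" "w \<in> - A"
    then show "w' \<in> - A" using J(2)[of w' w] by auto
  qed
qed

lemma cylinder_Un:
  assumes "cylinder A" "cylinder B"
  shows "cylinder (A \<union> B)"
proof -
  obtain J where J: "finite J" "\<And>w w'. (\<forall>i\<in>J. w i = w' i) \<Longrightarrow> w \<in> A \<Longrightarrow> w' \<in> A"
    using assms(1) unfolding cylinder_def by blast
  obtain K where K: "finite K" "\<And>w w'. (\<forall>i\<in>K. w i = w' i) \<Longrightarrow> w \<in> B \<Longrightarrow> w' \<in> B"
    using assms(2) unfolding cylinder_def by blast
  show ?thesis
  proof (rule cylinderI[of "J \<union> K"])
    fix w w' :: "'a \<Rightarrow> 'b"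
    assume "\<And>i. i \<in> J \<union> K \<Longrightarrow> w i = w' i" "w \<in> A \<union> B"
    then show "w' \<in> A \<union> B" using J(2)[of w w'] K(2)[of w w'] by auto
  qed (simp add: J(1) K(1))
qed

lemma open_cylinder:
  fixes A :: "('i \<Rightarrow> 'a::discrete_topology) set"
  assumes "cylinder A"
  shows "open A"
proof -
  obtain J where J: "finite J" "\<And>w w'. (\<forall>i\<in>J. w i = w' i) \<Longrightarrow> w \<in> A \<Longrightarrow> w' \<in> A"
    using assms unfolding cylinder_def by blast
  have "open (\<Inter>i\<in>J. (\<lambda>w'. w' i) -` {w i})" for w :: "'i \<Rightarrow> 'a"
    by (rule open_INT[OF J(1)])
      (intro ballI open_vimage continuous_on_product_coordinates open_discrete)
  then have "open (\<Union>w\<in>A. \<Inter>i\<in>J. (\<lambda>w'. w' i) -` {w i})"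
    by (intro open_UN ballI)
  moreover have "A = (\<Union>w\<in>A. \<Inter>i\<in>J. (\<lambda>w'. w' i) -` {w i})"
  proof
    show "(\<Union>w\<in>A. \<Inter>i\<in>J. (\<lambda>w'. w' i) -` {w i}) \<subseteq> A"
    proof
      fix w' assume "w' \<in> (\<Union>w\<in>A. \<Inter>i\<in>J. (\<lambda>w'. w' i) -` {w i})"
      then obtain w where "w \<in> A" "\<forall>i\<in>J. w i = w' i" by auto
      then show "w' \<in> A" using J(2)[of w w'] by simp
    qed
  qed (intro subsetI UN_I INT_I; simp)
  ultimately show ?thesis by simp
qed

lemma closed_cylinder:
  fixes A :: "('i \<Rightarrow> 'a::discrete_topology) set"
  assumes "cylinder A"
  shows "closed A"
  using open_cylinder[OF cylinder_compl[OF assms]] by (simp add: closed_def)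

lemma borel_cylinder:
  fixes A :: "('i \<Rightarrow> 'a::discrete_topology) set"
  shows "cylinder A \<Longrightarrow> A \<in> sets borel"
  by (simp add: open_cylinder)

lemma algebra_cylinder: "algebra UNIV {A. cylinder A}"
proof (rule algebra_iff_Un[THEN iffD2], intro conjI ballI)
  show "{} \<in> {A. cylinder A}" by (auto simp: cylinder_def)
qed (auto intro: cylinder_Un cylinder_compl simp: Compl_eq_Diff_UNIV[symmetric])

lemma sigma_sets_cylinder:
  "sigma_sets UNIV {A :: (nat \<Rightarrow> nat) set. cylinder A} = sets borel"
proof
  show "sigma_sets UNIV {A :: (nat \<Rightarrow> nat) set. cylinder A} \<subseteq> sets borel"
    using sigma_algebra.sigma_sets_subset[OF sets.sigma_algebra_axioms,
        of "{A :: (nat \<Rightarrow> nat) set. cylinder A}" borel]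
    by (auto intro: borel_cylinder)
  have "sets (borel :: (nat \<Rightarrow> nat) measure) = sets (Pi\<^sub>M UNIV (\<lambda>i::nat. borel :: nat measure))"
    by (simp add: sets_PiM_equal_borel)
  also have "\<dots> = sigma_sets UNIV {{f \<in> UNIV. f i \<in> A} |i A. i \<in> UNIV \<and> A \<in> sets (borel :: nat measure)}"
    unfolding sets_PiM_single by simp
  also have "\<dots> \<subseteq> sigma_sets UNIV {A :: (nat \<Rightarrow> nat) set. cylinder A}"
  proof (rule sigma_sets_mono')
    show "{{f \<in> UNIV. f i \<in> A} |i A. i \<in> UNIV \<and> A \<in> sets (borel :: nat measure)}
       \<subseteq> {A :: (nat \<Rightarrow> nat) set. cylinder A}"
    proof
      fix B :: "(nat \<Rightarrow> nat) set" assume "B \<in> {{f \<in> UNIV. f i \<in> A} |i A. i \<in> UNIV \<and> A \<in> sets (borel :: nat measure)}"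
      then obtain i :: nat and A :: "nat set" where "B = {f. f i \<in> A}" by auto
      then show "B \<in> {A. cylinder A}"
        using cylinder_Collect[of "{i}" "\<lambda>f. f i \<in> A"] by simp
    qed
  qed
  finally show "sets borel \<subseteq> sigma_sets UNIV {A :: (nat \<Rightarrow> nat) set. cylinder A}" .
qed

lemma compact_box_nat: "compact {w :: nat \<Rightarrow> nat. \<forall>i. w i \<le> C i}"
proof -
  have "compactin (product_topology (\<lambda>_. euclidean) UNIV) (PiE UNIV (\<lambda>i::nat. {..C i}))"
    by (subst compactin_PiE) (auto intro: finite_imp_compact)
  moreover have "PiE UNIV (\<lambda>i::nat. {..C i}) = {w. \<forall>i. w i \<le> C i}" by (auto simp: PiE_def)
  ultimately show ?thesis by (simp add: euclidean_product_topology)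
qed

text \<open>Membership in \<open>A n\<close> only depends on finitely many coordinates, so the others can be set
  to \<open>0\<close>. This turns the hypothesis, which bounds finitely many coordinates, into a point of the whole
  box, and boxes are compact.\<close>

lemma decseq_cylinder_Inter_nonempty:
  fixes A :: "nat \<Rightarrow> (nat \<Rightarrow> nat) set"
  assumes fd: "\<And>n. cylinder (A n)" and dec: "decseq A"
    and ne: "\<And>n J. finite J \<Longrightarrow> \<exists>w\<in>A n. \<forall>i\<in>J. w i \<le> C i"
  shows "(\<Inter>n. A n) \<noteq> {}"
proof -
  let ?K = "{w :: nat \<Rightarrow> nat. \<forall>i. w i \<le> C i}"
  have nonempty: "A n \<inter> ?K \<noteq> {}" for n
  proof -
    obtain J where J: "finite J" "\<And>w w'. (\<forall>i\<in>J. w i = w' i) \<Longrightarrow> w \<in> A n \<Longrightarrow> w' \<in> A n"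
      using fd[of n] unfolding cylinder_def by blast
    obtain w where w: "w \<in> A n" "\<forall>i\<in>J. w i \<le> C i" using ne[OF J(1)] by blast
    have "(\<lambda>i. if i \<in> J then w i else 0) \<in> A n" by (rule J(2)[OF _ w(1)]) auto
    moreover have "(\<lambda>i. if i \<in> J then w i else 0) \<in> ?K" using w(2) by auto
    ultimately show ?thesis by blast
  qed
  have "?K \<inter> (\<Inter>n\<in>UNIV. A n) \<noteq> {}"
  proof (rule compact_imp_fip_image[OF compact_box_nat])
    fix I :: "nat set" assume "finite I" "I \<subseteq> UNIV"
    have "A (Max I) \<subseteq> A n" if "n \<in> I" for n
      using dec that \<open>finite I\<close> by (simp add: decseq_def)
    then show "?K \<inter> (\<Inter>n\<in>I. A n) \<noteq> {}" using nonempty[of "Max I"] by blast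
  qed (simp add: fd closed_cylinder)
  then show ?thesis by blast
qed

text \<open>Only continuity at the empty set needs an argument. If a decreasing sequence of cylinders
  has charge at least \<open>e\<close>, choose a box whose \<open>i\<close>-th side misses charge at most \<open>e / 4 * (1/2) ^ i\<close>. For
  every finite set of coordinates the part of the cylinders in the box still has positive charge, so
  compactness of the box gives a common point.\<close>

lemma tight_charge_extends:
  fixes m :: "(nat \<Rightarrow> nat) set \<Rightarrow> real"
  assumes nonneg: "\<And>A. 0 \<le> m A" and one: "m UNIV = 1"
    and add: "\<And>A B. A \<inter> B = {} \<Longrightarrow> m (A \<union> B) = m A + m B"
    and tight: "\<And>i e. e > 0 \<Longrightarrow> \<exists>C. m {w. w i > C} \<le> e"
  shows "\<exists>N. sets N = sets borel \<and> emeasure N UNIV = 1 \<and>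
    (\<forall>A. cylinder A \<longrightarrow> emeasure N A = ennreal (m A))"
proof -
  have empty: "m {} = 0" using add[of "{}" "{}"] by simp
  have mono: "m A \<le> m B" if "A \<subseteq> B" for A B
    using add[of A "B - A"] nonneg[of "B - A"] that by (simp add: Un_absorb1)
  have subadd: "m (A \<union> B) \<le> m A + m B" for A B
    using add[of A "B - A"] mono[of "B - A" B] by auto
  have subadd_UN: "m (\<Union>i\<in>J. B i) \<le> (\<Sum>i\<in>J. m (B i))" if "finite J" for B and J :: "nat set"
    using that
  proof (induction J rule: finite_induct)
    case empty then show ?case using \<open>m {} = 0\<close> by simp
  next
    case (insert x F)
    then show ?case using subadd[of "B x" "\<Union>i\<in>F. B i"] by simp
  qed
  interpret algebra UNIV "{A :: (nat \<Rightarrow> nat) set. cylinder A}"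
    by (rule algebra_cylinder)
  have "\<exists>\<mu> :: (nat \<Rightarrow> nat) set \<Rightarrow> ennreal.
      (\<forall>s \<in> {A. cylinder A}. \<mu> s = ennreal (m s)) \<and>
      measure_space UNIV (sigma_sets UNIV {A. cylinder A}) \<mu>"
  proof (rule caratheodory_empty_continuous)
    show "positive {A. cylinder A} (\<lambda>A. ennreal (m A))"
      by (simp add: positive_def empty)
    show "additive {A. cylinder A} (\<lambda>A. ennreal (m A))"
      by (auto simp: additive_def add nonneg ennreal_plus)
  next
    fix A :: "nat \<Rightarrow> (nat \<Rightarrow> nat) set"
    assume A: "range A \<subseteq> {A. cylinder A}" "decseq A" "(\<Inter>i. A i) = {}"
    have dec: "decseq (\<lambda>i. m (A i))"
      using A(2) by (auto simp: decseq_def intro: mono)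
    have "(\<lambda>i. m (A i)) \<longlonglongrightarrow> 0"
    proof (rule ccontr)
      assume not: "\<not> (\<lambda>i. m (A i)) \<longlonglongrightarrow> 0"
      obtain e where e: "e > 0" "\<And>n. m (A n) \<ge> e"
      proof -
        have "\<exists>e>0. \<forall>N. \<exists>n\<ge>N. \<not> norm (m (A n) - 0) < e"
          using not unfolding LIMSEQ_iff by blast
        then obtain e where e: "e > 0" "\<forall>N. \<exists>n\<ge>N. \<not> \<bar>m (A n)\<bar> < e" by auto
        have "m (A N) \<ge> e" for N
        proof -
          obtain n where n: "n \<ge> N" "\<not> \<bar>m (A n)\<bar> < e" using e(2) by blast
          have "m (A n) \<le> m (A N)" using dec n(1) by (simp add: decseq_def)
          then show ?thesis using n(2) nonneg[of "A n"] by simp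
        qed
        then show thesis using that e(1) by blast
      qed
      have "\<forall>i. \<exists>C. m {w. w i > C} \<le> e / 4 * (1/2) ^ i"
        using e(1) by (intro allI tight) auto
      then obtain C where C: "\<And>i. m {w. w i > C i} \<le> e / 4 * (1/2) ^ i" by metis
      have "(\<Inter>n. A n) \<noteq> {}"
      proof (rule decseq_cylinder_Inter_nonempty[of A C])
        fix n and J :: "nat set" assume J: "finite J"
        have "m (\<Union>i\<in>J. {w. w i > C i}) \<le> (\<Sum>i\<in>J. e / 4 * (1/2) ^ i)"
          by (rule order_trans[OF subadd_UN[OF J] sum_mono[OF C]])
        also have "\<dots> \<le> (\<Sum>i. e / 4 * (1/2) ^ i)"
          using e(1) J by (intro sum_le_suminf summable_mult summable_geometric) simp_all
        also have "\<dots> = e / 2"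
          by (subst suminf_mult) (simp_all add: suminf_geometric summable_geometric)
        finally have small: "m (\<Union>i\<in>J. {w. w i > C i}) < e" using e(1) by simp
        show "\<exists>w\<in>A n. \<forall>i\<in>J. w i \<le> C i"
        proof (rule ccontr)
          assume "\<not> ?thesis"
          then have "A n \<subseteq> (\<Union>i\<in>J. {w. w i > C i})" by (auto simp: not_le)
          from mono[OF this] show False using e(2)[of n] small by linarith
        qed
      qed (use A in auto)
      then show False using A(3) by simp
    qed
    then show "(\<lambda>i. ennreal (m (A i))) \<longlonglongrightarrow> 0"
      using tendsto_ennrealI[of "\<lambda>i. m (A i)" 0 sequentially] by simp
  qed auto
  then obtain \<mu> :: "(nat \<Rightarrow> nat) set \<Rightarrow> ennreal" where
    \<mu>: "\<And>A. cylinder A \<Longrightarrow> \<mu> A = ennreal (m A)"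
    "measure_space UNIV (sigma_sets UNIV {A. cylinder A}) \<mu>" by auto
  let ?N = "measure_of UNIV (sigma_sets UNIV {A :: (nat \<Rightarrow> nat) set. cylinder A}) \<mu>"
  have em: "emeasure ?N A = ennreal (m A)" if "cylinder A" for A
    using \<mu> that by (subst emeasure_measure_of_sigma) (auto simp: measure_space_def)
  have "cylinder (UNIV :: (nat \<Rightarrow> nat) set)" by (auto simp: cylinder_def)
  then have "emeasure ?N UNIV = 1" using em one by simp
  moreover have "sets ?N = sets borel" by (simp add: sigma_sets_cylinder sets.sigma_sets_eq[of borel, simplified])
  ultimately show ?thesis using em by blast
qed

section \<open>Words, walks and the local action of a marked group\<close>

text \<open>The letter \<open>(s, True)\<close> is the generator \<open>s\<close>, and \<open>(s, False)\<close> is its inverse; in a graph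
  they are read as following an edge labelled \<open>s\<close> forwards or backwards.\<close>

definition letter :: "('g, 'a) monoid_scheme \<Rightarrow> 'g \<times> bool \<Rightarrow> 'g" where
  "letter G a = (if snd a then fst a else inv\<^bsub>G\<^esub> (fst a))"

primrec word_val :: "('g, 'a) monoid_scheme \<Rightarrow> ('g \<times> bool) list \<Rightarrow> 'g" where
  "word_val G [] = \<one>\<^bsub>G\<^esub>"
| "word_val G (a # ws) = letter G a \<otimes>\<^bsub>G\<^esub> word_val G ws"

definition rev_word :: "('s \<times> bool) list \<Rightarrow> ('s \<times> bool) list" where
  "rev_word ws = rev (map (\<lambda>a. (fst a, \<not> snd a)) ws)"

definition words :: "'s set \<Rightarrow> nat \<Rightarrow> ('s \<times> bool) list set" where
  "words S n = {ws. set ws \<subseteq> S \<times> UNIV \<and> length ws \<le> n}"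

definition step :: "('v, 's) lgraph \<Rightarrow> 'v \<Rightarrow> 's \<times> bool \<Rightarrow> 'v \<Rightarrow> bool" where
  "step \<Gamma> x a y \<longleftrightarrow> (if snd a then (x, fst a, y) \<in> ledges \<Gamma> else (y, fst a, x) \<in> ledges \<Gamma>)"

primrec walk :: "('v, 's) lgraph \<Rightarrow> 'v \<Rightarrow> ('s \<times> bool) list \<Rightarrow> 'v \<Rightarrow> bool" where
  "walk \<Gamma> x [] y \<longleftrightarrow> x = y"
| "walk \<Gamma> x (a # ws) z \<longleftrightarrow> (\<exists>y. step \<Gamma> x a y \<and> walk \<Gamma> y ws z)"

text \<open>All hypotheses on distances are used through \<open>reach\<close>, which avoids extended metrics.\<close>

definition reach :: "('v, 's) lgraph \<Rightarrow> nat \<Rightarrow> 'v \<Rightarrow> 'v \<Rightarrow> bool" where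
  "reach \<Gamma> n x y \<longleftrightarrow> (\<exists>ws. length ws \<le> n \<and> walk \<Gamma> x ws y)"

lemma words_mono: "m \<le> n \<Longrightarrow> words S m \<subseteq> words S n"
  by (auto simp: words_def)

lemma length_rev_word [simp]: "length (rev_word ws) = length ws"
  by (simp add: rev_word_def)

lemma words_rev_word: "ws \<in> words S n \<Longrightarrow> rev_word ws \<in> words S n"
  by (auto simp: words_def rev_word_def)

lemma finite_words: "finite S \<Longrightarrow> finite (words S n)"
  unfolding words_def by (intro finite_lists_length_le finite_SigmaI) auto

lemma walk_append: "walk \<Gamma> x (ws @ vs) z \<longleftrightarrow> (\<exists>y. walk \<Gamma> x ws y \<and> walk \<Gamma> y vs z)"
  by (induction ws arbitrary: x) auto

lemma step_sym: "step \<Gamma> x a y \<Longrightarrow> step \<Gamma> y (fst a, \<not> snd a) x"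
  by (auto simp: step_def split: if_splits)

lemma walk_rev: "walk \<Gamma> x ws y \<Longrightarrow> walk \<Gamma> y (rev_word ws) x"
proof (induction ws arbitrary: x)
  case (Cons a ws)
  then show ?case using step_sym[of \<Gamma> x a] by (fastforce simp: rev_word_def walk_append)
qed (simp add: rev_word_def)

lemma reach_refl [simp]: "reach \<Gamma> n x x"
  unfolding reach_def by (intro exI[of _ "[]"]) simp

lemma reach_sym: "reach \<Gamma> n x y \<Longrightarrow> reach \<Gamma> n y x"
  unfolding reach_def using walk_rev by (metis length_rev_word)

lemma reach_mono: "reach \<Gamma> m x y \<Longrightarrow> m \<le> n \<Longrightarrow> reach \<Gamma> n x y"
  unfolding reach_def by (meson order_trans)

lemma reach_trans: "reach \<Gamma> m x y \<Longrightarrow> reach \<Gamma> n y z \<Longrightarrow> reach \<Gamma> (m + n) x z"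
  unfolding reach_def by (metis add_mono length_append walk_append)

lemma walk_iff_relpow: "(\<exists>ws. length ws = k \<and> walk \<Gamma> x ws y) \<longleftrightarrow> (x, y) \<in> adjacency \<Gamma> ^^ k"
proof (induction k arbitrary: x)
  case (Suc k)
  have adj: "(x, z) \<in> adjacency \<Gamma> \<longleftrightarrow> (\<exists>a. step \<Gamma> x a z)" for z
    by (force simp: adjacency_def step_def)
  have "(x, y) \<in> adjacency \<Gamma> ^^ Suc k \<longleftrightarrow> (\<exists>z. (x, z) \<in> adjacency \<Gamma> \<and> (z, y) \<in> adjacency \<Gamma> ^^ k)"
    by (metis relcomp.cases relcomp.relcompI relpow.simps(2) relpow_commute)
  also have "\<dots> \<longleftrightarrow> (\<exists>z a ws. step \<Gamma> x a z \<and> length ws = k \<and> walk \<Gamma> z ws y)"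
    unfolding adj Suc[symmetric] by blast
  also have "\<dots> \<longleftrightarrow> (\<exists>ws. length ws = Suc k \<and> walk \<Gamma> x ws y)"
  proof
    assume "\<exists>z a ws. step \<Gamma> x a z \<and> length ws = k \<and> walk \<Gamma> z ws y"
    then obtain z a ws where "step \<Gamma> x a z" "length ws = k" "walk \<Gamma> z ws y" by blast
    then show "\<exists>ws. length ws = Suc k \<and> walk \<Gamma> x ws y" by (intro exI[of _ "a # ws"]) auto
  next
    assume "\<exists>ws. length ws = Suc k \<and> walk \<Gamma> x ws y"
    then obtain a ws where "length ws = k" "walk \<Gamma> x (a # ws) y" by (metis length_Suc_conv)
    then obtain z where "step \<Gamma> x a z" "walk \<Gamma> z ws y" by auto
    with \<open>length ws = k\<close> show "\<exists>z a ws. step \<Gamma> x a z \<and> length ws = k \<and> walk \<Gamma> z ws y" by blast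
  qed
  finally show ?case by blast
qed auto

lemma gdist_imp_reach:
  assumes "gdist \<Gamma> x y \<le> ennreal c" shows "reach \<Gamma> (nat \<lfloor>c\<rfloor>) x y"
proof -
  let ?K = "{k. (x, y) \<in> adjacency \<Gamma> ^^ k}"
  have "?K \<noteq> {}"
  proof
    assume "?K = {}"
    then have "gdist \<Gamma> x y = \<infinity>" by (simp add: gdist_def)
    with assms have "\<infinity> \<le> ennreal c" by simp
    then show False using ennreal_less_top[of c] by (simp add: not_le[symmetric])
  qed
  then have K: "(LEAST k. k \<in> ?K) \<in> ?K" by (metis LeastI_ex ex_in_conv)
  have "of_nat (LEAST k. k \<in> ?K) \<le> gdist \<Gamma> x y"
    unfolding gdist_def by (intro INF_greatest) (auto intro: Least_le)
  with assms have "ennreal (real (LEAST k. k \<in> ?K)) \<le> ennreal c"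
    by (metis ennreal_of_nat_eq_real_of_nat order_trans)
  then have "(LEAST k. k \<in> ?K) \<le> nat \<lfloor>c\<rfloor>"
    by (cases "c \<ge> 0") (auto simp: ennreal_le_iff le_nat_floor ennreal_neg)
  with K show ?thesis unfolding reach_def using walk_iff_relpow[of _ \<Gamma> x y] by (metis mem_Collect_eq)
qed

lemma reach_imp_gdist:
  assumes "reach \<Gamma> n x y" shows "gdist \<Gamma> x y \<le> ennreal (real n)"
proof -
  obtain ws where "length ws \<le> n" "walk \<Gamma> x ws y"
    using assms unfolding reach_def by blast
  then have "(x, y) \<in> adjacency \<Gamma> ^^ length ws" using walk_iff_relpow[of "length ws" \<Gamma> x y] by blast
  then have "gdist \<Gamma> x y \<le> of_nat (length ws)"
    unfolding gdist_def by (intro INF_lower) simp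
  also have "\<dots> \<le> ennreal (real n)"
    unfolding ennreal_of_nat_eq_real_of_nat using \<open>length ws \<le> n\<close> by (intro ennreal_leI) simp
  finally show ?thesis .
qed

lemma gdist_le_iff_reach: "gdist \<Gamma> x y \<le> ennreal (real n) \<longleftrightarrow> reach \<Gamma> n x y"
  using gdist_imp_reach[of \<Gamma> x y "real n"] reach_imp_gdist[of \<Gamma> n x y] by auto

lemma walk_finite_lgraph:
  assumes "finite_lgraph S \<Gamma>" "walk \<Gamma> x ws y"
  shows "set ws \<subseteq> S \<times> UNIV" "x \<in> lverts \<Gamma> \<Longrightarrow> y \<in> lverts \<Gamma>"
proof -
  have "set ws \<subseteq> S \<times> UNIV \<and> (x \<in> lverts \<Gamma> \<longrightarrow> y \<in> lverts \<Gamma>)"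
    using assms(2)
  proof (induction ws arbitrary: x)
    case (Cons a ws)
    then obtain z where z: "step \<Gamma> x a z" "walk \<Gamma> z ws y" by auto
    have "fst a \<in> S" "z \<in> lverts \<Gamma>"
      using z(1) assms(1) by (auto simp: step_def finite_lgraph_def split: if_splits)
    then show ?case using Cons.IH[OF z(2)] by (cases a) auto
  qed auto
  then show "set ws \<subseteq> S \<times> UNIV" "x \<in> lverts \<Gamma> \<Longrightarrow> y \<in> lverts \<Gamma>" by auto
qed

lemma reach_lverts: "finite_lgraph S \<Gamma> \<Longrightarrow> reach \<Gamma> n x y \<Longrightarrow> x \<in> lverts \<Gamma> \<Longrightarrow> y \<in> lverts \<Gamma>"
  unfolding reach_def using walk_finite_lgraph(2) by metis

lemma card_reach_le:
  assumes \<Gamma>: "finite_lgraph S \<Gamma>" "finite S"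
    and deg: "\<And>x. x \<in> lverts \<Gamma> \<Longrightarrow> card {(a, s, b) \<in> ledges \<Gamma>. a = x \<or> b = x} \<le> D"
    and x: "x \<in> lverts \<Gamma>"
  shows "card {y. reach \<Gamma> n x y} \<le> (D + 1) ^ n"
proof (induction n)
  case 0
  have "{y. reach \<Gamma> 0 x y} = {x}" by (auto simp: reach_def)
  then show ?case by simp
next
  case (Suc n)
  let ?N = "\<lambda>z. {y. \<exists>a. step \<Gamma> z a y}"
  have fin: "finite {y. reach \<Gamma> n x y}"
    using reach_lverts[OF \<Gamma>(1) _ x] \<Gamma>(1)
    by (auto simp: finite_lgraph_def intro: finite_subset[of _ "lverts \<Gamma>"])
  have "finite (ledges \<Gamma>)"
    using \<Gamma> by (auto simp: finite_lgraph_def intro: finite_subset)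
  have N: "card (?N z) \<le> D \<and> finite (?N z)" if "reach \<Gamma> n x z" for z
  proof -
    let ?E = "{(a, s, b) \<in> ledges \<Gamma>. a = z \<or> b = z}"
    have "finite ?E" using \<open>finite (ledges \<Gamma>)\<close> by (rule rev_finite_subset) auto
    moreover have "?N z \<subseteq> (\<lambda>(a, s, b). if a = z then b else a) ` ?E"
    proof
      fix y assume "y \<in> ?N z"
      then obtain a where a: "step \<Gamma> z a y" by blast
      show "y \<in> (\<lambda>(a, s, b). if a = z then b else a) ` ?E"
      proof (cases "snd a")
        case True
        then have "(z, fst a, y) \<in> ?E" using a by (simp add: step_def)
        then show ?thesis by (rule rev_image_eqI) simp
      next
        case False
        then have "(y, fst a, z) \<in> ?E" using a by (simp add: step_def)
        then show ?thesis by (rule rev_image_eqI) simp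
      qed
    qed
    ultimately have "card (?N z) \<le> card ?E" "finite (?N z)"
      by (auto intro: surj_card_le finite_surj)
    then show ?thesis using deg[OF reach_lverts[OF \<Gamma>(1) that x]] by linarith
  qed
  have "reach \<Gamma> n x y \<or> (\<exists>z. reach \<Gamma> n x z \<and> y \<in> ?N z)" if r: "reach \<Gamma> (Suc n) x y" for y
  proof -
    obtain ws where ws: "length ws \<le> Suc n" "walk \<Gamma> x ws y" using r unfolding reach_def by blast
    show ?thesis
    proof (cases ws rule: rev_cases)
      case (snoc vs a)
      then obtain z where "walk \<Gamma> x vs z" "step \<Gamma> z a y" using ws(2) by (auto simp: walk_append)
      moreover have "length vs \<le> n" using snoc ws(1) by simp
      ultimately show ?thesis unfolding reach_def by blast
    qed (use ws in simp)
  qed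
  then have "{y. reach \<Gamma> (Suc n) x y} \<subseteq> {y. reach \<Gamma> n x y} \<union> (\<Union>z\<in>{y. reach \<Gamma> n x y}. ?N z)"
    by blast
  then have "card {y. reach \<Gamma> (Suc n) x y} \<le> card ({y. reach \<Gamma> n x y} \<union> (\<Union>z\<in>{y. reach \<Gamma> n x y}. ?N z))"
    using fin N by (intro card_mono) auto
  also have "\<dots> \<le> card {y. reach \<Gamma> n x y} + card (\<Union>z\<in>{y. reach \<Gamma> n x y}. ?N z)"
    by (rule card_Un_le)
  also have "card (\<Union>z\<in>{y. reach \<Gamma> n x y}. ?N z) \<le> (\<Sum>z\<in>{y. reach \<Gamma> n x y}. card (?N z))"
    by (rule card_UN_le[OF fin])
  also have "\<dots> \<le> card {y. reach \<Gamma> n x y} * D"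
    using sum_bounded_above[of "{y. reach \<Gamma> n x y}" "\<lambda>z. card (?N z)" D] N by simp
  also have "card {y. reach \<Gamma> n x y} + card {y. reach \<Gamma> n x y} * D = card {y. reach \<Gamma> n x y} * (D + 1)"
    by simp
  also have "\<dots> \<le> (D + 1) ^ n * (D + 1)" using Suc by (rule mult_right_mono) simp
  finally show ?case by (simp add: mult.commute)
qed

text \<open>What is needed from an isomorphism of balls: short words can be read from \<open>x\<close>, and two of
  them end at the same vertex iff they are equal in the group.\<close>

definition locally_cayley ::
  "('g, 'a) monoid_scheme \<Rightarrow> 'g set \<Rightarrow> ('v, 'g) lgraph \<Rightarrow> nat \<Rightarrow> 'v \<Rightarrow> bool" where
  "locally_cayley G S \<Gamma> n x \<longleftrightarrow> x \<in> lverts \<Gamma> \<and>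
     (\<forall>ws\<in>words S n. \<exists>y. walk \<Gamma> x ws y) \<and>
     (\<forall>ws\<in>words S n. \<forall>vs\<in>words S n. \<forall>y z. walk \<Gamma> x ws y \<longrightarrow> walk \<Gamma> x vs z \<longrightarrow>
        (y = z \<longleftrightarrow> word_val G ws = word_val G vs))"

lemma locally_cayley_mono: "locally_cayley G S \<Gamma> n x \<Longrightarrow> m \<le> n \<Longrightarrow> locally_cayley G S \<Gamma> m x"
  unfolding locally_cayley_def using words_mono[of m n S] by (meson subsetD)

locale marked_group = group G for G (structure) +
  fixes S
  assumes generating: "finite_generating_set G S"
begin

lemma finite_S: "finite S" and S_carrier: "S \<subseteq> carrier G" and generate_S: "generate G S = carrier G"
  using generating by (auto simp: finite_generating_set_def)

lemma letter_closed [simp]: "a \<in> S \<times> UNIV \<Longrightarrow> letter G a \<in> carrier G"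
  using S_carrier by (auto simp: letter_def)

lemma word_val_closed: "set ws \<subseteq> S \<times> UNIV \<Longrightarrow> word_val G ws \<in> carrier G"
  by (induction ws) auto

lemma word_val_append:
  "set ws \<subseteq> S \<times> UNIV \<Longrightarrow> set vs \<subseteq> S \<times> UNIV \<Longrightarrow>
     word_val G (ws @ vs) = word_val G ws \<otimes> word_val G vs"
  by (induction ws) (auto simp: m_assoc word_val_closed)

lemma word_val_rev: "set ws \<subseteq> S \<times> UNIV \<Longrightarrow> word_val G (rev_word ws) = inv (word_val G ws)"
proof (induction ws)
  case (Cons a ws)
  have "set (rev_word ws) \<subseteq> S \<times> UNIV" "a \<in> S \<times> UNIV" "fst a \<in> carrier G"
    using Cons.prems S_carrier by (auto simp: rev_word_def)
  then show ?case
    using Cons word_val_append[of "rev_word ws" "[(fst a, \<not> snd a)]"]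
    by (auto simp: rev_word_def letter_def word_val_closed inv_mult_group)
qed (simp add: rev_word_def)

lemma word_val_surj:
  assumes "g \<in> carrier G" shows "\<exists>ws. set ws \<subseteq> S \<times> UNIV \<and> word_val G ws = g"
proof -
  have "g \<in> generate G S" using assms generate_S by simp
  then show ?thesis
  proof (induction rule: generate.induct)
    case one show ?case by (intro exI[of _ "[]"]) simp
  next
    case (incl h) then show ?case using S_carrier by (intro exI[of _ "[(h, True)]"]) (auto simp: letter_def)
  next
    case (inv h) then show ?case using S_carrier by (intro exI[of _ "[(h, False)]"]) (auto simp: letter_def)
  next
    case (eng h1 h2)
    then obtain ws vs where "set ws \<subseteq> S \<times> UNIV" "word_val G ws = h1"
      "set vs \<subseteq> S \<times> UNIV" "word_val G vs = h2" by blast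
    then show ?case using word_val_append by (intro exI[of _ "ws @ vs"]) auto
  qed
qed

definition geodesic :: "'a \<Rightarrow> ('a \<times> bool) list" where
  "geodesic g = (ARG_MIN length ws. set ws \<subseteq> S \<times> UNIV \<and> word_val G ws = g)"

definition len :: "'a \<Rightarrow> nat" where "len g = length (geodesic g)"

definition wball :: "nat \<Rightarrow> 'a set" where "wball n = {g \<in> carrier G. len g \<le> n}"

lemma geodesic:
  assumes "g \<in> carrier G"
  shows "set (geodesic g) \<subseteq> S \<times> UNIV" "word_val G (geodesic g) = g"
  using word_val_surj[OF assms] unfolding geodesic_def
  by (metis (mono_tags, lifting) arg_min_natI)+

lemma len_word_val_le: "set ws \<subseteq> S \<times> UNIV \<Longrightarrow> len (word_val G ws) \<le> length ws"
  unfolding len_def geodesic_def by (rule arg_min_nat_le) auto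

lemma geodesic_one [simp]: "geodesic \<one> = []"
  using len_word_val_le[of "[]"] by (simp add: len_def)

lemma geodesic_words: "g \<in> carrier G \<Longrightarrow> len g \<le> n \<Longrightarrow> geodesic g \<in> words S n"
  using geodesic(1) by (auto simp: words_def len_def)

lemma wball_closed: "g \<in> wball n \<Longrightarrow> g \<in> carrier G"
  by (simp add: wball_def)

lemma finite_wball: "finite (wball n)"
proof (rule finite_subset)
  show "wball n \<subseteq> word_val G ` words S n"
    using geodesic(2) geodesic_words by (force simp: wball_def)
qed (simp add: finite_words finite_S)

lemma countable_carrier: "countable (carrier G)"
proof -
  have "carrier G = (\<Union>n. wball n)" by (auto simp: wball_def)
  then show ?thesis using finite_wball by (auto intro: countable_finite)
qed

lemma walk_cayley:
  "x \<in> carrier G \<Longrightarrow> set ws \<subseteq> S \<times> UNIV \<Longrightarrow> walk (cayley_graph G S) x ws (x \<otimes> word_val G ws)"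
proof (induction ws arbitrary: x)
  case (Cons a ws)
  have a: "fst a \<in> S" "fst a \<in> carrier G" "set ws \<subseteq> S \<times> UNIV" "letter G a \<in> carrier G"
    using Cons.prems S_carrier by auto
  have "step (cayley_graph G S) x a (x \<otimes> letter G a)"
    using Cons.prems(1) a by (auto simp: step_def cayley_graph_def letter_def m_assoc intro!: exI)
  moreover have "walk (cayley_graph G S) (x \<otimes> letter G a) ws (x \<otimes> letter G a \<otimes> word_val G ws)"
    using Cons.IH Cons.prems(1) a by simp
  ultimately show ?case
    using Cons.prems a by (auto simp: m_assoc word_val_closed)
qed simp

text \<open>Let \<open>f\<close> be the isomorphism of balls. A walk from \<open>x\<close> that is at most as long as the radius
  stays in the ball, so by induction on the word \<open>f\<close> maps its end to the value of the word. Conversely,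
  the corresponding walk in the Cayley graph can be lifted edge by edge through \<open>f\<close>.\<close>

lemma locally_cayley_if_good:
  assumes \<Gamma>: "finite_lgraph S \<Gamma>" and x: "x \<in> sofic_good_vertices G S \<Gamma> (real n)"
  shows "locally_cayley G S \<Gamma> n x"
proof -
  let ?C = "cayley_graph G S"
  let ?B = "{y \<in> lverts \<Gamma>. reach \<Gamma> n x y}" and ?B' = "{y \<in> carrier G. reach ?C n \<one> y}"
  have xV: "x \<in> lverts \<Gamma>" using x by (simp add: sofic_good_vertices_def)
  obtain f where f: "bij_betw f ?B ?B'" "f x = \<one>"
    and edges: "\<And>a b s. a \<in> ?B \<Longrightarrow> b \<in> ?B \<Longrightarrow> (a, s, b) \<in> ledges \<Gamma> \<longleftrightarrow>
        f a \<in> carrier G \<and> s \<in> S \<and> f b = f a \<otimes> s"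
  proof -
    have B: "gball \<Gamma> x (real n) = ?B" "gball ?C \<one> (real n) = ?B'"
      by (auto simp: eball_def gdist_le_iff_reach cayley_graph_def)
    obtain f where f: "bij_betw f ?B ?B'" "f x = \<one>"
      and edges: "\<And>a b s. a \<in> ?B \<Longrightarrow> b \<in> ?B \<Longrightarrow>
          (a, s, b) \<in> ledges (induced_lgraph \<Gamma> ?B) \<longleftrightarrow> (f a, s, f b) \<in> ledges (induced_lgraph ?C ?B')"
    proof -
      have lv: "lverts (induced_lgraph \<Gamma> ?B) = ?B" "lverts (induced_lgraph ?C ?B') = ?B'"
        by (auto simp: induced_lgraph_def cayley_graph_def)
      have "rooted_iso (induced_lgraph \<Gamma> ?B) x (induced_lgraph ?C ?B') \<one>"
        using x unfolding sofic_good_vertices_def mem_Collect_eq B by blast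
      then obtain f where f: "bij_betw f ?B ?B'" "f x = \<one>" and
        e: "\<forall>a\<in>?B. \<forall>b\<in>?B. \<forall>s. (a, s, b) \<in> ledges (induced_lgraph \<Gamma> ?B) \<longleftrightarrow>
              (f a, s, f b) \<in> ledges (induced_lgraph ?C ?B')"
        unfolding rooted_iso_def lv by blast
      show ?thesis by (rule that[OF f]) (use e in blast)
    qed
    have "(a, s, b) \<in> ledges \<Gamma> \<longleftrightarrow> f a \<in> carrier G \<and> s \<in> S \<and> f b = f a \<otimes> s"
      if ab: "a \<in> ?B" "b \<in> ?B" for a b s
    proof -
      have "f a \<in> ?B'" "f b \<in> ?B'" using f(1) ab by (auto simp: bij_betw_def)
      then show ?thesis
        using edges[OF ab, of s] ab by (auto simp: induced_lgraph_def cayley_graph_def)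
    qed
    then show ?thesis by (rule that[OF f])
  qed
  have fB: "f y \<in> carrier G" if "y \<in> ?B" for y using f(1) that by (auto simp: bij_betw_def)
  have val: "y \<in> ?B \<and> f y = word_val G ws" if "walk \<Gamma> x ws y" "length ws \<le> n" for ws y
    using that
  proof (induction ws arbitrary: y rule: rev_induct)
    case Nil then show ?case using f(2) xV by simp
  next
    case (snoc a ws)
    obtain z where z: "walk \<Gamma> x ws z" "step \<Gamma> z a y" using snoc.prems(1) by (auto simp: walk_append)
    have IH: "z \<in> ?B" "f z = word_val G ws" using snoc.IH[OF z(1)] snoc.prems(2) by auto
    have y: "y \<in> ?B"
      using snoc.prems walk_finite_lgraph(2)[OF \<Gamma> snoc.prems(1) xV] unfolding reach_def by blast
    have ws: "set ws \<subseteq> S \<times> UNIV" "a \<in> S \<times> UNIV"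
      using walk_finite_lgraph(1)[OF \<Gamma> snoc.prems(1)] by auto
    then have aS: "fst a \<in> carrier G" using S_carrier by auto
    have "f y = f z \<otimes> letter G a"
    proof (cases "snd a")
      case True
      then show ?thesis using z(2) edges[OF IH(1) y, of "fst a"] by (simp add: step_def letter_def)
    next
      case False
      then have "f z = f y \<otimes> fst a" using z(2) edges[OF y IH(1), of "fst a"] by (simp add: step_def)
      then show ?thesis using False fB[OF y] aS by (simp add: letter_def m_assoc)
    qed
    moreover have "word_val G (ws @ [a]) = word_val G ws \<otimes> letter G a"
      using word_val_append[OF ws(1), of "[a]"] ws(2) by simp
    ultimately show ?case using y IH(2) by simp
  qed
  have ex: "\<exists>y. walk \<Gamma> x ws y" if "ws \<in> words S n" for ws
    using that
  proof (induction ws rule: rev_induct)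
    case (snoc a ws)
    have ws: "set ws \<subseteq> S \<times> UNIV" "a \<in> S \<times> UNIV" "length (ws @ [a]) \<le> n"
      using snoc.prems by (auto simp: words_def)
    then have aS: "fst a \<in> carrier G" "fst a \<in> S" using S_carrier by auto
    obtain z where z: "walk \<Gamma> x ws z" using snoc.IH ws by (auto simp: words_def)
    have zB: "z \<in> ?B" "f z = word_val G ws" using val[OF z] ws(3) by auto
    let ?c = "word_val G (ws @ [a])"
    have c: "?c = f z \<otimes> letter G a" "?c \<in> carrier G"
      using word_val_append[OF ws(1), of "[a]"] ws zB word_val_closed[of "ws @ [a]"] by auto
    have "walk ?C \<one> (ws @ [a]) ?c" using walk_cayley[of \<one> "ws @ [a]"] ws c by simp
    then have "?c \<in> ?B'" using ws(3) c(2) unfolding reach_def by blast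
    then obtain y where y: "y \<in> ?B" "f y = ?c" 
      unfolding bij_betw_imp_surj_on[OF f(1), symmetric] by (elim imageE) simp
    have "step \<Gamma> z a y"
    proof (cases "snd a")
      case True
      then show ?thesis using edges[OF zB(1) y(1), of "fst a"] fB[OF zB(1)] aS y(2) c
        by (simp add: step_def letter_def)
    next
      case False
      then have "f z = f y \<otimes> fst a" using y(2) c fB[OF zB(1)] aS by (simp add: letter_def m_assoc)
      then show ?thesis using False edges[OF y(1) zB(1), of "fst a"] fB[OF y(1)] aS by (simp add: step_def)
    qed
    then show ?case using z by (auto simp: walk_append)
  qed auto
  have "y = z \<longleftrightarrow> word_val G ws = word_val G vs"
    if "ws \<in> words S n" "vs \<in> words S n" "walk \<Gamma> x ws y" "walk \<Gamma> x vs z" for ws vs y z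
  proof -
    have "y \<in> ?B" "f y = word_val G ws" "z \<in> ?B" "f z = word_val G vs"
      using val[of ws y] val[of vs z] that by (auto simp: words_def)
    then show ?thesis using inj_on_eq_iff[OF bij_betw_imp_inj_on[OF f(1)], of y z] by simp
  qed
  then show ?thesis unfolding locally_cayley_def using xV ex by (intro conjI ballI allI impI) simp_all
qed

text \<open>The vertex \<open>x \<cdot> g\<close>. Its value is arbitrary unless the graph looks like the Cayley graph
  near \<open>x\<close>. For \<open>g = 1\<close> the word is empty, so that \<open>x \<cdot> 1 = x\<close> always holds.\<close>

definition pact :: "('v, 'a) lgraph \<Rightarrow> 'v \<Rightarrow> 'a \<Rightarrow> 'v" where
  "pact \<Gamma> x g = (SOME y. walk \<Gamma> x (geodesic g) y)"

text \<open>The group element that leads from \<open>x\<close> to \<open>y\<close>. Taking a shortest walk ensures that its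
  length is bounded by the distance even at vertices where the graph does not look like the Cayley
  graph; the value \<open>1\<close> for unreachable \<open>y\<close> is arbitrary.\<close>

definition displacement :: "('v, 'a) lgraph \<Rightarrow> 'v \<Rightarrow> 'v \<Rightarrow> 'a" where
  "displacement \<Gamma> x y =
     (if \<exists>ws. walk \<Gamma> x ws y then word_val G (ARG_MIN length ws. walk \<Gamma> x ws y) else \<one>)"

lemma pact_one [simp]: "pact \<Gamma> x \<one> = x"
  by (simp add: pact_def)

lemma displacement_self [simp]: "displacement \<Gamma> x x = \<one>"
proof -
  have "length (ARG_MIN length ws. walk \<Gamma> x ws x) \<le> length []"
    using arg_min_nat_le[of "\<lambda>ws. walk \<Gamma> x ws x" "[]" length] by simp
  then show ?thesis by (auto simp: displacement_def)
qed

lemma displacement_closed: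
  assumes "finite_lgraph S \<Gamma>" shows "displacement \<Gamma> x y \<in> carrier G"
proof (cases "\<exists>ws. walk \<Gamma> x ws y")
  case True
  then have "walk \<Gamma> x (ARG_MIN length ws. walk \<Gamma> x ws y) y" by (metis arg_min_natI)
  then show ?thesis
    using True walk_finite_lgraph(1)[OF assms] word_val_closed by (auto simp: displacement_def)
qed (auto simp: displacement_def)

lemma displacement_wball:
  assumes "finite_lgraph S \<Gamma>" "reach \<Gamma> r x y" shows "displacement \<Gamma> x y \<in> wball r"
proof -
  obtain ws where ws: "length ws \<le> r" "walk \<Gamma> x ws y" using assms(2) by (auto simp: reach_def)
  let ?v = "ARG_MIN length ws. walk \<Gamma> x ws y"
  have v: "walk \<Gamma> x ?v y" "length ?v \<le> length ws"
    using ws(2) arg_min_natI[of "\<lambda>us. walk \<Gamma> x us y" _ length]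
      arg_min_nat_le[of "\<lambda>us. walk \<Gamma> x us y" _ length] by blast+
  have S: "set ?v \<subseteq> S \<times> UNIV" using walk_finite_lgraph(1)[OF assms(1) v(1)] .
  have "displacement \<Gamma> x y = word_val G ?v" using ws(2) by (auto simp: displacement_def)
  then show ?thesis
    using len_word_val_le[OF S] word_val_closed[OF S] v(2) ws(1) by (simp add: wball_def)
qed

context
  fixes \<Gamma> :: "('v, 'a) lgraph" and n x
  assumes \<Gamma>: "finite_lgraph S \<Gamma>" and lc: "locally_cayley G S \<Gamma> n x"
begin

lemma walk_unique:
  assumes "walk \<Gamma> x ws y" "walk \<Gamma> x vs z" "length ws \<le> n" "length vs \<le> n"
  shows "y = z \<longleftrightarrow> word_val G ws = word_val G vs"
  using lc assms walk_finite_lgraph(1)[OF \<Gamma>] unfolding locally_cayley_def words_def by blast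

lemma walk_pact: "g \<in> carrier G \<Longrightarrow> len g \<le> n \<Longrightarrow> walk \<Gamma> x (geodesic g) (pact \<Gamma> x g)"
  unfolding pact_def using lc geodesic_words by (auto simp: locally_cayley_def intro: someI_ex)

lemma pact_word_val:
  assumes "walk \<Gamma> x ws y" "length ws \<le> n" shows "pact \<Gamma> x (word_val G ws) = y"
proof -
  have ws: "set ws \<subseteq> S \<times> UNIV" using walk_finite_lgraph(1)[OF \<Gamma> assms(1)] .
  then have l: "len (word_val G ws) \<le> n" using len_word_val_le assms(2) order_trans by blast
  show ?thesis
    using walk_unique[OF walk_pact[OF word_val_closed[OF ws] l] assms(1) _ assms(2)] l
      geodesic(2)[OF word_val_closed[OF ws]] by (simp add: len_def)
qed

lemma displacement_word_val:
  assumes "walk \<Gamma> x ws y" "length ws \<le> n" shows "displacement \<Gamma> x y = word_val G ws"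
proof -
  let ?v = "ARG_MIN length ws. walk \<Gamma> x ws y"
  have "walk \<Gamma> x ?v y" "length ?v \<le> length ws"
    using assms(1) arg_min_natI[of "\<lambda>us. walk \<Gamma> x us y" _ length]
      arg_min_nat_le[of "\<lambda>us. walk \<Gamma> x us y" _ length] by blast+
  then have "word_val G ?v = word_val G ws"
    using walk_unique[OF _ assms(1) _ assms(2), of ?v y] assms(2) by simp
  then show ?thesis using assms(1) by (auto simp: displacement_def)
qed

lemma displacement_pact:
  "g \<in> carrier G \<Longrightarrow> len g \<le> n \<Longrightarrow> displacement \<Gamma> x (pact \<Gamma> x g) = g"
  using displacement_word_val[OF walk_pact] geodesic(2) by (simp add: len_def)

lemma reach_pact: "g \<in> carrier G \<Longrightarrow> len g \<le> n \<Longrightarrow> reach \<Gamma> (len g) x (pact \<Gamma> x g)"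
  unfolding reach_def len_def using walk_pact by (metis len_def order_refl)

lemma pact_displacement:
  assumes "reach \<Gamma> r x y" "r \<le> n"
  shows "pact \<Gamma> x (displacement \<Gamma> x y) = y" "displacement \<Gamma> x y \<in> wball r"
proof -
  obtain ws where ws: "length ws \<le> r" "walk \<Gamma> x ws y" using assms(1) by (auto simp: reach_def)
  have S: "set ws \<subseteq> S \<times> UNIV" using walk_finite_lgraph(1)[OF \<Gamma> ws(2)] .
  have "length ws \<le> n" using ws(1) assms(2) by simp
  then show "pact \<Gamma> x (displacement \<Gamma> x y) = y" "displacement \<Gamma> x y \<in> wball r"
    using displacement_word_val[OF ws(2)] pact_word_val[OF ws(2)] word_val_closed[OF S]
      len_word_val_le[OF S] ws(1) by (auto simp: wball_def)
qed

text \<open>Everything is read from \<open>x\<close>: the walk along \<open>k\<close> that starts at \<open>x \<cdot> g\<close> is the end of a walk from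
  \<open>x\<close>, so the ball around \<open>x\<close> determines it.\<close>

lemma pact_mult:
  assumes "g \<in> carrier G" "k \<in> carrier G" "len g + len k \<le> n"
  shows "pact \<Gamma> (pact \<Gamma> x g) k = pact \<Gamma> x (g \<otimes> k)"
    and "reach \<Gamma> (len k) (pact \<Gamma> x g) (pact \<Gamma> x (g \<otimes> k))"
proof -
  let ?w = "geodesic g @ geodesic k"
  have S: "set (geodesic g) \<subseteq> S \<times> UNIV" "set (geodesic k) \<subseteq> S \<times> UNIV" using geodesic(1) assms by auto
  have val: "word_val G ?w = g \<otimes> k" using word_val_append S geodesic(2) assms by simp
  have l: "length ?w \<le> n" using assms(3) by (simp add: len_def)
  have g: "walk \<Gamma> x (geodesic g) (pact \<Gamma> x g)" using walk_pact assms by simp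
  have "?w \<in> words S n" using S l by (auto simp: words_def)
  then obtain z where z: "walk \<Gamma> x ?w z" using lc unfolding locally_cayley_def by blast
  have end_z: "y = z" if "walk \<Gamma> (pact \<Gamma> x g) (geodesic k) y" for y
    using walk_unique[OF _ z l l, of y] that g by (auto simp: walk_append)
  obtain y where "walk \<Gamma> x (geodesic g) y" "walk \<Gamma> y (geodesic k) z" using z by (auto simp: walk_append)
  moreover have "y = pact \<Gamma> x g"
    using walk_unique[OF calculation(1) g] assms(3) by (simp add: len_def)
  ultimately have kz: "walk \<Gamma> (pact \<Gamma> x g) (geodesic k) z" by simp
  then have "pact \<Gamma> (pact \<Gamma> x g) k = z" unfolding pact_def[of _ _ k] using end_z by (metis someI)
  then show "pact \<Gamma> (pact \<Gamma> x g) k = pact \<Gamma> x (g \<otimes> k)" using pact_word_val[OF z l] val by simp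
  show "reach \<Gamma> (len k) (pact \<Gamma> x g) (pact \<Gamma> x (g \<otimes> k))"
    using kz pact_word_val[OF z l] val unfolding reach_def len_def by auto
qed

text \<open>The shortest word from \<open>y\<close> to \<open>z\<close> has length at most \<open>2 * r\<close>, so that together with a walk to
  \<open>y\<close> it has length at most \<open>3 * r\<close> and can be evaluated at \<open>x\<close>.\<close>

lemma displacement_cocycle:
  assumes "reach \<Gamma> r x y" "reach \<Gamma> r x z" "3 * r \<le> n"
  shows "displacement \<Gamma> x z = displacement \<Gamma> x y \<otimes> displacement \<Gamma> y z"
proof -
  obtain ws vs where ws: "length ws \<le> r" "walk \<Gamma> x ws y" and vs: "length vs \<le> r" "walk \<Gamma> x vs z"
    using assms by (auto simp: reach_def)
  let ?v = "ARG_MIN length us. walk \<Gamma> y us z"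
  have yz: "walk \<Gamma> y (rev_word ws @ vs) z" using walk_rev[OF ws(2)] vs(2) by (auto simp: walk_append)
  then have v: "walk \<Gamma> y ?v z" "length ?v \<le> length (rev_word ws @ vs)"
    using arg_min_natI[of "\<lambda>us. walk \<Gamma> y us z" _ length]
      arg_min_nat_le[of "\<lambda>us. walk \<Gamma> y us z" _ length] by blast+
  have d: "displacement \<Gamma> y z = word_val G ?v" using yz by (auto simp: displacement_def)
  have wv: "walk \<Gamma> x (ws @ ?v) z" using ws(2) v(1) by (auto simp: walk_append)
  have "length (ws @ ?v) \<le> n" using ws vs v assms(3) by simp
  then have "displacement \<Gamma> x z = word_val G (ws @ ?v)" by (rule displacement_word_val[OF wv])
  also have "\<dots> = word_val G ws \<otimes> word_val G ?v"
    using walk_finite_lgraph(1)[OF \<Gamma> ws(2)] walk_finite_lgraph(1)[OF \<Gamma> v(1)] by (rule word_val_append)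
  finally show ?thesis using displacement_word_val[OF ws(2)] ws(1) assms(3) d by simp
qed

end

lemma len_mult:
  assumes "g \<in> carrier G" "k \<in> carrier G" shows "len (g \<otimes> k) \<le> len g + len k"
  using len_word_val_le[of "geodesic g @ geodesic k"] word_val_append[of "geodesic g" "geodesic k"]
    geodesic[OF assms(1)] geodesic[OF assms(2)] by (simp add: len_def)

end

section \<open>The space of coloured configurations\<close>

definition lex_less :: "(nat \<Rightarrow> nat) \<Rightarrow> (nat \<Rightarrow> nat) \<Rightarrow> bool" where
  "lex_less b c \<longleftrightarrow> (\<exists>r. b r < c r \<and> (\<forall>s<r. b s = c s))"

lemma lex_lessI: "b r < c r \<and> (\<forall>s<r. b s = c s) \<Longrightarrow> lex_less b c"
  unfolding lex_less_def by blast

lemma lex_less_asym: "lex_less b c \<Longrightarrow> \<not> lex_less c b"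
proof
  assume "lex_less b c" "lex_less c b"
  then obtain r t where "b r < c r" "\<forall>s<r. b s = c s" "c t < b t" "\<forall>s<t. c s = b s"
    unfolding lex_less_def by blast
  then show False by (cases r t rule: linorder_cases) auto
qed

lemma lex_less_trans: "lex_less b c \<Longrightarrow> lex_less c d \<Longrightarrow> lex_less b d"
proof -
  assume "lex_less b c" "lex_less c d"
  then obtain r t where rt: "b r < c r" "\<forall>s<r. b s = c s" "c t < d t" "\<forall>s<t. c s = d s"
    unfolding lex_less_def by blast
  then have "b (min r t) < d (min r t) \<and> (\<forall>s<min r t. b s = d s)"
    by (cases r t rule: linorder_cases) auto
  then show ?thesis unfolding lex_less_def by blast
qed

text \<open>Since \<open>b\<close> and \<open>c\<close> differ at \<open>r\<close>, looking at coordinates up to \<open>r\<close> is enough to compare them. This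
  locality is what allows the comparison to pass to the limit.\<close>

lemma lex_less_total:
  fixes b c :: "nat \<Rightarrow> nat"
  assumes "b r \<noteq> c r" shows "(\<exists>t\<le>r. b t < c t \<and> (\<forall>s<t. b s = c s)) \<or> (\<exists>t\<le>r. c t < b t \<and> (\<forall>s<t. c s = b s))"
proof -
  let ?t = "LEAST t. b t \<noteq> c t"
  have t: "b ?t \<noteq> c ?t" by (rule LeastI[of "\<lambda>t. b t \<noteq> c t", OF assms])
  have le: "?t \<le> r" by (rule Least_le[of "\<lambda>t. b t \<noteq> c t", OF assms])
  have eq: "\<forall>s<?t. b s = c s"
    using not_less_Least[of _ "\<lambda>t. b t \<noteq> c t"] by blast
  show ?thesis
  proof (cases "b ?t < c ?t")
    case True
    then show ?thesis using le eq by blast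
  next
    case False
    then have "c ?t < b ?t" using t by simp
    moreover have "\<forall>s<?t. c s = b s" by (intro allI impI sym[OF eq[rule_format]])
    ultimately show ?thesis using le by blast
  qed
qed

locale group_pair = GG: marked_group G SG + HH: marked_group H SH
  for G :: "('g, 'a) monoid_scheme" and SG and H :: "('h, 'b) monoid_scheme" and SH
begin

abbreviation mult_G (infixl "\<cdot>" 70) where "a \<cdot> b \<equiv> a \<otimes>\<^bsub>G\<^esub> b"
abbreviation mult_H (infixl "\<star>" 70) where "a \<star> b \<equiv> a \<otimes>\<^bsub>H\<^esub> b"
abbreviation one_G ("\<one>\<^sub>G") where "\<one>\<^sub>G \<equiv> \<one>\<^bsub>G\<^esub>"
abbreviation one_H ("\<one>\<^sub>H") where "\<one>\<^sub>H \<equiv> \<one>\<^bsub>H\<^esub>"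
abbreviation inv_G ("inv\<^sub>G _" [81] 80) where "inv\<^sub>G a \<equiv> inv\<^bsub>G\<^esub> a"
abbreviation inv_H ("inv\<^sub>H _" [81] 80) where "inv\<^sub>H a \<equiv> inv\<^bsub>H\<^esub> a"

text \<open>A configuration is coded by one sequence of naturals: at the pair \<open>(eG k, 0)\<close> it stores the
  index of the value at \<open>k\<close>, and at \<open>(eG k, Suc r)\<close> the colour of \<open>k\<close> for the distance \<open>r\<close>. The unit of
  \<open>H\<close> gets index \<open>0\<close>, so that it comes first when values are compared by their index.\<close>

definition eG :: "'g \<Rightarrow> nat" where "eG = to_nat_on (carrier G)"

definition eH :: "'h \<Rightarrow> nat" where
  "eH h = (if h = \<one>\<^sub>H then 0 else Suc (to_nat_on (carrier H) h))"

definition loc :: "(nat \<Rightarrow> nat) \<Rightarrow> 'g \<Rightarrow> 'h" where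
  "loc w k = inv_into (carrier H) eH (w (prod_encode (eG k, 0)))"

definition col :: "(nat \<Rightarrow> nat) \<Rightarrow> 'g \<Rightarrow> nat \<Rightarrow> nat" where
  "col w k r = w (prod_encode (eG k, Suc r))"

text \<open>The code of the map \<open>f\<close> with the colours \<open>b\<close>; \<open>loc\<close> and \<open>col\<close> recover them. Coordinates
  that are not used are \<open>0\<close>, so that codes of finite groups are unique as well.\<close>

definition config :: "('g \<Rightarrow> 'h) \<Rightarrow> ('g \<Rightarrow> nat \<Rightarrow> nat) \<Rightarrow> nat \<Rightarrow> nat" where
  "config f b m = (case prod_decode m of (i, r) \<Rightarrow>
     if i \<in> eG ` carrier G
     then case r of 0 \<Rightarrow> eH (f (inv_into (carrier G) eG i)) | Suc s \<Rightarrow> b (inv_into (carrier G) eG i) s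
     else 0)"

text \<open>For every \<open>r\<close>, a proper colouring of the graph on \<open>G\<close> that joins elements at distance at
  most \<open>r\<close>.\<close>

definition separated :: "('g \<Rightarrow> nat \<Rightarrow> nat) \<Rightarrow> bool" where
  "separated b \<longleftrightarrow> (\<forall>k\<in>carrier G. \<forall>r. \<forall>v\<in>GG.wball r. v \<noteq> \<one>\<^sub>G \<longrightarrow> b k r \<noteq> b (k \<cdot> v) r)"

definition Omega :: "(nat \<Rightarrow> nat) set" where
  "Omega = {w. (\<forall>i r. i \<notin> eG ` carrier G \<longrightarrow> w (prod_encode (i, r)) = 0) \<and>
     (\<forall>k\<in>carrier G. w (prod_encode (eG k, 0)) \<in> eH ` carrier H) \<and> separated (col w)}"

lemma inj_eG: "inj_on eG (carrier G)"
  unfolding eG_def using GG.countable_carrier by (rule inj_on_to_nat_on)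

lemma inj_eH: "inj_on eH (carrier H)"
  using inj_on_to_nat_on[OF HH.countable_carrier] by (auto simp: inj_on_def eH_def)

lemma eH_one [simp]: "eH \<one>\<^sub>H = 0" and eH_eq_0: "eH h = 0 \<longleftrightarrow> h = \<one>\<^sub>H"
  by (auto simp: eH_def)

lemma loc_config: "k \<in> carrier G \<Longrightarrow> f k \<in> carrier H \<Longrightarrow> loc (config f b) k = f k"
  by (simp add: loc_def config_def inv_into_f_f[OF inj_eG] inv_into_f_f[OF inj_eH])

lemma col_config: "k \<in> carrier G \<Longrightarrow> col (config f b) k = b k"
  by (rule ext) (simp add: col_def config_def inv_into_f_f[OF inj_eG])

lemma separated_cong:
  assumes "\<And>k. k \<in> carrier G \<Longrightarrow> b k = c k" shows "separated b = separated c"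
proof -
  have "b k r = c k r \<and> b (k \<cdot> v) r = c (k \<cdot> v) r" if "k \<in> carrier G" "v \<in> GG.wball r'" for k v r r'
    using assms that GG.wball_closed by simp
  then show ?thesis unfolding separated_def by (metis (no_types, lifting))
qed

lemma config_in_Omega:
  assumes "\<And>k. k \<in> carrier G \<Longrightarrow> f k \<in> carrier H" "separated b"
  shows "config f b \<in> Omega"
proof -
  have "separated (col (config f b))" using assms(2) separated_cong[of "col (config f b)" b] col_config by simp
  then show ?thesis
    using assms(1) by (auto simp: Omega_def config_def inv_into_f_f[OF inj_eG])
qed

lemma loc_closed: "w \<in> Omega \<Longrightarrow> k \<in> carrier G \<Longrightarrow> loc w k \<in> carrier H"
  by (auto simp: Omega_def loc_def inv_into_into)

lemma eH_loc: "w \<in> Omega \<Longrightarrow> k \<in> carrier G \<Longrightarrow> eH (loc w k) = w (prod_encode (eG k, 0))"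
  by (auto simp: Omega_def loc_def f_inv_into_f)

lemma separated_col: "w \<in> Omega \<Longrightarrow> separated (col w)"
  by (simp add: Omega_def)

lemma Omega_eqI:
  assumes "w \<in> Omega" "w' \<in> Omega"
    and "\<And>k. k \<in> carrier G \<Longrightarrow> loc w k = loc w' k" "\<And>k. k \<in> carrier G \<Longrightarrow> col w k = col w' k"
  shows "w = w'"
proof
  fix m
  obtain i r where m: "m = prod_encode (i, r)" by (metis prod.exhaust prod_decode_inverse)
  show "w m = w' m"
  proof (cases "i \<in> eG ` carrier G")
    case False
    then show ?thesis using assms(1,2) by (simp add: Omega_def m)
  next
    case True
    then obtain k where k: "k \<in> carrier G" "i = eG k" by blast
    show ?thesis
    proof (cases r)
      case 0
      then show ?thesis using eH_loc[OF assms(1) k(1)] eH_loc[OF assms(2) k(1)] assms(3)[OF k(1)] m k(2) by simp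
    next
      case (Suc s)
      then show ?thesis using fun_cong[OF assms(4)[OF k(1)], of s] m k(2) by (simp add: col_def)
    qed
  qed
qed

text \<open>Conditions on finitely many values and colours define cylinders in the space of all
  sequences, since \<open>loc\<close> and \<open>col\<close> are defined there.\<close>

lemma cylinder_config:
  assumes "finite K"
    and "\<And>w w'. (\<And>k. k \<in> K \<Longrightarrow> loc w k = loc w' k) \<Longrightarrow>
          (\<And>k r. k \<in> K \<Longrightarrow> r \<le> R \<Longrightarrow> col w k r = col w' k r) \<Longrightarrow> P w = P w'"
  shows "cylinder {w. P w}"
proof (rule cylinder_Collect)
  let ?J = "(\<lambda>(k, r). prod_encode (eG k, r)) ` (K \<times> {..Suc R})"
  show "finite ?J" using assms(1) by simp
  fix w w' :: "nat \<Rightarrow> nat" assume eq: "\<And>i. i \<in> ?J \<Longrightarrow> w i = w' i"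
  have "w (prod_encode (eG k, r)) = w' (prod_encode (eG k, r))" if "k \<in> K" "r \<le> Suc R" for k r
    using that by (intro eq) (auto intro!: rev_image_eqI[of "(k, r)"])
  then show "P w = P w'" by (intro assms(2)) (simp_all add: loc_def col_def)
qed

definition BOmega :: "(nat \<Rightarrow> nat) measure" where "BOmega = restrict_space borel Omega"

lemma space_BOmega [simp]: "space BOmega = Omega"
  by (simp add: BOmega_def space_restrict_space)

text \<open>Each condition in the definition of \<open>Omega\<close> involves at most two coordinates. This is why
  colours are required to differ locally and not just to be injective: the latter would only be a
  countable intersection of open conditions.\<close>

lemma closed_Omega: "closed Omega"
proof -
  have 1: "cylinder {w :: nat \<Rightarrow> nat. Q (w m)}" for Q m
    by (rule cylinder_Collect[of "{m}"]) auto
  have 2: "cylinder {w. col w k r \<noteq> col w k' r}" for k k' r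
    by (rule cylinder_config[of "{k, k'}" r]) auto
  have "Omega = (\<Inter>i\<in>- eG ` carrier G. \<Inter>r. {w. w (prod_encode (i, r)) = 0}) \<inter>
     (\<Inter>k\<in>carrier G. {w. w (prod_encode (eG k, 0)) \<in> eH ` carrier H}) \<inter>
     (\<Inter>k\<in>carrier G. \<Inter>r. \<Inter>v\<in>GG.wball r - {\<one>\<^sub>G}. {w. col w k r \<noteq> col w (k \<cdot> v) r})"
    by (auto simp: Omega_def separated_def)
  then show ?thesis
    by (simp only:) (intro closed_Int closed_INT ballI closed_cylinder 1 2)
qed

lemma Omega_borel: "Omega \<in> sets borel" using closed_Omega by (rule borel_closed)

lemma euclidean_nat_discrete: "(euclidean :: nat topology) = discrete_topology UNIV"
  by (simp add: topology_eq open_discrete)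

lemma standard_borel_BOmega:
  assumes "sets M = sets BOmega" shows "standard_borel M"
proof -
  have sp: "space M = Omega" using sets_eq_imp_space_eq[OF assms] by simp
  let ?T = "subtopology euclidean Omega"
  have "completely_metrizable_space (product_topology (\<lambda>_ :: nat. euclidean :: nat topology) UNIV)"
    by (simp add: completely_metrizable_space_product_topology euclidean_nat_discrete
        completely_metrizable_space_discrete_topology)
  then have "completely_metrizable_space (euclidean :: (nat \<Rightarrow> nat) topology)"
    by (simp add: euclidean_product_topology)
  then have "completely_metrizable_space ?T"
    using closed_Omega by (intro completely_metrizable_space_closedin) simp_all
  moreover have "second_countable (euclidean :: (nat \<Rightarrow> nat) topology)"
  proof -
    obtain B :: "(nat \<Rightarrow> nat) set set" where B: "countable B" "topological_basis B"
      using ex_countable_basis by blast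
    have "\<exists>V\<in>B. x \<in> V \<and> V \<subseteq> W" if "open W" "x \<in> W" for W x
      using topological_basisE[OF B(2) that] by metis
    then show ?thesis unfolding second_countable_def
      using B topological_basis_open[OF B(2)] by (intro exI[of _ B]) simp
  qed
  then have "second_countable ?T" by (rule second_countable_subtopology)
  moreover have "sets M = sigma_sets (space M) {A. openin ?T A}"
  proof -
    have "sets M = (\<inter>) Omega ` sets borel" by (simp add: assms BOmega_def sets_restrict_space)
    also have "sets (borel :: (nat \<Rightarrow> nat) measure) = sigma_sets UNIV {A. open A}"
      by (simp add: borel_def)
    also have "(\<inter>) Omega ` sigma_sets UNIV {A. open A} = sigma_sets Omega ((\<inter>) Omega ` {A. open A})"
    proof (rule restricted_sigma)
      show "Omega \<in> sigma_sets UNIV {A. open A}" using Omega_borel by (simp add: borel_def)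
    qed simp
    also have "(\<inter>) Omega ` {A. open A} = {A. openin ?T A}"
      by (auto simp: openin_subtopology image_def)
    finally show ?thesis by (simp add: sp)
  qed
  ultimately show ?thesis unfolding standard_borel_def using sp by (intro exI[of _ ?T]) auto
qed

lemma sets_BOmega_cylinder: "cylinder {w. P w} \<Longrightarrow> {w \<in> Omega. P w} \<in> sets BOmega"
  unfolding BOmega_def by (rule sets_restrict_space_iff[THEN iffD2])
    (auto simp: Omega_borel Collect_conj_eq intro: sets.Int borel_cylinder)

lemma pred_BOmega: "cylinder {w. P w} \<Longrightarrow> Measurable.pred BOmega P"
  using sets_BOmega_cylinder[of P] by (simp add: pred_def)

lemma measurable_loc: "(\<lambda>w. loc w k) \<in> BOmega \<rightarrow>\<^sub>M count_space UNIV"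
proof (rule measurableI)
  fix A :: "'h set"
  show "(\<lambda>w. loc w k) -` A \<inter> space BOmega \<in> sets BOmega"
    using sets_BOmega_cylinder[OF cylinder_config[of "{k}" 0 "\<lambda>w. loc w k \<in> A"]]
    by (simp add: vimage_def Int_def conj_commute)
qed simp

lemma measurable_col: "(\<lambda>w. col w k r) \<in> BOmega \<rightarrow>\<^sub>M count_space UNIV"
proof (rule measurableI)
  fix A :: "nat set"
  show "(\<lambda>w. col w k r) -` A \<inter> space BOmega \<in> sets BOmega"
    using sets_BOmega_cylinder[OF cylinder_config[of "{k}" r "\<lambda>w. col w k r \<in> A"]]
    by (simp add: vimage_def Int_def conj_commute)
qed simp

lemma measurable_config:
  assumes f: "\<And>k. k \<in> carrier G \<Longrightarrow> (\<lambda>x. f x k) \<in> N \<rightarrow>\<^sub>M count_space UNIV"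
    and b: "\<And>k r. k \<in> carrier G \<Longrightarrow> (\<lambda>x. b x k r) \<in> N \<rightarrow>\<^sub>M count_space UNIV"
    and closed: "\<And>x. x \<in> space N \<Longrightarrow> config (f x) (b x) \<in> Omega"
  shows "(\<lambda>x. config (f x) (b x)) \<in> N \<rightarrow>\<^sub>M BOmega"
  unfolding BOmega_def
proof (rule measurable_restrict_space2)
  show "(\<lambda>x. config (f x) (b x)) \<in> N \<rightarrow>\<^sub>M borel"
  proof (rule measurable_coordinatewise_then_product)
    fix m
    obtain i r where m: "m = prod_encode (i, r)" by (metis prod.exhaust prod_decode_inverse)
    show "(\<lambda>x. config (f x) (b x) m) \<in> N \<rightarrow>\<^sub>M borel"
    proof (cases "i \<in> eG ` carrier G")
      case False
      then show ?thesis by (simp add: config_def m)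
    next
      case True
      then obtain k where k: "k \<in> carrier G" "i = eG k" by blast
      show ?thesis
      proof (cases r)
        case 0
        have "(\<lambda>x. eH (f x k)) \<in> N \<rightarrow>\<^sub>M borel" by (rule measurable_compose[OF f[OF k(1)]]) simp
        then show ?thesis using k 0 by (simp add: config_def m inv_into_f_f[OF inj_eG])
      next
        case (Suc s)
        have "(\<lambda>x. b x k s) \<in> N \<rightarrow>\<^sub>M borel" by (rule measurable_compose[OF b[OF k(1)]]) simp
        then show ?thesis using k Suc by (simp add: config_def m inv_into_f_f[OF inj_eG])
      qed
    qed
  qed
qed (use closed in auto)

text \<open>\<open>G\<close> translates the argument and \<open>H\<close> the value. The inverse makes \<open>actG\<close> a left action; the view
  from \<open>x \<cdot> g\<close> then is, up to a translation by \<open>H\<close>, the translate by \<open>g\<close> inverse of the view from \<open>x\<close>.\<close>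

definition actG :: "'g \<Rightarrow> (nat \<Rightarrow> nat) \<Rightarrow> nat \<Rightarrow> nat" where
  "actG g w = config (\<lambda>k. loc w (inv\<^sub>G g \<cdot> k)) (\<lambda>k. col w (inv\<^sub>G g \<cdot> k))"

definition actH :: "'h \<Rightarrow> (nat \<Rightarrow> nat) \<Rightarrow> nat \<Rightarrow> nat" where
  "actH h w = config (\<lambda>k. h \<star> loc w k) (col w)"

lemma loc_actG: "g \<in> carrier G \<Longrightarrow> w \<in> Omega \<Longrightarrow> k \<in> carrier G \<Longrightarrow>
    loc (actG g w) k = loc w (inv\<^sub>G g \<cdot> k)"
  unfolding actG_def by (intro loc_config) (auto intro: loc_closed)

lemma col_actG: "g \<in> carrier G \<Longrightarrow> k \<in> carrier G \<Longrightarrow> col (actG g w) k = col w (inv\<^sub>G g \<cdot> k)"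
  unfolding actG_def by (simp add: col_config)

lemma loc_actH: "h \<in> carrier H \<Longrightarrow> w \<in> Omega \<Longrightarrow> k \<in> carrier G \<Longrightarrow> loc (actH h w) k = h \<star> loc w k"
  unfolding actH_def by (intro loc_config) (auto intro: loc_closed)

lemma col_actH: "k \<in> carrier G \<Longrightarrow> col (actH h w) k = col w k"
  unfolding actH_def by (simp add: col_config)

lemma actG_closed:
  assumes g: "g \<in> carrier G" and w: "w \<in> Omega" shows "actG g w \<in> Omega"
  unfolding actG_def
proof (rule config_in_Omega)
  have "col w (inv\<^sub>G g \<cdot> k) r \<noteq> col w (inv\<^sub>G g \<cdot> (k \<cdot> v)) r"
    if kv: "k \<in> carrier G" "v \<in> GG.wball r" "v \<noteq> \<one>\<^sub>G" for k r v
  proof -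
    have gk: "inv\<^sub>G g \<cdot> k \<in> carrier G" using g kv by simp
    have "col w (inv\<^sub>G g \<cdot> k) r \<noteq> col w (inv\<^sub>G g \<cdot> k \<cdot> v) r"
      using separated_col[OF w] gk kv(2,3) unfolding separated_def by blast
    then show ?thesis using g kv(1) GG.wball_closed[OF kv(2)] by (simp add: GG.m_assoc)
  qed
  then show "separated (\<lambda>k. col w (inv\<^sub>G g \<cdot> k))" by (simp add: separated_def)
qed (use g loc_closed[OF w] in simp)

lemma actH_closed: "h \<in> carrier H \<Longrightarrow> w \<in> Omega \<Longrightarrow> actH h w \<in> Omega"
  unfolding actH_def by (rule config_in_Omega) (simp_all add: loc_closed separated_col)

lemma actG_one: "w \<in> Omega \<Longrightarrow> actG \<one>\<^sub>G w = w"
  by (rule Omega_eqI) (simp_all add: actG_closed loc_actG col_actG)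

lemma actG_mult:
  "g \<in> carrier G \<Longrightarrow> g' \<in> carrier G \<Longrightarrow> w \<in> Omega \<Longrightarrow> actG (g \<cdot> g') w = actG g (actG g' w)"
  by (rule Omega_eqI) (simp_all add: actG_closed loc_actG col_actG GG.inv_mult_group GG.m_assoc)

lemma actH_one: "w \<in> Omega \<Longrightarrow> actH \<one>\<^sub>H w = w"
  by (rule Omega_eqI) (simp_all add: actH_closed loc_actH col_actH loc_closed)

lemma actH_mult:
  "h \<in> carrier H \<Longrightarrow> h' \<in> carrier H \<Longrightarrow> w \<in> Omega \<Longrightarrow> actH (h \<star> h') w = actH h (actH h' w)"
  by (rule Omega_eqI) (simp_all add: actH_closed loc_actH col_actH loc_closed HH.m_assoc)

lemma act_commute:
  "g \<in> carrier G \<Longrightarrow> h \<in> carrier H \<Longrightarrow> w \<in> Omega \<Longrightarrow> actG g (actH h w) = actH h (actG g w)"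
  by (rule Omega_eqI) (simp_all add: actG_closed actH_closed loc_actG loc_actH col_actG col_actH)

text \<open>Choose \<open>r\<close> as the distance from \<open>k\<close> to \<open>k'\<close>.\<close>

lemma separated_inj:
  assumes "w \<in> Omega" "k \<in> carrier G" "k' \<in> carrier G" "k \<noteq> k'"
  shows "\<exists>r. col w k r \<noteq> col w k' r"
proof -
  let ?v = "inv\<^sub>G k \<cdot> k'"
  have v: "?v \<in> GG.wball (GG.len ?v)" using assms by (simp add: GG.wball_def)
  moreover have "k \<cdot> ?v = k'" using assms by (simp add: GG.m_assoc[symmetric])
  moreover have "?v \<noteq> \<one>\<^sub>G" using assms \<open>k \<cdot> ?v = k'\<close> by fastforce
  ultimately show ?thesis using separated_col[OF assms(1)] assms(2) unfolding separated_def by metis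
qed

lemma actG_free: "g \<in> carrier G \<Longrightarrow> w \<in> Omega \<Longrightarrow> actG g w = w \<Longrightarrow> g = \<one>\<^sub>G"
  using separated_inj[of w "\<one>\<^sub>G" "inv\<^sub>G g"] col_actG[of g "\<one>\<^sub>G" w]
  by (metis GG.inv_closed GG.inv_inv GG.inv_one GG.one_closed GG.r_one)

lemma actH_free: "h \<in> carrier H \<Longrightarrow> w \<in> Omega \<Longrightarrow> actH h w = w \<Longrightarrow> h = \<one>\<^sub>H"
  using loc_actH[of h w "\<one>\<^sub>G"] loc_closed[of w "\<one>\<^sub>G"]
  by (metis HH.r_cancel_one GG.one_closed)

lemma measurable_actG: "g \<in> carrier G \<Longrightarrow> actG g \<in> BOmega \<rightarrow>\<^sub>M BOmega"
  using measurable_config[of "\<lambda>w k. loc w (inv\<^sub>G g \<cdot> k)" BOmega "\<lambda>w k. col w (inv\<^sub>G g \<cdot> k)"]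
    actG_closed measurable_loc measurable_col unfolding actG_def by simp

lemma measurable_actH: "h \<in> carrier H \<Longrightarrow> actH h \<in> BOmega \<rightarrow>\<^sub>M BOmega"
  using measurable_config[of "\<lambda>w k. h \<star> loc w k" BOmega "\<lambda>w. col w"]
    actH_closed measurable_compose[OF measurable_loc, of "\<lambda>x. h \<star> x"] measurable_col unfolding actH_def by simp

text \<open>The action that \<open>G\<close> induces on the fundamental domain of \<open>H\<close>: translate, and move back by the
  element of \<open>H\<close> that makes the value at the unit trivial.\<close>

definition shift :: "'g \<Rightarrow> (nat \<Rightarrow> nat) \<Rightarrow> nat \<Rightarrow> nat" where
  "shift g w = actH (inv\<^sub>H (loc (actG g w) \<one>\<^sub>G)) (actG g w)"

lemma measurable_shift: assumes g: "g \<in> carrier G" shows "shift g \<in> BOmega \<rightarrow>\<^sub>M BOmega"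
proof -
  have "(\<lambda>w. actH (inv\<^sub>H (loc (actG g w) \<one>\<^sub>G)) (actG g w)) \<in> BOmega \<rightarrow>\<^sub>M BOmega"
  proof (rule measurable_compose_countable'[where I = "carrier H" and
        f = "\<lambda>h w. actH (inv\<^sub>H h) (actG g w)" and g = "\<lambda>w. loc (actG g w) \<one>\<^sub>G"])
    show "(\<lambda>w. actH (inv\<^sub>H h) (actG g w)) \<in> BOmega \<rightarrow>\<^sub>M BOmega" if "h \<in> carrier H" for h
      using measurable_compose[OF measurable_actG[OF g] measurable_actH] that by simp
    have m: "(\<lambda>w. loc (actG g w) \<one>\<^sub>G) \<in> BOmega \<rightarrow>\<^sub>M count_space UNIV"
      by (rule measurable_compose[OF measurable_actG[OF g] measurable_loc])
    show "(\<lambda>w. loc (actG g w) \<one>\<^sub>G) \<in> BOmega \<rightarrow>\<^sub>M count_space (carrier H)"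
      by (rule measurableI) (use measurable_sets[OF m] loc_closed[OF actG_closed[OF g]] in auto)
  qed (rule HH.countable_carrier)
  then show ?thesis by (simp add: shift_def[abs_def])
qed

definition XH :: "(nat \<Rightarrow> nat) set" where "XH = {w \<in> Omega. loc w \<one>\<^sub>G = \<one>\<^sub>H}"

text \<open>If all fibres are finite, then there is exactly one leading \<open>p\<close>. It depends equivariantly on \<open>w\<close>,
  so requiring \<open>p = 1\<close> selects one point of each such \<open>G\<close>-orbit.\<close>

definition leading :: "(nat \<Rightarrow> nat) \<Rightarrow> 'g \<Rightarrow> bool" where
  "leading w p \<longleftrightarrow> (\<forall>k\<in>carrier G. eH (loc w p) \<le> eH (loc w k)) \<and>
     (\<forall>k\<in>carrier G. k \<noteq> p \<longrightarrow> loc w k = loc w p \<longrightarrow> lex_less (col w p) (col w k))"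

definition XG :: "(nat \<Rightarrow> nat) set" where "XG = {w \<in> Omega. leading w \<one>\<^sub>G}"

definition finite_fibres :: "(nat \<Rightarrow> nat) \<Rightarrow> bool" where
  "finite_fibres w \<longleftrightarrow> (\<forall>h\<in>carrier H. finite {k \<in> carrier G. loc w k = h})"

lemma leading_ex1:
  assumes w: "w \<in> Omega" and fin: "finite_fibres w"
  shows "\<exists>!p. p \<in> carrier G \<and> leading w p"
proof (rule ex_ex1I)
  obtain p0 where p0: "p0 \<in> carrier G" "\<And>k. k \<in> carrier G \<Longrightarrow> eH (loc w p0) \<le> eH (loc w k)"
    using ex_has_least_nat[of "\<lambda>k. k \<in> carrier G" "\<one>\<^sub>G" "\<lambda>k. eH (loc w k)"] by auto
  let ?F = "{k \<in> carrier G. loc w k = loc w p0}"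
  have "finite ?F" using fin loc_closed[OF w p0(1)] by (auto simp: finite_fibres_def)
  moreover have "?F \<noteq> {}" using p0(1) by blast
  ultimately obtain p where p: "p \<in> ?F" "\<forall>k\<in>?F. k \<noteq> p \<longrightarrow> \<not> lex_less (col w k) (col w p)"
  proof -
    have "asymp_on ?F (\<lambda>k l. lex_less (col w k) (col w l))"
      using lex_less_asym by (intro asymp_onI) blast
    moreover have "transp_on ?F (\<lambda>k l. lex_less (col w k) (col w l))"
      using lex_less_trans by (intro transp_onI) blast
    ultimately show ?thesis
      using Finite_Set.bex_min_element[of ?F "\<lambda>k l. lex_less (col w k) (col w l)"] that
        \<open>finite ?F\<close> \<open>?F \<noteq> {}\<close> by blast
  qed
  have "lex_less (col w p) (col w k)" if k: "k \<in> ?F" "k \<noteq> p" for k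
  proof -
    obtain r where r: "col w p r \<noteq> col w k r" using separated_inj[OF w, of p k] k p(1) by blast
    have "lex_less (col w p) (col w k) \<or> lex_less (col w k) (col w p)"
      using lex_less_total[of "col w p" r "col w k", OF r] unfolding lex_less_def by blast
    then show ?thesis using p(2) k by blast
  qed
  then show "\<exists>p. p \<in> carrier G \<and> leading w p" using p(1) p0(2) unfolding leading_def by auto
next
  fix p q assume p: "p \<in> carrier G \<and> leading w p" and q: "q \<in> carrier G \<and> leading w q"
  then have "eH (loc w p) = eH (loc w q)" by (simp add: leading_def antisym)
  then have "loc w p = loc w q" using inj_eH loc_closed[OF w] p q by (simp add: inj_on_def)
  then show "p = q" using p q lex_less_asym unfolding leading_def by metis
qed

lemma leading_actG:
  assumes "g \<in> carrier G" "w \<in> Omega" "p \<in> carrier G"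
  shows "leading (actG g w) p \<longleftrightarrow> leading w (inv\<^sub>G g \<cdot> p)"
proof -
  have bij: "bij_betw (\<lambda>k. inv\<^sub>G g \<cdot> k) (carrier G) (carrier G)"
    by (rule bij_betw_byWitness[of _ "\<lambda>k. g \<cdot> k"]) (use assms in \<open>auto simp: GG.m_assoc[symmetric]\<close>)
  have ball: "(\<forall>k\<in>carrier G. Q k) \<longleftrightarrow> (\<forall>k\<in>carrier G. Q (inv\<^sub>G g \<cdot> k))" for Q
    using bij_betw_imp_surj_on[OF bij] by (metis image_eqI imageE)
  have inj: "inv\<^sub>G g \<cdot> k = inv\<^sub>G g \<cdot> p \<longleftrightarrow> k = p" if "k \<in> carrier G" for k
    using assms that by simp
  show ?thesis
    unfolding leading_def[of w] using assms
    by (subst (1 2) ball) (simp add: leading_def loc_actG col_actG inj)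
qed

lemma XG_actG_iff: "g \<in> carrier G \<Longrightarrow> w \<in> Omega \<Longrightarrow> actG g w \<in> XG \<longleftrightarrow> leading w (inv\<^sub>G g)"
  by (simp add: XG_def actG_closed leading_actG)

lemma ex1_XG:
  assumes "w \<in> Omega" "finite_fibres w"
  shows "\<exists>!y. (\<exists>g\<in>carrier G. y = actG g w) \<and> y \<in> XG"
proof -
  obtain p where p: "p \<in> carrier G" "leading w p" "\<And>q. q \<in> carrier G \<Longrightarrow> leading w q \<Longrightarrow> q = p"
    using leading_ex1[OF assms] by blast
  show ?thesis
  proof (rule ex1I[of _ "actG (inv\<^sub>G p) w"])
    show "(\<exists>g\<in>carrier G. actG (inv\<^sub>G p) w = actG g w) \<and> actG (inv\<^sub>G p) w \<in> XG"
      using p(1,2) assms(1) by (intro conjI bexI[of _ "inv\<^sub>G p"]) (simp_all add: XG_actG_iff)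
    fix y assume "(\<exists>g\<in>carrier G. y = actG g w) \<and> y \<in> XG"
    then obtain g where g: "g \<in> carrier G" "y = actG g w" "leading w (inv\<^sub>G g)"
      using assms(1) XG_actG_iff by auto
    then have "inv\<^sub>G g = p" using p(3) by simp
    then show "y = actG (inv\<^sub>G p) w" using g by auto
  qed
qed

lemma ex1_XH:
  assumes w: "w \<in> Omega" shows "\<exists>!y. (\<exists>h\<in>carrier H. y = actH h w) \<and> y \<in> XH"
proof -
  have l: "loc w \<one>\<^sub>G \<in> carrier H" using loc_closed[OF w] by simp
  have iff: "actH h w \<in> XH \<longleftrightarrow> h = inv\<^sub>H (loc w \<one>\<^sub>G)" if "h \<in> carrier H" for h
    using that w l by (auto simp: XH_def actH_closed loc_actH HH.inv_equality)
  show ?thesis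
    by (rule ex1I[of _ "actH (inv\<^sub>H (loc w \<one>\<^sub>G)) w"]) (use iff l in auto)
qed

lemma sets_XH: "XH \<in> sets BOmega"
  unfolding XH_def by (intro sets_BOmega_cylinder cylinder_config[of "{\<one>\<^sub>G}" 0]) auto

lemma cylinder_loc: "cylinder {w. Q (loc w k)}"
  by (rule cylinder_config[of "{k}" 0]) auto

lemma pred_lex_less: "Measurable.pred BOmega (\<lambda>w. lex_less (col w k) (col w l))"
  unfolding lex_less_def
proof (rule pred_intros_countable(2), rule pred_BOmega)
  fix r
  show "cylinder {w. col w k r < col w l r \<and> (\<forall>s<r. col w k s = col w l s)}"
    by (rule cylinder_config[of "{k, l}" r]) auto
qed

lemma pred_Ball_countable:
  assumes "countable I" "\<And>i. i \<in> I \<Longrightarrow> Measurable.pred M (P i)"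
  shows "Measurable.pred M (\<lambda>x. \<forall>i\<in>I. P i x)"
  using sets.sets_Collect_countable_All'[of I M P] assms by (simp add: pred_def)

lemma pred_leading: "Measurable.pred BOmega (\<lambda>w. leading w p)"
  unfolding leading_def
proof (intro pred_intros_logic pred_Ball_countable[OF GG.countable_carrier] pred_lex_less)
  fix k
  show "Measurable.pred BOmega (\<lambda>w. eH (loc w p) \<le> eH (loc w k))"
    by (intro pred_BOmega cylinder_config[of "{p, k}" 0]) auto
  show "Measurable.pred BOmega (\<lambda>w. loc w k = loc w p)"
    by (intro pred_BOmega cylinder_config[of "{p, k}" 0]) auto
  show "Measurable.pred BOmega (\<lambda>w. k = p)" by simp
qed

lemma sets_XG: "XG \<in> sets BOmega"
  using pred_leading[of "\<one>\<^sub>G"] by (simp add: XG_def pred_def)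

end

section \<open>The suspension of a law on the fundamental domain of H\<close>

lemma free_mp_actionI:
  assumes "group G"
    and closed: "\<And>g x. g \<in> carrier G \<Longrightarrow> x \<in> space M \<Longrightarrow> act g x \<in> space M"
    and one: "\<And>x. x \<in> space M \<Longrightarrow> act \<one>\<^bsub>G\<^esub> x = x"
    and mult: "\<And>g g' x. g \<in> carrier G \<Longrightarrow> g' \<in> carrier G \<Longrightarrow> x \<in> space M \<Longrightarrow>
      act (g \<otimes>\<^bsub>G\<^esub> g') x = act g (act g' x)"
    and free: "\<And>g x. g \<in> carrier G \<Longrightarrow> x \<in> space M \<Longrightarrow> act g x = x \<Longrightarrow> g = \<one>\<^bsub>G\<^esub>"
    and meas: "\<And>g. g \<in> carrier G \<Longrightarrow> act g \<in> M \<rightarrow>\<^sub>M M"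
    and inv: "\<And>g. g \<in> carrier G \<Longrightarrow> distr M M (act g) = M"
  shows "free_mp_action G M (\<lambda>g. restrict (act g) (space M))" (is "free_mp_action G M ?\<phi>")
proof -
  interpret group G by fact
  have bij: "?\<phi> g \<in> Bij (space M)" if g: "g \<in> carrier G" for g
  proof -
    have "bij_betw (?\<phi> g) (space M) (space M)"
    proof (rule bij_betw_byWitness[of _ "?\<phi> (inv\<^bsub>G\<^esub> g)"])
      show "\<forall>a\<in>space M. ?\<phi> (inv\<^bsub>G\<^esub> g) (?\<phi> g a) = a"
        using g closed one mult[of "inv\<^bsub>G\<^esub> g" g] by simp
      show "\<forall>a\<in>space M. ?\<phi> g (?\<phi> (inv\<^bsub>G\<^esub> g) a) = a"
        using g closed one mult[of g "inv\<^bsub>G\<^esub> g"] by simp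
    qed (use g closed in auto)
    then show ?thesis by (simp add: Bij_def)
  qed
  have "?\<phi> (g \<otimes>\<^bsub>G\<^esub> g') = ?\<phi> g \<otimes>\<^bsub>BijGroup (space M)\<^esub> ?\<phi> g'" if "g \<in> carrier G" "g' \<in> carrier G" for g g'
    using that bij closed mult
    by (auto simp: BijGroup_def compose_def restrict_def)
  then have "?\<phi> \<in> hom G (BijGroup (space M))"
    using bij by (intro homI) (simp_all add: BijGroup_def)
  then have "group_action G (space M) ?\<phi>"
    unfolding group_action_def group_hom_def group_hom_axioms_def
    using group_BijGroup is_group by blast
  moreover have "?\<phi> g \<in> M \<rightarrow>\<^sub>M M \<and> distr M M (?\<phi> g) = M" if "g \<in> carrier G" for g
  proof
    show "?\<phi> g \<in> M \<rightarrow>\<^sub>M M"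
      using meas[OF that] by (subst measurable_cong[where g = "act g"]) simp_all
    have "distr M M (?\<phi> g) = distr M M (act g)" by (rule distr_cong) simp_all
    then show "distr M M (?\<phi> g) = M" using inv[OF that] by simp
  qed
  moreover have "stabilizer G ?\<phi> x = {\<one>\<^bsub>G\<^esub>}" if "x \<in> space M" for x
    using free[OF _ that] one[OF that] that unfolding stabilizer_def by auto
  ultimately show ?thesis unfolding free_mp_action_def by (intro conjI ballI) simp_all
qed

text \<open>The abstract part of the construction. A probability measure on \<open>XH\<close> that is invariant
  under the induced action of \<open>G\<close> is spread over the translates of \<open>XH\<close> by \<open>H\<close>.\<close>

locale coupling_law = group_pair G SG H SH
  for G :: "('g, 'a) monoid_scheme" and SG and H :: "('h, 'b) monoid_scheme" and SH +
  fixes \<nu> :: "(nat \<Rightarrow> nat) measure"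
  assumes sets_nu: "sets \<nu> = sets BOmega" and emeasure_nu: "emeasure \<nu> Omega = 1"
    and AE_XH: "AE w in \<nu>. w \<in> XH"
    and shift_invariant: "\<And>g. g \<in> carrier G \<Longrightarrow>
      distr \<nu> BOmega (shift g) = \<nu>"
begin

lemma space_nu [simp]: "space \<nu> = Omega"
  using sets_eq_imp_space_eq[OF sets_nu] by simp

lemma finite_measure_nu: "finite_measure \<nu>"
  by (rule finite_measureI) (simp add: emeasure_nu)

lemma sigma_finite_H: "sigma_finite_measure (count_space (carrier H))"
  by (rule sigma_finite_measure_count_space_countable[OF HH.countable_carrier])

lemma pair_sigma_finite: "pair_sigma_finite (count_space (carrier H)) \<nu>"
  unfolding pair_sigma_finite_def
  using sigma_finite_H finite_measure_nu finite_measure_def by blast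

definition \<mu> :: "(nat \<Rightarrow> nat) measure" where
  "\<mu> = distr (count_space (carrier H) \<Otimes>\<^sub>M \<nu>) BOmega (\<lambda>(h, w). actH h w)"

lemma sets_mu: "sets \<mu> = sets BOmega" by (simp add: \<mu>_def)

lemma space_mu [simp]: "space \<mu> = Omega" by (simp add: \<mu>_def)

lemma measurable_actH_nu: "h \<in> carrier H \<Longrightarrow> actH h \<in> \<nu> \<rightarrow>\<^sub>M BOmega"
  using measurable_actH measurable_cong_sets[OF sets_nu refl] by blast

lemma measurable_act_pair: "(\<lambda>(h, w). actH h w) \<in> count_space (carrier H) \<Otimes>\<^sub>M \<nu> \<rightarrow>\<^sub>M BOmega"
  by (rule measurable_pair_measure_countable1[OF HH.countable_carrier]) (simp add: measurable_actH_nu)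

lemma nn_integral_mu:
  assumes f: "f \<in> borel_measurable BOmega"
  shows "(\<integral>\<^sup>+w. f w \<partial>\<mu>) = (\<integral>\<^sup>+h. \<integral>\<^sup>+w. f (actH h w) \<partial>\<nu> \<partial>count_space (carrier H))" (is ?A)
    and "(\<integral>\<^sup>+w. f w \<partial>\<mu>) = (\<integral>\<^sup>+w. \<integral>\<^sup>+h. f (actH h w) \<partial>count_space (carrier H) \<partial>\<nu>)" (is ?B)
    and "(\<lambda>w. \<integral>\<^sup>+h. f (actH h w) \<partial>count_space (carrier H)) \<in> borel_measurable BOmega" (is ?C)
proof -
  interpret pair_sigma_finite "count_space (carrier H)" \<nu> by (rule pair_sigma_finite)
  let ?f = "\<lambda>(h, w). f (actH h w)"
  have m: "?f \<in> borel_measurable (count_space (carrier H) \<Otimes>\<^sub>M \<nu>)"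
    using measurable_compose[OF measurable_act_pair f] by (simp add: case_prod_unfold)
  have 1: "(\<integral>\<^sup>+w. f w \<partial>\<mu>) = (\<integral>\<^sup>+p. ?f p \<partial>(count_space (carrier H) \<Otimes>\<^sub>M \<nu>))"
    unfolding \<mu>_def by (subst nn_integral_distr[OF measurable_act_pair]) (simp_all add: f case_prod_unfold)
  show ?A using 1 M2.nn_integral_fst[OF m] by simp
  then show ?B using Fubini'[of "\<lambda>h w. f (actH h w)"] m by simp
  have "(\<lambda>w. \<integral>\<^sup>+h. f (actH h w) \<partial>count_space (carrier H)) \<in> borel_measurable \<nu>"
    using M1.borel_measurable_nn_integral_fst[OF measurable_pair_swap[OF m]] by (simp add: case_prod_unfold)
  then show ?C using measurable_cong_sets[OF sets_nu refl] by blast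
qed

lemma emeasure_mu:
  assumes A: "A \<in> sets BOmega"
  shows "emeasure \<mu> A = (\<integral>\<^sup>+h. emeasure \<nu> {w \<in> Omega. actH h w \<in> A} \<partial>count_space (carrier H))"
proof -
  have "emeasure \<mu> A = (\<integral>\<^sup>+w. indicator A w \<partial>\<mu>)" using A by (simp add: sets_mu)
  also have "\<dots> = (\<integral>\<^sup>+h. \<integral>\<^sup>+w. indicator A (actH h w) \<partial>\<nu> \<partial>count_space (carrier H))"
    using A by (intro nn_integral_mu(1)) simp
  also have "\<dots> = (\<integral>\<^sup>+h. emeasure \<nu> {w \<in> Omega. actH h w \<in> A} \<partial>count_space (carrier H))"
  proof (rule nn_integral_cong)
    fix h assume "h \<in> space (count_space (carrier H))"
    then have "{w \<in> Omega. actH h w \<in> A} \<in> sets \<nu>"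
      using measurable_sets[OF measurable_actH_nu[of h] A] by (simp add: vimage_def Int_def conj_commute)
    moreover have "(\<integral>\<^sup>+w. indicator A (actH h w) \<partial>\<nu>) = (\<integral>\<^sup>+w. indicator {w \<in> Omega. actH h w \<in> A} w \<partial>\<nu>)"
      by (rule nn_integral_cong) (simp add: indicator_def)
    ultimately show "(\<integral>\<^sup>+w. indicator A (actH h w) \<partial>\<nu>) = emeasure \<nu> {w \<in> Omega. actH h w \<in> A}"
      by simp
  qed
  finally show ?thesis .
qed

lemma measurable_indicator_act:
  "A \<in> sets BOmega \<Longrightarrow> T \<in> BOmega \<rightarrow>\<^sub>M BOmega \<Longrightarrow>
    (\<lambda>w. indicator A (T w) :: ennreal) \<in> borel_measurable BOmega"
  by (rule measurable_compose[OF _ borel_measurable_indicator])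

lemma distr_muI:
  assumes T: "T \<in> BOmega \<rightarrow>\<^sub>M BOmega"
    and eq: "\<And>A. A \<in> sets BOmega \<Longrightarrow>
      (\<integral>\<^sup>+w. indicator A (T w) \<partial>\<mu>) = (\<integral>\<^sup>+w. (indicator A w :: ennreal) \<partial>\<mu>)"
  shows "distr \<mu> \<mu> T = \<mu>"
proof (rule measure_eqI)
  have T': "T \<in> \<mu> \<rightarrow>\<^sub>M \<mu>" using T measurable_cong_sets[OF sets_mu sets_mu] by blast
  fix A assume "A \<in> sets (distr \<mu> \<mu> T)"
  then have A: "A \<in> sets BOmega" by (simp add: sets_mu)
  have "emeasure (distr \<mu> \<mu> T) A = (\<integral>\<^sup>+w. indicator A w \<partial>distr \<mu> \<mu> T)" using A by (simp add: sets_mu)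
  also have "\<dots> = (\<integral>\<^sup>+w. indicator A (T w) \<partial>\<mu>)"
    using A by (intro nn_integral_distr[OF T']) (simp add: sets_mu borel_measurable_indicator)
  finally show "emeasure (distr \<mu> \<mu> T) A = emeasure \<mu> A" using eq[OF A] A by (simp add: sets_mu)
qed simp

lemma sum_H_translate:
  assumes "c \<in> carrier H"
  shows "(\<integral>\<^sup>+h. f (h \<star> c) \<partial>count_space (carrier H)) = (\<integral>\<^sup>+h. f h \<partial>count_space (carrier H))"
    and "(\<integral>\<^sup>+h. f (c \<star> h) \<partial>count_space (carrier H)) = (\<integral>\<^sup>+h. f h \<partial>count_space (carrier H))"
proof -
  have "bij_betw (\<lambda>h. h \<star> c) (carrier H) (carrier H)"
    by (rule bij_betw_byWitness[of _ "\<lambda>h. h \<star> inv\<^sub>H c"]) (use assms in \<open>auto simp: HH.m_assoc\<close>)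
  from nn_integral_bij_count_space[OF this]
  show "(\<integral>\<^sup>+h. f (h \<star> c) \<partial>count_space (carrier H)) = (\<integral>\<^sup>+h. f h \<partial>count_space (carrier H))" .
  have "bij_betw (\<lambda>h. c \<star> h) (carrier H) (carrier H)"
    by (rule bij_betw_byWitness[of _ "\<lambda>h. inv\<^sub>H c \<star> h"])
      (use assms in \<open>auto simp: HH.m_assoc[symmetric]\<close>)
  from nn_integral_bij_count_space[OF this]
  show "(\<integral>\<^sup>+h. f (c \<star> h) \<partial>count_space (carrier H)) = (\<integral>\<^sup>+h. f h \<partial>count_space (carrier H))" .
qed

lemma mu_actH: assumes h: "h \<in> carrier H" shows "distr \<mu> \<mu> (actH h) = \<mu>"
proof (rule distr_muI[OF measurable_actH[OF h]])
  fix A assume A: "A \<in> sets BOmega"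
  have m: "(\<lambda>w. indicator A (actH h w) :: ennreal) \<in> borel_measurable BOmega"
    by (rule measurable_indicator_act[OF A measurable_actH[OF h]])
  have "(\<integral>\<^sup>+w. indicator A (actH h w) \<partial>\<mu>)
      = (\<integral>\<^sup>+k. \<integral>\<^sup>+w. indicator A (actH h (actH k w)) \<partial>\<nu> \<partial>count_space (carrier H))"
    by (rule nn_integral_mu(1)[OF m])
  also have "\<dots> = (\<integral>\<^sup>+k. \<integral>\<^sup>+w. indicator A (actH (h \<star> k) w) \<partial>\<nu> \<partial>count_space (carrier H))"
    using h by (intro nn_integral_cong) (simp add: actH_mult)
  also have "\<dots> = (\<integral>\<^sup>+k. \<integral>\<^sup>+w. indicator A (actH k w) \<partial>\<nu> \<partial>count_space (carrier H))"
    by (rule sum_H_translate(2)[OF h])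
  also have "\<dots> = (\<integral>\<^sup>+w. indicator A w \<partial>\<mu>)"
    using A by (intro nn_integral_mu(1)[symmetric]) simp
  finally show "(\<integral>\<^sup>+w. indicator A (actH h w) \<partial>\<mu>) = (\<integral>\<^sup>+w. indicator A w \<partial>\<mu>)" .
qed

text \<open>Write the translate of \<open>w\<close> by \<open>g\<close> as the translate of \<open>shift g w\<close> by an element of \<open>H\<close>. This element
  depends on \<open>w\<close>, but for each \<open>w\<close> it is absorbed by the sum over \<open>H\<close>. What remains is the invariance of
  \<open>\<nu>\<close> under \<open>shift g\<close>.\<close>

lemma mu_actG: assumes g: "g \<in> carrier G" shows "distr \<mu> \<mu> (actG g) = \<mu>"
proof (rule distr_muI[OF measurable_actG[OF g]])
  fix A assume A: "A \<in> sets BOmega"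
  let ?F = "\<lambda>w. \<integral>\<^sup>+h. (indicator A (actH h w) :: ennreal) \<partial>count_space (carrier H)"
  have m: "(\<lambda>w. indicator A (actG g w) :: ennreal) \<in> borel_measurable BOmega"
    by (rule measurable_indicator_act[OF A measurable_actG[OF g]])
  have F: "?F \<in> borel_measurable BOmega" using A by (intro nn_integral_mu(3)) simp
  have "(\<integral>\<^sup>+w. indicator A (actG g w) \<partial>\<mu>)
      = (\<integral>\<^sup>+w. \<integral>\<^sup>+h. indicator A (actG g (actH h w)) \<partial>count_space (carrier H) \<partial>\<nu>)"
    by (rule nn_integral_mu(2)[OF m])
  also have "\<dots> = (\<integral>\<^sup>+w. ?F (shift g w) \<partial>\<nu>)"
  proof (rule nn_integral_cong)
    fix w assume "w \<in> space \<nu>"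
    then have w: "w \<in> Omega" "actG g w \<in> Omega" using actG_closed[OF g] by simp_all
    let ?c = "loc (actG g w) \<one>\<^sub>G"
    have c: "?c \<in> carrier H" using loc_closed[OF w(2)] by simp
    have "?F (shift g w) = (\<integral>\<^sup>+h. indicator A (actH (h \<star> ?c) (shift g w)) \<partial>count_space (carrier H))"
      by (rule sum_H_translate(1)[OF c, symmetric])
    also have "\<dots> = (\<integral>\<^sup>+h. indicator A (actG g (actH h w)) \<partial>count_space (carrier H))"
    proof (rule nn_integral_cong)
      fix h assume "h \<in> space (count_space (carrier H))"
      then have h: "h \<in> carrier H" by simp
      have "actH (h \<star> ?c) (shift g w) = actH (h \<star> ?c \<star> inv\<^sub>H ?c) (actG g w)"
        unfolding shift_def using actH_mult[of "h \<star> ?c" "inv\<^sub>H ?c" "actG g w"] h c w(2) by simp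
      also have "\<dots> = actG g (actH h w)" using h c act_commute[OF g h w(1)] by (simp add: HH.m_assoc)
      finally show "indicator A (actH (h \<star> ?c) (shift g w)) = (indicator A (actG g (actH h w)) :: ennreal)"
        by simp
    qed
    finally show "(\<integral>\<^sup>+h. indicator A (actG g (actH h w)) \<partial>count_space (carrier H)) = ?F (shift g w)" by simp
  qed
  also have "\<dots> = (\<integral>\<^sup>+w. ?F w \<partial>distr \<nu> BOmega (shift g))"
  proof (rule nn_integral_distr[symmetric])
    show "shift g \<in> \<nu> \<rightarrow>\<^sub>M BOmega" using measurable_shift[OF g] measurable_cong_sets[OF sets_nu refl] by blast
  qed (use F in simp)
  also have "\<dots> = (\<integral>\<^sup>+w. ?F w \<partial>\<nu>)" using shift_invariant[OF g] by simp
  also have "\<dots> = (\<integral>\<^sup>+w. indicator A w \<partial>\<mu>)"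
    using A by (intro nn_integral_mu(2)[symmetric]) simp
  finally show "(\<integral>\<^sup>+w. indicator A (actG g w) \<partial>\<mu>) = (\<integral>\<^sup>+w. indicator A w \<partial>\<mu>)" .
qed

lemma nu_null_slice:
  assumes "h \<in> carrier H" "A \<in> sets BOmega" "\<And>w. w \<in> A \<Longrightarrow> loc w \<one>\<^sub>G \<noteq> h"
  shows "emeasure \<nu> {w \<in> Omega. actH h w \<in> A} = 0"
proof -
  have "AE w in \<nu>. w \<notin> {w \<in> Omega. actH h w \<in> A}"
    using AE_XH
  proof eventually_elim
    case (elim w)
    then have "loc (actH h w) \<one>\<^sub>G = h" using assms(1) by (simp add: XH_def loc_actH)
    then show ?case using assms(3) by blast
  qed
  then show ?thesis
    using measurable_sets[OF measurable_actH_nu[OF assms(1)] assms(2)]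
    by (subst AE_iff_measurable[symmetric]) (auto simp: vimage_def Int_def conj_commute)
qed

text \<open>The translate of \<open>\<nu>\<close> by \<open>h\<close> lives on configurations with value \<open>h\<close> at the unit, so only the
  translates by elements of \<open>J\<close> see \<open>A\<close>.\<close>

lemma emeasure_mu_slices:
  assumes "finite J" "J \<subseteq> carrier H" "A \<in> sets BOmega" "\<And>w. w \<in> A \<Longrightarrow> loc w \<one>\<^sub>G \<in> J"
  shows "emeasure \<mu> A = (\<Sum>h\<in>J. emeasure \<nu> {w \<in> Omega. actH h w \<in> A})"
  unfolding emeasure_mu[OF assms(3)]
  using assms by (intro nn_integral_count_space') (auto intro!: nu_null_slice)

lemma emeasure_mu_XH: "emeasure \<mu> XH = 1"
proof -
  have "emeasure \<mu> XH = emeasure \<nu> {w \<in> Omega. actH \<one>\<^sub>H w \<in> XH}"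
    using emeasure_mu_slices[of "{\<one>\<^sub>H}" XH] sets_XH by (simp add: XH_def)
  also have "\<dots> = emeasure \<nu> Omega"
    using AE_XH sets_XH measurable_sets[OF measurable_actH_nu[OF HH.one_closed] sets_XH]
    by (intro emeasure_eq_AE) (auto simp: actH_one vimage_def Int_def conj_commute sets_nu
        sets.top[of BOmega, simplified] elim: eventually_mono)
  finally show ?thesis by (simp add: emeasure_nu)
qed

lemma sigma_finite_mu: "sigma_finite_measure \<mu>"
proof
  let ?S = "\<lambda>h. {w \<in> Omega. loc w \<one>\<^sub>G = h}"
  have S: "?S h \<in> sets BOmega" for h
    by (rule sets_BOmega_cylinder) (rule cylinder_loc)
  have "emeasure \<mu> (?S h) < \<infinity>" if "h \<in> carrier H" for h
  proof -
    have "emeasure \<mu> (?S h) = emeasure \<nu> {w \<in> Omega. actH h w \<in> ?S h}"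
      using emeasure_mu_slices[of "{h}" "?S h"] S that by simp
    also have "\<dots> \<le> emeasure \<nu> (space \<nu>)" by (rule emeasure_space)
    finally show ?thesis by (simp add: emeasure_nu order_le_less_trans)
  qed
  moreover have "(\<Union>h\<in>carrier H. ?S h) = Omega" using loc_closed by auto
  ultimately show "\<exists>A. countable A \<and> A \<subseteq> sets \<mu> \<and> \<Union> A = space \<mu> \<and> (\<forall>a\<in>A. emeasure \<mu> a \<noteq> \<infinity>)"
    using S HH.countable_carrier by (intro exI[of _ "?S ` carrier H"]) (auto simp: sets_mu less_top)
qed

lemma AE_muI:
  assumes A: "{w \<in> Omega. P w} \<in> sets BOmega" and nu: "AE w in \<nu>. P w"
    and inv: "\<And>h w. h \<in> carrier H \<Longrightarrow> w \<in> Omega \<Longrightarrow> P w \<Longrightarrow> P (actH h w)"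
  shows "AE w in \<mu>. P w"
proof -
  let ?N = "{w \<in> Omega. \<not> P w}"
  have N: "?N \<in> sets BOmega"
  proof -
    have "?N = space BOmega - {w \<in> Omega. P w}" by auto
    then show ?thesis using sets.compl_sets[OF A] by simp
  qed
  have "emeasure \<nu> {w \<in> Omega. actH h w \<in> ?N} = 0" if h: "h \<in> carrier H" for h
  proof -
    have "AE w in \<nu>. w \<notin> {w \<in> Omega. actH h w \<in> ?N}"
      using nu by eventually_elim (use inv[OF h] in auto)
    then show ?thesis
      using measurable_sets[OF measurable_actH_nu[OF h] N]
      by (subst AE_iff_measurable[symmetric]) (auto simp: vimage_def Int_def conj_commute)
  qed
  then have "emeasure \<mu> ?N = (\<integral>\<^sup>+h. 0 \<partial>count_space (carrier H))"
    unfolding emeasure_mu[OF N] by (intro nn_integral_cong) simp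
  then show ?thesis using N by (intro AE_I[of _ _ ?N]) (auto simp: sets_mu)
qed

text \<open>Exhaust \<open>XG\<close> by bounding the index of the value at the unit.\<close>

lemma emeasure_mu_XG_le:
  assumes K: "\<And>J. finite J \<Longrightarrow> J \<subseteq> carrier H \<Longrightarrow> (\<Sum>h\<in>J. emeasure \<nu> {w \<in> Omega. actH h w \<in> XG}) \<le> K"
  shows "emeasure \<mu> XG \<le> K"
proof -
  let ?A = "\<lambda>n. {w \<in> XG. eH (loc w \<one>\<^sub>G) \<le> n}"
  have A: "?A n \<in> sets BOmega" for n
  proof -
    have "{w \<in> Omega. eH (loc w \<one>\<^sub>G) \<le> n} \<in> sets BOmega"
      by (rule sets_BOmega_cylinder) (rule cylinder_loc)
    moreover have "?A n = XG \<inter> {w \<in> Omega. eH (loc w \<one>\<^sub>G) \<le> n}" by (auto simp: XG_def)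
    ultimately show ?thesis using sets_XG by simp
  qed
  have "emeasure \<mu> (?A n) \<le> K" for n
  proof -
    let ?J = "{h \<in> carrier H. eH h \<le> n}"
    have fin: "finite ?J"
      by (rule inj_on_finite[of eH _ "{..n}"]) (use inj_eH in \<open>auto intro: inj_on_subset\<close>)
    have "emeasure \<mu> (?A n) = (\<Sum>h\<in>?J. emeasure \<nu> {w \<in> Omega. actH h w \<in> ?A n})"
      using fin A loc_closed by (intro emeasure_mu_slices) (auto simp: XG_def)
    also have "\<dots> \<le> (\<Sum>h\<in>?J. emeasure \<nu> {w \<in> Omega. actH h w \<in> XG})"
      using measurable_sets[OF measurable_actH_nu sets_XG]
      by (intro sum_mono emeasure_mono) (auto simp: vimage_def Int_def conj_commute)
    also have "\<dots> \<le> K" using fin by (intro K) auto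
    finally show ?thesis .
  qed
  moreover have "(\<Union>n. ?A n) = XG" by auto
  moreover have "incseq ?A" by (auto simp: incseq_def)
  ultimately show ?thesis
    using SUP_emeasure_incseq[of ?A \<mu>] A by (metis (no_types, lifting) SUP_least image_subsetI sets_mu)
qed

definition \<phi> :: "'g \<Rightarrow> (nat \<Rightarrow> nat) \<Rightarrow> nat \<Rightarrow> nat" where "\<phi> g = restrict (actG g) Omega"
definition \<psi> :: "'h \<Rightarrow> (nat \<Rightarrow> nat) \<Rightarrow> nat \<Rightarrow> nat" where "\<psi> h = restrict (actH h) Omega"

lemma me_coupling_mu:
  assumes fin: "AE w in \<mu>. finite_fibres w" and XG: "emeasure \<mu> XG < \<infinity>"
  shows "me_coupling G H \<mu> \<phi> \<psi> XG XH"
proof (rule me_coupling.intro)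
  show "standard_borel \<mu>" by (rule standard_borel_BOmega[OF sets_mu])
  show "sigma_finite_measure \<mu>" by (rule sigma_finite_mu)
  have "free_mp_action G \<mu> (\<lambda>g. restrict (actG g) (space \<mu>))"
    by (rule free_mp_actionI[OF GG.is_group])
      (simp_all add: actG_closed actG_one actG_mult actG_free mu_actG measurable_actG
        measurable_cong_sets[OF sets_mu sets_mu])
  then show "free_mp_action G \<mu> \<phi>" by (simp add: \<phi>_def[abs_def])
  have "free_mp_action H \<mu> (\<lambda>h. restrict (actH h) (space \<mu>))"
    by (rule free_mp_actionI[OF HH.is_group])
      (simp_all add: actH_closed actH_one actH_mult actH_free mu_actH measurable_actH
        measurable_cong_sets[OF sets_mu sets_mu])
  then show "free_mp_action H \<mu> \<psi>" by (simp add: \<psi>_def[abs_def])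
  show "\<phi> g (\<psi> h x) = \<psi> h (\<phi> g x)" if "g \<in> carrier G" "h \<in> carrier H" "x \<in> space \<mu>" for g h x
    using that by (simp add: \<phi>_def \<psi>_def actG_closed actH_closed act_commute)
  have iffG: "y \<in> orbit G \<phi> x \<inter> XG \<longleftrightarrow> (\<exists>g\<in>carrier G. y = actG g x) \<and> y \<in> XG" if "x \<in> Omega" for x y
    using that by (auto simp: orbit_def \<phi>_def)
  have "AE x in \<mu>. \<exists>!y. y \<in> orbit G \<phi> x \<inter> XG"
    using fin AE_space
  proof eventually_elim
    case (elim x)
    then have "x \<in> Omega" by simp
    then show ?case unfolding iffG[OF \<open>x \<in> Omega\<close>] using ex1_XG elim(1) by blast
  qed
  then show "fundamental_domain G \<mu> \<phi> XG" by (simp add: fundamental_domain_def sets_mu sets_XG)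
  have iffH: "y \<in> orbit H \<psi> x \<inter> XH \<longleftrightarrow> (\<exists>h\<in>carrier H. y = actH h x) \<and> y \<in> XH" if "x \<in> Omega" for x y
    using that by (auto simp: orbit_def \<psi>_def)
  have "AE x in \<mu>. \<exists>!y. y \<in> orbit H \<psi> x \<inter> XH"
  proof (rule AE_I2)
    fix x assume "x \<in> space \<mu>"
    then have "x \<in> Omega" by simp
    then show "\<exists>!y. y \<in> orbit H \<psi> x \<inter> XH" unfolding iffH[OF \<open>x \<in> Omega\<close>] by (rule ex1_XH)
  qed
  then show "fundamental_domain H \<mu> \<psi> XH" by (simp add: fundamental_domain_def sets_mu sets_XH)
qed (rule emeasure_mu_XH XG)+

end

section \<open>Ultralimits of counting measures on sofic approximations\<close>

text \<open>By compactness the values cluster somewhere, and along an ultrafilter a cluster point is a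
  limit.\<close>

lemma ultrafilter_tendsto_exists:
  fixes f :: "nat \<Rightarrow> real"
  assumes U: "ultrafilter U" and f: "\<And>n. 0 \<le> f n" "\<And>n. f n \<le> 1"
  shows "\<exists>l. (f \<longlongrightarrow> l) U"
proof -
  have "filtermap f U \<noteq> bot" using U by (simp add: ultrafilter_def filtermap_bot_iff)
  moreover have "eventually (\<lambda>x. x \<in> {0..1}) (filtermap f U)" using f by (simp add: eventually_filtermap)
  ultimately obtain l where l: "inf (nhds l) (filtermap f U) \<noteq> bot"
    using compact_filter[of "{0..1::real}"] by blast
  have "eventually (\<lambda>n. f n \<in> S) U" if S: "open S" "l \<in> S" for S
  proof (rule ccontr)
    assume "\<not> ?thesis"
    then have "eventually (\<lambda>n. f n \<notin> S) U" using U unfolding ultrafilter_def by blast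
    then have "eventually (\<lambda>x. x \<notin> S) (filtermap f U)" by (simp add: eventually_filtermap)
    moreover have "eventually (\<lambda>x. x \<in> S) (nhds l)" using S by (rule eventually_nhds_in_open)
    ultimately have "eventually (\<lambda>x. False) (inf (nhds l) (filtermap f U))"
      unfolding eventually_inf by blast
    then show False using l by (simp add: trivial_limit_def)
  qed
  then show ?thesis using topological_tendstoI by blast
qed

lemma nonprincipal_ultrafilter_le_sequentially:
  assumes "nonprincipal_ultrafilter U" shows "U \<le> sequentially"
proof -
  have U: "ultrafilter U" and np: "\<And>a. U \<noteq> principal {a}"
    using assms by (auto simp: nonprincipal_ultrafilter_def)
  have ne: "eventually (\<lambda>n. n \<noteq> a) U" for a
  proof (rule ccontr)
    assume "\<not> ?thesis"
    then have ev: "eventually (\<lambda>n. n = a) U" using U unfolding ultrafilter_def by fastforce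
    have "U = principal {a}"
    proof (rule filter_eqI)
      fix P show "eventually P U = eventually P (principal {a})"
      proof
        assume "eventually P U"
        then have "eventually (\<lambda>n. P n \<and> n = a) U" using ev by (rule eventually_conj)
        then have "\<exists>n. P n \<and> n = a" using U eventually_happens unfolding ultrafilter_def by blast
        then show "eventually P (principal {a})" by (simp add: eventually_principal)
      next
        assume "eventually P (principal {a})"
        then have "P a" by (simp add: eventually_principal)
        then show "eventually P U" using ev by (auto elim: eventually_mono)
      qed
    qed
    then show False using np by blast
  qed
  have "eventually (\<lambda>n. n \<ge> N) U" for N
  proof (induction N)
    case (Suc N)
    then show ?case using ne[of N] by eventually_elim auto
  qed simp
  then show ?thesis by (simp add: le_sequentially)
qed

locale ultra_counting =
  fixes U :: "nat filter" and V :: "nat \<Rightarrow> 'v set"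
  assumes ultrafilter: "ultrafilter U" and finite_V: "\<And>n. finite (V n)"
    and nonempty: "eventually (\<lambda>n. V n \<noteq> {}) U"
begin

text \<open>A finitely additive probability on sequences of events. It plays the role of the Loeb measure
  on the ultraproduct of the \<open>V n\<close>, but for internal events only.\<close>

definition pr :: "(nat \<Rightarrow> 'v \<Rightarrow> bool) \<Rightarrow> real" where
  "pr Q = Lim U (\<lambda>n. real (card {x \<in> V n. Q n x}) / real (card (V n)))"

lemma U_nontrivial: "U \<noteq> bot" using ultrafilter by (simp add: ultrafilter_def)

lemma pr_tendsto: "((\<lambda>n. real (card {x \<in> V n. Q n x}) / real (card (V n))) \<longlongrightarrow> pr Q) U"
proof -
  have "card {x \<in> V n. Q n x} \<le> card (V n)" for n using finite_V by (intro card_mono) auto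
  then obtain l where "((\<lambda>n. real (card {x \<in> V n. Q n x}) / real (card (V n))) \<longlongrightarrow> l) U"
    using ultrafilter_tendsto_exists[OF ultrafilter,
        of "\<lambda>n. real (card {x \<in> V n. Q n x}) / real (card (V n))"]
    by (auto simp: divide_le_eq_1)
  then show ?thesis unfolding pr_def using tendsto_Lim[OF U_nontrivial, of _ l] by simp
qed

lemma pr_le:
  assumes "eventually (\<lambda>n. real (card {x \<in> V n. Q n x}) \<le> c * real (card (V n))) U"
  shows "pr Q \<le> c"
proof (rule tendsto_upperbound[OF pr_tendsto _ U_nontrivial])
  show "eventually (\<lambda>n. real (card {x \<in> V n. Q n x}) / real (card (V n)) \<le> c) U"
    using assms nonempty
  proof eventually_elim
    case (elim n)
    then have "real (card (V n)) > 0" using finite_V[of n] by (simp add: card_gt_0_iff)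
    then show ?case using elim by (simp add: divide_le_eq)
  qed
qed

lemma pr_less_imp:
  assumes "pr Q < c"
  shows "eventually (\<lambda>n. real (card {x \<in> V n. Q n x}) < c * real (card (V n))) U"
  using order_tendstoD(2)[OF pr_tendsto assms] nonempty
proof eventually_elim
  case (elim n)
  then have "real (card (V n)) > 0" using finite_V[of n] by (simp add: card_gt_0_iff)
  then show ?case using elim by (simp add: divide_less_eq)
qed

lemma pr_mono:
  assumes "eventually (\<lambda>n. \<forall>x\<in>V n. Q n x \<longrightarrow> R n x) U" shows "pr Q \<le> pr R"
proof (rule tendsto_le[OF U_nontrivial pr_tendsto pr_tendsto])
  show "eventually (\<lambda>n. real (card {x \<in> V n. Q n x}) / real (card (V n))
    \<le> real (card {x \<in> V n. R n x}) / real (card (V n))) U"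
    using assms
  proof eventually_elim
    case (elim n)
    then have "card {x \<in> V n. Q n x} \<le> card {x \<in> V n. R n x}"
      using finite_V by (intro card_mono) auto
    then show ?case by (simp add: divide_right_mono)
  qed
qed

lemma pr_mono': "(\<And>n x. x \<in> V n \<Longrightarrow> Q n x \<Longrightarrow> R n x) \<Longrightarrow> pr Q \<le> pr R"
  by (intro pr_mono always_eventually) auto

lemma pr_nonneg: "0 \<le> pr Q"
  by (rule tendsto_lowerbound[OF pr_tendsto _ U_nontrivial]) simp

lemma pr_True: "pr (\<lambda>n x. True) = 1"
proof (rule tendsto_unique[OF U_nontrivial pr_tendsto])
  have "eventually (\<lambda>n. 1 = real (card {x \<in> V n. True}) / real (card (V n))) U"
    using nonempty by eventually_elim (use finite_V in simp)
  then show "((\<lambda>n. real (card {x \<in> V n. True}) / real (card (V n))) \<longlongrightarrow> 1) U"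
    by (rule Lim_transform_eventually[OF tendsto_const])
qed

lemma pr_disj:
  assumes "\<And>n x. x \<in> V n \<Longrightarrow> \<not> (Q n x \<and> R n x)"
  shows "pr (\<lambda>n x. Q n x \<or> R n x) = pr Q + pr R"
proof (rule tendsto_unique[OF U_nontrivial pr_tendsto])
  have "card {x \<in> V n. Q n x \<or> R n x} = card {x \<in> V n. Q n x} + card {x \<in> V n. R n x}" for n
  proof -
    have "{x \<in> V n. Q n x \<or> R n x} = {x \<in> V n. Q n x} \<union> {x \<in> V n. R n x}" by auto
    moreover have "{x \<in> V n. Q n x} \<inter> {x \<in> V n. R n x} = {}" using assms by auto
    ultimately show ?thesis using finite_V by (simp add: card_Un_disjoint)
  qed
  then show "((\<lambda>n. real (card {x \<in> V n. Q n x \<or> R n x}) / real (card (V n))) \<longlongrightarrow> pr Q + pr R) U"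
    using tendsto_add[OF pr_tendsto[of Q] pr_tendsto[of R]] by (simp add: add_divide_distrib)
qed

lemma pr_not: "pr (\<lambda>n x. \<not> Q n x) = 1 - pr Q"
  using pr_disj[of Q "\<lambda>n x. \<not> Q n x"] pr_True by simp

lemma pr_disj_le: "pr (\<lambda>n x. Q n x \<or> R n x) \<le> pr Q + pr R"
proof -
  have "pr (\<lambda>n x. Q n x \<or> R n x) = pr (\<lambda>n x. Q n x \<or> (R n x \<and> \<not> Q n x))"
    by (rule arg_cong[of _ _ pr]) auto
  also have "\<dots> = pr Q + pr (\<lambda>n x. R n x \<and> \<not> Q n x)" by (rule pr_disj) auto
  also have "\<dots> \<le> pr Q + pr R" by (intro add_left_mono pr_mono') auto
  finally show ?thesis .
qed

lemma stat_negligibleD: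
  assumes "stat_negligible U V bad" "\<And>C n. bad C n \<subseteq> V n" "e > 0"
  shows "\<exists>C :: nat. pr (\<lambda>n x. x \<in> bad (real C) n) < e"
proof -
  have "measure (uniform_count_measure (V n)) (bad C n)
    = real (card {x \<in> V n. x \<in> bad C n}) / real (card (V n))" for C n
  proof -
    have "{x \<in> V n. x \<in> bad C n} = bad C n" using assms(2) by blast
    then show ?thesis using assms(2) finite_V by (simp add: measure_uniform_count_measure)
  qed
  then have "((\<lambda>C. pr (\<lambda>n x. x \<in> bad C n)) \<longlongrightarrow> 0) at_top"
    using assms(1) by (simp add: stat_negligible_def pr_def)
  then have "eventually (\<lambda>C. pr (\<lambda>n x. x \<in> bad C n) < e) at_top"
    using assms(3) by (rule order_tendstoD(2))
  then obtain C0 where "\<And>C. C \<ge> C0 \<Longrightarrow> pr (\<lambda>n x. x \<in> bad C n) < e"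
    unfolding eventually_at_top_linorder by blast
  then show ?thesis using real_arch_simple[of C0] by blast
qed

end

lemma sofic_approximation_locally_cayley:
  assumes "marked_group G S" and sofic: "sofic_approximation G S \<Gamma>"
  shows "(\<lambda>n. real (card {x \<in> lverts (\<Gamma> n). \<not> locally_cayley G S (\<Gamma> n) r x}) / real (card (lverts (\<Gamma> n))))
    \<longlonglongrightarrow> 0" (is "?b \<longlonglongrightarrow> 0")
    and "eventually (\<lambda>n. lverts (\<Gamma> n) \<noteq> {}) sequentially"
proof -
  interpret marked_group G S by fact
  let ?good = "\<lambda>n. sofic_good_vertices G S (\<Gamma> n) (real (Suc r))"
  let ?g = "\<lambda>n. real (card (?good n)) / real (card (lverts (\<Gamma> n)))"
  have g: "?g \<longlonglongrightarrow> 1"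
    using sofic by (auto simp: sofic_approximation_def simp del: of_nat_Suc)
  have "eventually (\<lambda>n. ?g n > 0) sequentially" by (rule order_tendstoD(1)[OF g]) simp
  then show ne: "eventually (\<lambda>n. lverts (\<Gamma> n) \<noteq> {}) sequentially"
    by eventually_elim auto
  have fin: "finite_lgraph S (\<Gamma> n)" for n using sofic by (auto simp: sofic_approximation_def)
  have "eventually (\<lambda>n. ?b n \<le> 1 - ?g n) sequentially"
    using ne
  proof eventually_elim
    case (elim n)
    have fV: "finite (lverts (\<Gamma> n))" using fin[of n] by (simp add: finite_lgraph_def)
    have sub: "?good n \<subseteq> lverts (\<Gamma> n)" by (auto simp: sofic_good_vertices_def)
    have "{x \<in> lverts (\<Gamma> n). \<not> locally_cayley G S (\<Gamma> n) r x} \<subseteq> lverts (\<Gamma> n) - ?good n"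
      using locally_cayley_mono[OF locally_cayley_if_good[OF fin], of _ n "Suc r" r] by auto
    then have "card {x \<in> lverts (\<Gamma> n). \<not> locally_cayley G S (\<Gamma> n) r x} \<le> card (lverts (\<Gamma> n) - ?good n)"
      using fV by (intro card_mono) auto
    also have "\<dots> = card (lverts (\<Gamma> n)) - card (?good n)"
      using sub fV by (intro card_Diff_subset) (auto intro: finite_subset)
    finally have "real (card {x \<in> lverts (\<Gamma> n). \<not> locally_cayley G S (\<Gamma> n) r x})
      \<le> real (card (lverts (\<Gamma> n))) - real (card (?good n))"
      using card_mono[OF fV sub] by linarith
    moreover have "real (card (lverts (\<Gamma> n))) > 0" using elim fV by (simp add: card_gt_0_iff)
    ultimately show ?case by (simp add: field_simps)
  qed
  moreover have "eventually (\<lambda>n. 0 \<le> ?b n) sequentially" by simp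
  moreover have "(\<lambda>n. 1 - ?g n) \<longlonglongrightarrow> 0" using tendsto_diff[OF tendsto_const[of 1] g] by simp
  ultimately show "?b \<longlonglongrightarrow> 0"
    using tendsto_sandwich[of "\<lambda>_. 0" ?b sequentially "\<lambda>n. 1 - ?g n" 0] by simp
qed

text \<open>Greedy colouring: a new vertex has at most \<open>N\<close> neighbours, and there are \<open>N + 1\<close> colours.\<close>

lemma finite_graph_colouring:
  assumes "finite V" and "\<And>x y. R x y \<Longrightarrow> R y x" and "\<And>x. x \<in> V \<Longrightarrow> card {y \<in> V. R x y} \<le> N"
  shows "\<exists>c :: 'v \<Rightarrow> nat. (\<forall>x. c x \<le> N) \<and> (\<forall>x\<in>V. \<forall>y\<in>V. x \<noteq> y \<longrightarrow> R x y \<longrightarrow> c x \<noteq> c y)"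
  using assms(1,3)
proof (induction V rule: finite_induct)
  case empty
  then show ?case by (intro exI[of _ "\<lambda>_. 0"]) simp
next
  case (insert x F)
  have "card {z \<in> F. R y z} \<le> N" if "y \<in> F" for y
  proof -
    have "card {z \<in> F. R y z} \<le> card {z \<in> insert x F. R y z}"
      using insert.hyps by (intro card_mono) auto
    then show ?thesis using insert.prems[of y] that by simp
  qed
  then obtain c where c: "\<And>y. c y \<le> N" "\<And>y z. y \<in> F \<Longrightarrow> z \<in> F \<Longrightarrow> y \<noteq> z \<Longrightarrow> R y z \<Longrightarrow> c y \<noteq> c z"
    using insert.IH by blast
  have "card (c ` {z \<in> F. R x z}) \<le> card {z \<in> F. R x z}" using insert.hyps by (intro card_image_le) auto
  also have "\<dots> \<le> card {z \<in> insert x F. R x z}" using insert.hyps by (intro card_mono) auto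
  also have "\<dots> < card {..N}" using insert.prems[of x] by simp
  finally have "\<not> {..N} \<subseteq> c ` {z \<in> F. R x z}"
    using card_mono[of "c ` {z \<in> F. R x z}" "{..N}"] insert.hyps by auto
  then obtain k where k: "k \<le> N" "k \<notin> c ` {z \<in> F. R x z}" by auto
  show ?case
  proof (intro exI[of _ "c(x := k)"] conjI allI ballI impI)
    fix y z assume yz: "y \<in> insert x F" "z \<in> insert x F" "y \<noteq> z" "R y z"
    show "(c(x := k)) y \<noteq> (c(x := k)) z"
    proof (cases "y = x")
      case True
      then have "z \<in> F" "R x z" "z \<noteq> x" using yz by auto
      then show ?thesis using k(2) True by auto
    next
      case False
      then have yF: "y \<in> F" using yz by auto
      show ?thesis
      proof (cases "z = x")
        case True
        then have "R x y" using yz(4) assms(2) by blast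
        then show ?thesis using k(2) True False yF by auto
      next
        case False
        then show ?thesis using c(2)[OF yF _ yz(3,4)] yz(2) \<open>y \<noteq> x\<close> by auto
      qed
    qed
  qed (use c k in auto)
qed

locale sofic_coarse_equivalence =
  group_pair G SG H SH
  for G :: "('g, 'a) monoid_scheme" and SG and H :: "('h, 'b) monoid_scheme" and SH +
  fixes \<G> :: "nat \<Rightarrow> ('v, 'g) lgraph" and \<H> :: "nat \<Rightarrow> ('w, 'h) lgraph"
    and U :: "nat filter" and u :: "nat \<Rightarrow> 'v \<Rightarrow> 'w"
  assumes sofic_G: "sofic_approximation G SG \<G>" and sofic_H: "sofic_approximation H SH \<H>"
    and U: "nonprincipal_ultrafilter U"
    and u_closed: "\<And>n. u n \<in> lverts (\<G> n) \<rightarrow> lverts (\<H> n)"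
    and coarse: "map_sequence.stat_coarse_equivalence U
      (\<lambda>n. lverts (\<G> n)) (\<lambda>n. gdist (\<G> n)) (\<lambda>n. lverts (\<H> n)) (\<lambda>n. gdist (\<H> n)) u"
begin

abbreviation "VG n \<equiv> lverts (\<G> n)"
abbreviation "VH n \<equiv> lverts (\<H> n)"
abbreviation "cayG n r x \<equiv> locally_cayley G SG (\<G> n) r x"
abbreviation "cayH n r z \<equiv> locally_cayley H SH (\<H> n) r z"

lemma fin_G: "finite_lgraph SG (\<G> n)" and fin_H: "finite_lgraph SH (\<H> n)"
  using sofic_G sofic_H by (auto simp: sofic_approximation_def)

lemma finite_VG: "finite (VG n)" and finite_VH: "finite (VH n)"
  using fin_G[of n] fin_H[of n] by (auto simp: finite_lgraph_def)

lemma u_in: "x \<in> VG n \<Longrightarrow> u n x \<in> VH n" using u_closed by auto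

lemma U_seq: "U \<le> sequentially" by (rule nonprincipal_ultrafilter_le_sequentially[OF U])

sublocale A: ultra_counting U VG
  using U sofic_approximation_locally_cayley(2)[OF GG.marked_group_axioms sofic_G] U_seq finite_VG
  by unfold_locales (auto simp: nonprincipal_ultrafilter_def filter_leD)

sublocale B: ultra_counting U VH
  using U sofic_approximation_locally_cayley(2)[OF HH.marked_group_axioms sofic_H] U_seq finite_VH
  by unfold_locales (auto simp: nonprincipal_ultrafilter_def filter_leD)

abbreviation "pr \<equiv> A.pr"

lemma pr_cayG: "pr (\<lambda>n x. \<not> cayG n r x) = 0"
  using tendsto_unique[OF A.U_nontrivial A.pr_tendsto
      tendsto_mono[OF U_seq sofic_approximation_locally_cayley(1)[OF GG.marked_group_axioms sofic_G]]] .

lemma pr_H_cayH: "B.pr (\<lambda>n x. \<not> cayH n r x) = 0"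
  using tendsto_unique[OF B.U_nontrivial B.pr_tendsto
      tendsto_mono[OF U_seq sofic_approximation_locally_cayley(1)[OF HH.marked_group_axioms sofic_H]]] .

lemma degree_G: "\<exists>D. \<forall>n x r. x \<in> VG n \<longrightarrow> card {y. reach (\<G> n) r x y} \<le> (D + 1) ^ r"
proof -
  obtain D where "\<And>n x. x \<in> VG n \<Longrightarrow> card {(a, s, b) \<in> ledges (\<G> n). a = x \<or> b = x} \<le> D"
    using sofic_G unfolding sofic_approximation_def uniformly_bounded_degree_def by blast
  then show ?thesis using card_reach_le[OF fin_G GG.finite_S] by blast
qed

lemma degree_H: "\<exists>D. \<forall>n x r. x \<in> VH n \<longrightarrow> card {y. reach (\<H> n) r x y} \<le> (D + 1) ^ r"
proof -
  obtain D where "\<And>n x. x \<in> VH n \<Longrightarrow> card {(a, s, b) \<in> ledges (\<H> n). a = x \<or> b = x} \<le> D"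
    using sofic_H unfolding sofic_approximation_def uniformly_bounded_degree_def by blast
  then show ?thesis using card_reach_le[OF fin_H HH.finite_S] by blast
qed

lemmas coarse_unfolded = coarse[unfolded map_sequence.stat_coarse_equivalence_def
    map_sequence.stat_coarsely_bijective_def map_sequence.stat_lipschitz_def
    map_sequence.stat_expansive_def map_sequence.stat_coarsely_surjective_def]

lemma ediam_less_imp: "ediam d A < c \<Longrightarrow> x \<in> A \<Longrightarrow> y \<in> A \<Longrightarrow> d x y < c"
  unfolding ediam_def by (meson SUP_upper order_le_less_trans)

text \<open>The hypotheses on \<open>u\<close> in terms of \<open>reach\<close>. They are stated for positive radii, and are
  therefore applied with \<open>Suc r\<close>.\<close>

lemma lipschitz:
  assumes "e > 0"
  shows "\<exists>C. pr (\<lambda>n x. \<exists>y\<in>VG n. reach (\<G> n) r x y \<and> \<not> reach (\<H> n) C (u n x) (u n y)) < e"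
proof -
  let ?bad = "\<lambda>C n. {y \<in> VG n. ediam (gdist (\<H> n)) (u n ` gball (\<G> n) y (real (Suc r))) \<ge> ennreal C}"
  have "stat_negligible U VG ?bad" using coarse_unfolded by simp
  then obtain C :: nat where C: "pr (\<lambda>n x. x \<in> ?bad (real C) n) < e"
    using A.stat_negligibleD[of ?bad e] assms by auto
  have "pr (\<lambda>n x. \<exists>y\<in>VG n. reach (\<G> n) r x y \<and> \<not> reach (\<H> n) C (u n x) (u n y))
      \<le> pr (\<lambda>n x. x \<in> ?bad (real C) n)"
  proof (rule A.pr_mono')
    fix n x assume x: "x \<in> VG n"
    assume "\<exists>y\<in>VG n. reach (\<G> n) r x y \<and> \<not> reach (\<H> n) C (u n x) (u n y)"
    then obtain y where y: "y \<in> VG n" "reach (\<G> n) r x y" "\<not> reach (\<H> n) C (u n x) (u n y)" by blast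
    have "reach (\<G> n) (Suc r) x y" using reach_mono[OF y(2)] by simp
    then have "x \<in> gball (\<G> n) x (real (Suc r))" "y \<in> gball (\<G> n) x (real (Suc r))"
      unfolding eball_def gdist_le_iff_reach using x y(1) by auto
    then have "gdist (\<H> n) (u n x) (u n y) < ennreal (real C)"
      if "ediam (gdist (\<H> n)) (u n ` gball (\<G> n) x (real (Suc r))) < ennreal (real C)"
      using ediam_less_imp[OF that, of "u n x" "u n y"] by blast
    then show "x \<in> ?bad (real C) n"
      using y(3) x gdist_le_iff_reach[of "\<H> n" "u n x" "u n y" C] not_le by fastforce
  qed
  then show ?thesis using C by (meson order_le_less_trans)
qed

lemma expansive:
  assumes "e > 0"
  shows "\<exists>C. pr (\<lambda>n x. \<exists>y\<in>VG n. reach (\<H> n) r (u n x) (u n y) \<and> \<not> reach (\<G> n) C x y) < e"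
proof -
  let ?A = "\<lambda>n y. u n -` gball (\<H> n) (u n y) (real (Suc r)) \<inter> VG n"
  let ?bad = "\<lambda>C n. {y \<in> VG n. ediam (gdist (\<G> n)) (?A n y) \<ge> ennreal C}"
  have "stat_negligible U VG ?bad" using coarse_unfolded by simp
  then obtain C :: nat where C: "pr (\<lambda>n x. x \<in> ?bad (real C) n) < e"
    using A.stat_negligibleD[of ?bad e] assms by auto
  have "pr (\<lambda>n x. \<exists>y\<in>VG n. reach (\<H> n) r (u n x) (u n y) \<and> \<not> reach (\<G> n) C x y)
      \<le> pr (\<lambda>n x. x \<in> ?bad (real C) n)"
  proof (rule A.pr_mono')
    fix n x assume x: "x \<in> VG n"
    assume "\<exists>y\<in>VG n. reach (\<H> n) r (u n x) (u n y) \<and> \<not> reach (\<G> n) C x y"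
    then obtain y where y: "y \<in> VG n" "reach (\<H> n) r (u n x) (u n y)" "\<not> reach (\<G> n) C x y" by blast
    have "reach (\<H> n) (Suc r) (u n x) (u n y)" using reach_mono[OF y(2)] by simp
    then have "x \<in> ?A n x" "y \<in> ?A n x"
      unfolding eball_def gdist_le_iff_reach using x y(1) u_in by auto
    then have "gdist (\<G> n) x y < ennreal (real C)"
      if "ediam (gdist (\<G> n)) (?A n x) < ennreal (real C)"
      using ediam_less_imp[OF that, of x y] by blast
    then show "x \<in> ?bad (real C) n"
      using y(3) x gdist_le_iff_reach[of "\<G> n" x y C] not_le by fastforce
  qed
  then show ?thesis using C by (meson order_le_less_trans)
qed

text \<open>For a suitable \<open>C\<close> at least half of the vertices of \<open>\<H> n\<close> are at distance at most \<open>C\<close> from the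
  image, and balls have bounded cardinality.\<close>

lemma card_VH_le: "\<exists>K>0. eventually (\<lambda>n. real (card (VH n)) \<le> K * real (card (VG n))) U"
proof -
  let ?bad = "\<lambda>C n. {z \<in> VH n. esetdist (gdist (\<H> n)) z (u n ` VG n) \<ge> ennreal C}"
  have "stat_negligible U VH ?bad" using coarse_unfolded by simp
  then obtain C :: nat where C: "B.pr (\<lambda>n x. x \<in> ?bad (real C) n) < 1/2"
    using B.stat_negligibleD[of ?bad "1/2"] by auto
  obtain D where D: "\<And>n x r. x \<in> VH n \<Longrightarrow> card {y. reach (\<H> n) r x y} \<le> (D + 1) ^ r"
    using degree_H by blast
  let ?K = "(D + 1) ^ C"
  have "eventually (\<lambda>n. real (card (VH n)) \<le> (2 * real ?K) * real (card (VG n))) U"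
    using B.pr_less_imp[OF C]
  proof eventually_elim
    case (elim n)
    let ?near = "{z \<in> VH n. z \<notin> ?bad (real C) n}"
    have "?near \<subseteq> (\<Union>x\<in>VG n. {z. reach (\<H> n) C (u n x) z})"
    proof
      fix z assume z: "z \<in> ?near"
      then have "esetdist (gdist (\<H> n)) z (u n ` VG n) < ennreal (real C)" by (auto simp: not_le)
      then obtain x where "x \<in> VG n" "gdist (\<H> n) z (u n x) < ennreal (real C)"
        unfolding esetdist_def by (auto simp: INF_less_iff)
      then have "x \<in> VG n" "reach (\<H> n) C z (u n x)"
        using gdist_le_iff_reach[of "\<H> n" z "u n x" C] by auto
      then show "z \<in> (\<Union>x\<in>VG n. {z. reach (\<H> n) C (u n x) z})" using reach_sym by fast
    qed
    moreover have "finite {z. reach (\<H> n) C (u n x) z}" if "x \<in> VG n" for x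
      using reach_lverts[OF fin_H _ u_in[OF that]] finite_VH[of n]
      by (auto intro: finite_subset[of _ "VH n"])
    ultimately have "card ?near \<le> card (\<Union>x\<in>VG n. {z. reach (\<H> n) C (u n x) z})"
      using finite_VG by (intro card_mono) auto
    also have "\<dots> \<le> (\<Sum>x\<in>VG n. card {z. reach (\<H> n) C (u n x) z})" by (rule card_UN_le[OF finite_VG])
    also have "\<dots> \<le> (\<Sum>x\<in>VG n. ?K)" by (intro sum_mono D u_in)
    finally have near: "card ?near \<le> ?K * card (VG n)" by (simp add: mult.commute)
    have "VH n = {z \<in> VH n. z \<in> ?bad (real C) n} \<union> ?near" by auto
    then have "card (VH n) \<le> card {z \<in> VH n. z \<in> ?bad (real C) n} + card ?near"
      by (metis (no_types, lifting) card_Un_le)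
    with near elim have "real (card (VH n)) \<le> 1/2 * real (card (VH n)) + real (?K * card (VG n))"
      by linarith
    then show ?case by simp
  qed
  moreover have "2 * real ?K > 0" by simp
  ultimately show ?thesis by blast
qed

text \<open>A random vertex is sent to a good vertex with high probability. Up to a small set of
  vertices \<open>x\<close>, fibres have bounded diameter and hence at most \<open>B\<close> elements. The bad vertices of \<open>\<H> n\<close>
  then have at most \<open>B\<close> times as many preimages of this kind, and by \<open>card_VH_le\<close> this is negligible in
  comparison with \<open>card (\<G> n)\<close>.\<close>

lemma pr_cayH: "pr (\<lambda>n x. \<not> cayH n r (u n x)) = 0"
proof -
  have "pr (\<lambda>n x. \<not> cayH n r (u n x)) \<le> 0 + e" if e: "e > 0" for e
  proof -
    obtain C where C: "pr (\<lambda>n x. \<exists>y\<in>VG n. reach (\<H> n) 0 (u n x) (u n y) \<and> \<not> reach (\<G> n) C x y) < e / 2"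
      using expansive[of "e / 2" 0] e by auto
    let ?far = "\<lambda>n x. \<exists>y\<in>VG n. reach (\<H> n) 0 (u n x) (u n y) \<and> \<not> reach (\<G> n) C x y"
    let ?Q = "\<lambda>n x. \<not> cayH n r (u n x) \<and> \<not> ?far n x"
    obtain K where K: "K > 0" "eventually (\<lambda>n. real (card (VH n)) \<le> K * real (card (VG n))) U"
      using card_VH_le by blast
    obtain D where D: "\<And>n x r. x \<in> VG n \<Longrightarrow> card {y. reach (\<G> n) r x y} \<le> (D + 1) ^ r"
      using degree_G by blast
    let ?B = "real ((D + 1) ^ C)"
    have B: "?B > 0" by simp
    have "B.pr (\<lambda>n x. \<not> cayH n r x) < e / (2 * ?B * K)" using pr_H_cayH e B K(1) by simp
    from B.pr_less_imp[OF this] K(2)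
    have "eventually (\<lambda>n. real (card {x \<in> VG n. ?Q n x}) \<le> e / 2 * real (card (VG n))) U"
    proof eventually_elim
      case (elim n)
      let ?bad = "{z \<in> VH n. \<not> cayH n r z}" and ?F = "\<lambda>z. {x \<in> VG n. u n x = z \<and> \<not> ?far n x}"
      have F: "card (?F z) \<le> (D + 1) ^ C" for z
      proof (cases "?F z = {}")
        case False
        then obtain x where x: "x \<in> ?F z" by blast
        then have "?F z \<subseteq> {y. reach (\<G> n) C x y}" using reach_refl[of "\<H> n" 0 z] by fastforce
        moreover have "finite {y. reach (\<G> n) C x y}"
          using reach_lverts[OF fin_G, of n C x] x finite_VG[of n] by (auto intro: finite_subset[of _ "VG n"])
        ultimately have "card (?F z) \<le> card {y. reach (\<G> n) C x y}" by (intro card_mono)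
        also have "\<dots> \<le> (D + 1) ^ C" using D x by blast
        finally show ?thesis .
      qed (simp only: card.empty)
      have "{x \<in> VG n. ?Q n x} \<subseteq> (\<Union>z\<in>?bad. ?F z)" using u_in by auto
      then have "card {x \<in> VG n. ?Q n x} \<le> card (\<Union>z\<in>?bad. ?F z)"
        using finite_VG finite_VH by (intro card_mono) auto
      also have "\<dots> \<le> (\<Sum>z\<in>?bad. card (?F z))" using finite_VH by (intro card_UN_le) auto
      also have "\<dots> \<le> (\<Sum>z\<in>?bad. (D + 1) ^ C)" by (intro sum_mono F)
      finally have "card {x \<in> VG n. ?Q n x} \<le> card ?bad * (D + 1) ^ C"
        unfolding sum_constant of_nat_id .
      then have "real (card {x \<in> VG n. ?Q n x}) \<le> real (card ?bad) * ?B"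
        unfolding of_nat_mult[symmetric] of_nat_le_iff .
      also have "\<dots> \<le> (e / (2 * ?B * K) * real (card (VH n))) * ?B"
        using elim(1) by (intro mult_right_mono) auto
      also have "\<dots> \<le> (e / (2 * ?B * K) * (K * real (card (VG n)))) * ?B"
        using elim(2) e B K(1) by (intro mult_right_mono mult_left_mono) auto
      also have "\<dots> = e / 2 * real (card (VG n))" using B K(1) by (simp add: field_simps)
      finally show ?case .
    qed
    then have "pr ?Q \<le> e / 2" by (rule A.pr_le)
    moreover have "pr (\<lambda>n x. \<not> cayH n r (u n x)) \<le> pr (\<lambda>n x. ?Q n x \<or> ?far n x)"
      by (rule A.pr_mono') auto
    moreover have "\<dots> \<le> pr ?Q + pr ?far" by (rule A.pr_disj_le)
    ultimately show ?thesis using C by linarith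
  qed
  then have "pr (\<lambda>n x. \<not> cayH n r (u n x)) \<le> 0" by (rule field_le_epsilon)
  then show ?thesis using A.pr_nonneg[of "\<lambda>n x. \<not> cayH n r (u n x)"] by linarith
qed

end

section \<open>The law of the view from a random vertex\<close>

context sofic_coarse_equivalence
begin

definition is_colouring :: "(nat \<Rightarrow> nat \<Rightarrow> 'v \<Rightarrow> nat) \<Rightarrow> (nat \<Rightarrow> nat) \<Rightarrow> bool" where
  "is_colouring c N \<longleftrightarrow> (\<forall>n r x. c n r x \<le> N r) \<and>
     (\<forall>n r. \<forall>x\<in>VG n. \<forall>y\<in>VG n. x \<noteq> y \<longrightarrow> reach (\<G> n) r x y \<longrightarrow> c n r x \<noteq> c n r y)"

text \<open>For the distance \<open>r\<close> the number of colours does not depend on \<open>n\<close>, since degrees are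
  uniformly bounded. This keeps the colours tight in the limit.\<close>

definition colour :: "nat \<Rightarrow> nat \<Rightarrow> 'v \<Rightarrow> nat" where
  "colour = (SOME c. \<exists>N. is_colouring c N)"

lemma colour: "\<exists>N. is_colouring colour N"
proof -
  obtain D where D: "\<And>n x r. x \<in> VG n \<Longrightarrow> card {y. reach (\<G> n) r x y} \<le> (D + 1) ^ r"
    using degree_G by blast
  have "\<exists>c :: 'v \<Rightarrow> nat. (\<forall>x. c x \<le> (D + 1) ^ r) \<and>
    (\<forall>x\<in>VG n. \<forall>y\<in>VG n. x \<noteq> y \<longrightarrow> reach (\<G> n) r x y \<longrightarrow> c x \<noteq> c y)" for n r
  proof (rule finite_graph_colouring[OF finite_VG])
    fix x assume x: "x \<in> VG n"
    have "finite {y. reach (\<G> n) r x y}"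
      using reach_lverts[OF fin_G _ x] finite_VG[of n] by (auto intro: finite_subset[of _ "VG n"])
    then have "card {y \<in> VG n. reach (\<G> n) r x y} \<le> card {y. reach (\<G> n) r x y}"
      by (intro card_mono) auto
    then show "card {y \<in> VG n. reach (\<G> n) r x y} \<le> (D + 1) ^ r" using D[OF x, of r] by linarith
  qed (rule reach_sym)
  then have "\<forall>n r. \<exists>c :: 'v \<Rightarrow> nat. (\<forall>x. c x \<le> (D + 1) ^ r) \<and>
    (\<forall>x\<in>VG n. \<forall>y\<in>VG n. x \<noteq> y \<longrightarrow> reach (\<G> n) r x y \<longrightarrow> c x \<noteq> c y)" by (intro allI)
  then obtain c :: "nat \<Rightarrow> nat \<Rightarrow> 'v \<Rightarrow> nat" where "\<forall>n r. (\<forall>x. c n r x \<le> (D + 1) ^ r) \<and>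
    (\<forall>x\<in>VG n. \<forall>y\<in>VG n. x \<noteq> y \<longrightarrow> reach (\<G> n) r x y \<longrightarrow> c n r x \<noteq> c n r y)"
    unfolding choice_iff by blast
  then have "is_colouring c (\<lambda>r. (D + 1) ^ r)" unfolding is_colouring_def by blast
  then have "\<exists>c N. is_colouring c N" by blast
  then show ?thesis unfolding colour_def by (rule someI_ex)
qed

lemma colour_bounded: "\<exists>N. \<forall>n x. colour n r x \<le> N"
  using colour unfolding is_colouring_def by blast

lemma colour_separated:
  "x \<in> VG n \<Longrightarrow> y \<in> VG n \<Longrightarrow> x \<noteq> y \<Longrightarrow> reach (\<G> n) r x y \<Longrightarrow> colour n r x \<noteq> colour n r y"
  using colour unfolding is_colouring_def by blast

abbreviation "pactG n x g \<equiv> GG.pact (\<G> n) x g"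
abbreviation "pactH n z h \<equiv> HH.pact (\<H> n) z h"
abbreviation "dispG n x y \<equiv> GG.displacement (\<G> n) x y"
abbreviation "dispH n z z' \<equiv> HH.displacement (\<H> n) z z'"

definition view :: "nat \<Rightarrow> 'v \<Rightarrow> nat \<Rightarrow> nat" where
  "view n x = config (\<lambda>k. dispH n (u n x) (u n (pactG n x k))) (\<lambda>k r. colour n r (pactG n x k))"

lemma dispH_closed: "dispH n z z' \<in> carrier H" by (rule HH.displacement_closed[OF fin_H])

lemma loc_view: "k \<in> carrier G \<Longrightarrow> loc (view n x) k = dispH n (u n x) (u n (pactG n x k))"
  unfolding view_def by (simp add: loc_config dispH_closed)

lemma col_view: "k \<in> carrier G \<Longrightarrow> col (view n x) k r = colour n r (pactG n x k)"
  unfolding view_def by (simp add: col_config)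

text \<open>The vertices at which computations with \<open>x \<cdot> k\<close> and its image are valid for all \<open>k\<close> in \<open>K\<close>. The
  order of quantifiers in \<open>pr_nice\<close> matters: \<open>C\<close> comes from the Lipschitz condition, and only then the
  radius \<open>R\<close> is chosen, as large as the computation with \<open>C\<close> requires.\<close>

definition nice :: "'g set \<Rightarrow> nat \<Rightarrow> nat \<Rightarrow> nat \<Rightarrow> 'v \<Rightarrow> bool" where
  "nice K C R n x \<longleftrightarrow> cayG n R x \<and> cayH n R (u n x) \<and>
     (\<forall>k\<in>K. GG.len k \<le> R \<and> reach (\<H> n) C (u n x) (u n (pactG n x k)))"

lemma pactG_VG:
  assumes "cayG n R x" "k \<in> carrier G" "GG.len k \<le> R" shows "pactG n x k \<in> VG n"
  using reach_lverts[OF fin_G GG.reach_pact[OF fin_G assms]] assms(1) by (simp add: locally_cayley_def)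

lemma pr_nice:
  assumes K: "finite K" "K \<subseteq> carrier G" and e: "e > 0"
  shows "\<exists>C. \<forall>R. \<exists>R'\<ge>R. pr (\<lambda>n x. \<not> nice K C R' n x) \<le> e"
proof -
  let ?r = "\<Sum>k\<in>K. GG.len k"
  have r: "GG.len k \<le> ?r" if "k \<in> K" for k using that K(1) by (intro member_le_sum) auto
  obtain C where C: "pr (\<lambda>n x. \<exists>y\<in>VG n. reach (\<G> n) ?r x y \<and> \<not> reach (\<H> n) C (u n x) (u n y)) < e"
    using lipschitz[OF e] by blast
  let ?bad = "\<lambda>n x. \<exists>y\<in>VG n. reach (\<G> n) ?r x y \<and> \<not> reach (\<H> n) C (u n x) (u n y)"
  have "pr (\<lambda>n x. \<not> nice K C (R + ?r) n x) \<le> e" for R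
  proof -
    have "pr (\<lambda>n x. \<not> nice K C (R + ?r) n x)
      \<le> pr (\<lambda>n x. \<not> cayG n (R + ?r) x \<or> (\<not> cayH n (R + ?r) (u n x) \<or> ?bad n x))"
    proof (rule A.pr_mono')
      fix n x assume "x \<in> VG n" and not: "\<not> nice K C (R + ?r) n x"
      show "\<not> cayG n (R + ?r) x \<or> (\<not> cayH n (R + ?r) (u n x) \<or> ?bad n x)"
      proof (rule ccontr)
        assume ok: "\<not> ?thesis"
        have "GG.len k \<le> R + ?r \<and> reach (\<H> n) C (u n x) (u n (pactG n x k))" if k: "k \<in> K" for k
        proof -
          have kc: "k \<in> carrier G" "GG.len k \<le> R + ?r" using k K(2) r[OF k] by auto
          have "cayG n (R + ?r) x" using ok by blast
          then have "pactG n x k \<in> VG n" "reach (\<G> n) (GG.len k) x (pactG n x k)"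
            using pactG_VG[OF _ kc] GG.reach_pact[OF fin_G _ kc] by blast+
          then have "pactG n x k \<in> VG n" "reach (\<G> n) ?r x (pactG n x k)" using reach_mono r[OF k] by metis+
          then show ?thesis using ok kc(2) by blast
        qed
        then show False using not ok unfolding nice_def by blast
      qed
    qed
    also have "\<dots> \<le> pr (\<lambda>n x. \<not> cayG n (R + ?r) x) + pr (\<lambda>n x. \<not> cayH n (R + ?r) (u n x) \<or> ?bad n x)"
      by (rule A.pr_disj_le)
    also have "\<dots> \<le> pr (\<lambda>n x. \<not> cayG n (R + ?r) x) + (pr (\<lambda>n x. \<not> cayH n (R + ?r) (u n x)) + pr ?bad)"
      by (intro add_left_mono A.pr_disj_le)
    finally show ?thesis using C pr_cayG[of "R + ?r"] pr_cayH[of "R + ?r"] by linarith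
  qed
  then show ?thesis by (metis le_add1)
qed

lemma nice_mono: "nice K C R' n x \<Longrightarrow> R \<le> R' \<Longrightarrow> cayG n R x \<and> cayH n R (u n x)"
  unfolding nice_def by (meson locally_cayley_mono)

text \<open>The way in which all comparisons of probabilities are made: an implication between events
  only has to be checked at vertices that are nice with a radius that may depend on \<open>C\<close>.\<close>

lemma pr_le_nice:
  assumes K: "finite K" "K \<subseteq> carrier G"
    and imp: "\<And>C. \<exists>R. \<forall>R'\<ge>R. \<forall>n x. x \<in> VG n \<longrightarrow> nice K C R' n x \<longrightarrow> Q n x \<longrightarrow> Q' n x"
  shows "pr Q \<le> pr Q'"
proof (rule field_le_epsilon)
  fix e :: real assume e: "e > 0"
  obtain C where C: "\<And>R. \<exists>R'\<ge>R. pr (\<lambda>n x. \<not> nice K C R' n x) \<le> e" using pr_nice[OF K e] by blast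
  obtain R where R: "\<And>R' n x. R' \<ge> R \<Longrightarrow> x \<in> VG n \<Longrightarrow> nice K C R' n x \<Longrightarrow> Q n x \<Longrightarrow> Q' n x"
    using imp[of C] by blast
  obtain R' where R': "R' \<ge> R" "pr (\<lambda>n x. \<not> nice K C R' n x) \<le> e" using C by blast
  have "pr Q \<le> pr (\<lambda>n x. Q' n x \<or> \<not> nice K C R' n x)" by (rule A.pr_mono') (use R[OF R'(1)] in blast)
  also have "\<dots> \<le> pr Q' + pr (\<lambda>n x. \<not> nice K C R' n x)" by (rule A.pr_disj_le)
  finally show "pr Q \<le> pr Q' + e" using R'(2) by linarith
qed

lemma pr_False: "pr (\<lambda>n x. False) = 0"
  using A.pr_not[of "\<lambda>n x. True"] A.pr_True by simp

lemma pr_zero_nice: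
  assumes K: "finite K" "K \<subseteq> carrier G"
    and imp: "\<And>C. \<exists>R. \<forall>R'\<ge>R. \<forall>n x. x \<in> VG n \<longrightarrow> nice K C R' n x \<longrightarrow> \<not> Q n x"
  shows "pr Q = 0"
  using pr_le_nice[OF K, of Q "\<lambda>n x. False"] imp pr_False A.pr_nonneg[of Q] by simp

lemma view_tight:
  assumes e: "e > 0" shows "\<exists>C. pr (\<lambda>n x. view n x m > C) \<le> e"
proof -
  obtain i r where m: "m = prod_encode (i, r)" by (metis prod.exhaust prod_decode_inverse)
  show ?thesis
  proof (cases "i \<in> eG ` carrier G")
    case False
    then have "view n x m = 0" for n x by (simp add: view_def config_def m)
    then show ?thesis using pr_False e by (intro exI[of _ 0]) simp
  next
    case True
    then obtain k where k: "k \<in> carrier G" "i = eG k" by blast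
    show ?thesis
    proof (cases r)
      case (Suc s)
      obtain N where "\<And>n x. colour n s x \<le> N" using colour_bounded by blast
      then have "\<not> view n x m > N" for n x
        using col_view[OF k(1), of n x s] by (simp add: col_def m k(2) Suc not_less)
      then show ?thesis using pr_False e by (intro exI[of _ N]) simp
    next
      case 0
      obtain C where C: "\<And>R. \<exists>R'\<ge>R. pr (\<lambda>n x. \<not> nice {k} C R' n x) \<le> e"
        using pr_nice[of "{k}" e] k(1) e by auto
      then obtain R' where R': "R' \<ge> C" "pr (\<lambda>n x. \<not> nice {k} C R' n x) \<le> e" by blast
      let ?M = "Max (eH ` HH.wball C)"
      have "pr (\<lambda>n x. view n x m > ?M) \<le> pr (\<lambda>n x. \<not> nice {k} C R' n x)"
      proof (rule A.pr_mono')
        fix n x assume gt: "view n x m > ?M"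
        show "\<not> nice {k} C R' n x"
        proof
          assume "nice {k} C R' n x"
          then have "dispH n (u n x) (u n (pactG n x k)) \<in> HH.wball C"
            using HH.displacement_wball[OF fin_H] by (simp add: nice_def)
          then have "eH (dispH n (u n x) (u n (pactG n x k))) \<le> ?M"
            using HH.finite_wball by simp
          moreover have "view n x m = eH (dispH n (u n x) (u n (pactG n x k)))"
            using k 0 by (simp add: view_def config_def m inv_into_f_f[OF inj_eG])
          ultimately show False using gt by simp
        qed
      qed
      then show ?thesis using R'(2) order_trans by blast
    qed
  qed
qed

definition law :: "(nat \<Rightarrow> nat) measure" where
  "law = (SOME N. sets N = sets borel \<and> emeasure N UNIV = 1 \<and>
     (\<forall>A. cylinder A \<longrightarrow> emeasure N A = ennreal (pr (\<lambda>n x. view n x \<in> A))))"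

lemma law: "sets law = sets borel \<and> emeasure law UNIV = 1 \<and>
     (\<forall>A. cylinder A \<longrightarrow> emeasure law A = ennreal (pr (\<lambda>n x. view n x \<in> A)))"
  unfolding law_def
proof (rule someI_ex, rule tight_charge_extends)
  show "pr (\<lambda>n x. view n x \<in> UNIV) = 1" using A.pr_True by simp
  show "pr (\<lambda>n x. view n x \<in> A \<union> B) = pr (\<lambda>n x. view n x \<in> A) + pr (\<lambda>n x. view n x \<in> B)"
    if "A \<inter> B = {}" for A B
    using A.pr_disj[of "\<lambda>n x. view n x \<in> A" "\<lambda>n x. view n x \<in> B"] that by auto
  show "\<exists>C. pr (\<lambda>n x. view n x \<in> {w. C < w i}) \<le> e" if "e > 0" for i e
    using view_tight[OF that] by simp
qed (rule A.pr_nonneg)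

lemma sets_law: "sets law = sets borel" and space_law: "space law = UNIV"
  using law sets_eq_imp_space_eq[of law borel] by auto

lemma AE_law:
  assumes fd: "cylinder {w. P w}" and null: "pr (\<lambda>n x. \<not> P (view n x)) = 0"
  shows "AE w in law. P w"
proof -
  have fd': "cylinder {w. \<not> P w}"
    using cylinder_compl[OF fd] by (simp add: Collect_neg_eq)
  then have "emeasure law {w. \<not> P w} = 0" using law null by simp
  then show ?thesis
    using borel_cylinder[OF fd'] by (intro AE_I[of _ _ "{w. \<not> P w}"]) (auto simp: sets_law)
qed

text \<open>The only condition that can fail at a vertex is the one on colours. At a nice vertex the
  vertices \<open>x \<cdot> k\<close> and \<open>x \<cdot> (k \<cdot> v)\<close> are distinct and joined by a walk of length at most \<open>r\<close>.\<close>

lemma AE_law_Omega: "AE w in law. w \<in> Omega"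
proof -
  have ev: "AE w in law. P (w m)" if "\<And>n x. P (view n x m)" for P m
    using that pr_False by (intro AE_law cylinder_Collect[of "{m}"]) auto
  have 1: "AE w in law. \<forall>r. \<forall>i\<in>- eG ` carrier G. w (prod_encode (i, r)) = 0"
    unfolding AE_all_countable
  proof (intro allI AE_ball_countable[THEN iffD2] ballI)
    fix r i assume "i \<in> - eG ` carrier G"
    then show "AE w in law. w (prod_encode (i, r)) = 0"
      by (intro ev) (simp add: view_def config_def)
  qed simp
  have 2: "AE w in law. \<forall>k\<in>carrier G. w (prod_encode (eG k, 0)) \<in> eH ` carrier H"
  proof (intro AE_ball_countable[THEN iffD2] ballI GG.countable_carrier)
    fix k assume "k \<in> carrier G"
    then show "AE w in law. w (prod_encode (eG k, 0)) \<in> eH ` carrier H"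
      by (intro ev) (simp add: view_def config_def dispH_closed inv_into_f_f[OF inj_eG])
  qed
  have 3: "AE w in law. \<forall>r. \<forall>k\<in>carrier G. \<forall>v\<in>carrier G.
      v \<in> GG.wball r \<longrightarrow> v \<noteq> \<one>\<^sub>G \<longrightarrow> col w k r \<noteq> col w (k \<cdot> v) r"
    unfolding AE_all_countable
  proof (intro allI AE_ball_countable[THEN iffD2] ballI GG.countable_carrier)
    fix r k v assume k: "k \<in> carrier G" and v: "v \<in> carrier G"
    show "AE w in law. v \<in> GG.wball r \<longrightarrow> v \<noteq> \<one>\<^sub>G \<longrightarrow> col w k r \<noteq> col w (k \<cdot> v) r"
    proof (rule AE_law)
      show "pr (\<lambda>n x. \<not> (v \<in> GG.wball r \<longrightarrow> v \<noteq> \<one>\<^sub>G \<longrightarrow>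
          col (view n x) k r \<noteq> col (view n x) (k \<cdot> v) r)) = 0"
      proof (rule pr_zero_nice[of "{}"])
        let ?R = "GG.len k + GG.len v"
        have kv: "k \<cdot> v \<in> carrier G" "GG.len (k \<cdot> v) \<le> ?R"
          using k v GG.len_mult by auto
        have "col (view n x) k r \<noteq> col (view n x) (k \<cdot> v) r"
          if "R' \<ge> ?R" "nice {} C R' n x" and vr: "v \<in> GG.wball r" "v \<noteq> \<one>\<^sub>G" for R' C n x
        proof -
          have c: "cayG n ?R x" using nice_mono[OF that(2,1)] by blast
          have "reach (\<G> n) (GG.len v) (pactG n x k) (pactG n x (k \<cdot> v))"
            by (rule GG.pact_mult(2)[OF fin_G c k v order_refl])
          then have "reach (\<G> n) r (pactG n x k) (pactG n x (k \<cdot> v))"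
            by (rule reach_mono) (use vr(1) in \<open>simp add: GG.wball_def\<close>)
          moreover have "pactG n x k \<noteq> pactG n x (k \<cdot> v)"
          proof
            assume "pactG n x k = pactG n x (k \<cdot> v)"
            then have "k = k \<cdot> v"
              using GG.displacement_pact[OF fin_G c k le_add1] GG.displacement_pact[OF fin_G c kv] by metis
            then show False using vr(2) k v GG.r_cancel_one'[of k v] by simp
          qed
          moreover have "pactG n x k \<in> VG n" "pactG n x (k \<cdot> v) \<in> VG n"
            using pactG_VG[OF c k] pactG_VG[OF c kv] by auto
          ultimately show "col (view n x) k r \<noteq> col (view n x) (k \<cdot> v) r"
            using colour_separated k kv(1) by (simp add: col_view)
        qed
        then show "\<exists>R. \<forall>R'\<ge>R. \<forall>n x. x \<in> VG n \<longrightarrow> nice {} C R' n x \<longrightarrow>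
          \<not> \<not> (v \<in> GG.wball r \<longrightarrow> v \<noteq> \<one>\<^sub>G \<longrightarrow> col (view n x) k r \<noteq> col (view n x) (k \<cdot> v) r)" for C
          by blast
      qed auto
      show "cylinder {w. v \<in> GG.wball r \<longrightarrow> v \<noteq> \<one>\<^sub>G \<longrightarrow> col w k r \<noteq> col w (k \<cdot> v) r}"
        by (rule cylinder_config[of "{k, k \<cdot> v}" r]) simp_all
    qed
  qed
  show ?thesis
    using 1 2 3
  proof eventually_elim
    case (elim w)
    then show ?case using GG.wball_closed unfolding Omega_def separated_def by blast
  qed
qed

definition nu :: "(nat \<Rightarrow> nat) measure" where "nu = restrict_space law Omega"

lemma sets_nu: "sets nu = sets BOmega"
  unfolding nu_def BOmega_def by (intro sets_restrict_space_cong sets_law)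

lemma space_nu: "space nu = Omega" by (simp add: nu_def space_restrict_space space_law)

lemma AE_nu_iff: "(AE w in nu. P w) \<longleftrightarrow> (AE w in law. P w)"
proof -
  have "(AE w in nu. P w) \<longleftrightarrow> (AE w in law. w \<in> Omega \<longrightarrow> P w)"
    unfolding nu_def by (rule AE_restrict_space_iff) (simp add: space_law sets_law Omega_borel)
  also have "\<dots> \<longleftrightarrow> (AE w in law. P w)"
    using AE_law_Omega by (auto elim: eventually_elim2)
  finally show ?thesis .
qed

lemma AE_nu:
  "cylinder {w. P w} \<Longrightarrow> pr (\<lambda>n x. \<not> P (view n x)) = 0 \<Longrightarrow> AE w in nu. P w"
  unfolding AE_nu_iff by (rule AE_law)

lemma emeasure_nu_cylinder:
  assumes fd: "cylinder {w. P w}"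
  shows "emeasure nu {w \<in> Omega. P w} = ennreal (pr (\<lambda>n x. P (view n x)))"
proof -
  have P: "{w. P w} \<in> sets law" using borel_cylinder[OF fd] by (simp add: sets_law)
  have "emeasure nu {w \<in> Omega. P w} = emeasure law {w \<in> Omega. P w}"
    unfolding nu_def by (rule emeasure_restrict_space) (auto simp: space_law sets_law Omega_borel)
  also have "\<dots> = emeasure law {w. P w}"
  proof (rule emeasure_eq_AE)
    have "{w \<in> Omega. P w} = Omega \<inter> {w. P w}" by blast
    then show "{w \<in> Omega. P w} \<in> sets law" using P Omega_borel by (simp add: sets_law)
  qed (use AE_law_Omega P in \<open>auto elim: eventually_mono\<close>)
  also have "\<dots> = ennreal (pr (\<lambda>n x. P (view n x)))" using law fd by simp
  finally show ?thesis .
qed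

text \<open>On vertices that see a large ball of the Cayley graph, \<open>x \<mapsto> x \<cdot> g\<close> is injective, since
  acting by the inverse of \<open>g\<close> undoes it.\<close>

lemma pr_pact_le:
  assumes g: "g \<in> carrier G" shows "pr (\<lambda>n x. Q n (pactG n x g)) \<le> pr Q"
proof -
  let ?R = "GG.len g + GG.len (inv\<^sub>G g)"
  let ?Q = "\<lambda>n x. Q n (pactG n x g) \<and> cayG n ?R x"
  have "pr ?Q \<le> pr Q"
  proof (rule tendsto_le[OF A.U_nontrivial A.pr_tendsto A.pr_tendsto], rule always_eventually, rule allI)
    fix n
    have "inj_on (\<lambda>x. pactG n x g) {x \<in> VG n. ?Q n x}"
    proof (rule inj_on_inverseI)
      fix x assume "x \<in> {x \<in> VG n. ?Q n x}"
      then have "cayG n ?R x" by blast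
      then show "pactG n (pactG n x g) (inv\<^sub>G g) = x"
        using GG.pact_mult(1)[OF fin_G, of n ?R x g "inv\<^sub>G g"] g by simp
    qed
    moreover have "(\<lambda>x. pactG n x g) ` {x \<in> VG n. ?Q n x} \<subseteq> {x \<in> VG n. Q n x}"
      using pactG_VG[OF _ g, of n ?R] by auto
    ultimately have "card {x \<in> VG n. ?Q n x} \<le> card {x \<in> VG n. Q n x}"
      using finite_VG by (intro card_inj_on_le) auto
    then show "real (card {x \<in> VG n. ?Q n x}) / real (card (VG n)) \<le> real (card {x \<in> VG n. Q n x}) / real (card (VG n))"
      by (simp add: divide_right_mono)
  qed
  moreover have "pr (\<lambda>n x. Q n (pactG n x g)) \<le> pr (\<lambda>n x. ?Q n x \<or> \<not> cayG n ?R x)"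
    by (rule A.pr_mono') blast
  moreover have "\<dots> \<le> pr ?Q + pr (\<lambda>n x. \<not> cayG n ?R x)" by (rule A.pr_disj_le)
  ultimately show ?thesis using pr_cayG[of ?R] by linarith
qed

text \<open>On \<open>Omega\<close> this is \<open>shift g\<close>. The formula makes sense for every sequence and shows which
  finitely many values and colours each coordinate of the result depends on, so that preimages of
  cylinders are cylinders.\<close>

definition shifted :: "'g \<Rightarrow> (nat \<Rightarrow> nat) \<Rightarrow> nat \<Rightarrow> nat" where
  "shifted g w = config (\<lambda>k. inv\<^sub>H (loc w (inv\<^sub>G g)) \<star> loc w (inv\<^sub>G g \<cdot> k))
     (\<lambda>k. col w (inv\<^sub>G g \<cdot> k))"

lemma shifted_eq:
  assumes g: "g \<in> carrier G" and w: "w \<in> Omega"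
  shows "shift g w = shifted g w"
proof -
  have l: "loc (actG g w) \<one>\<^sub>G = loc w (inv\<^sub>G g)" using g w by (simp add: loc_actG)
  have "shift g w m = shifted g w m" for m
  proof (cases "fst (prod_decode m) \<in> eG ` carrier G")
    case True
    then obtain k where "k \<in> carrier G" "fst (prod_decode m) = eG k" by blast
    then show ?thesis
      unfolding shift_def actH_def shifted_def l config_def using g w
      by (simp add: case_prod_unfold inv_into_f_f[OF inj_eG] loc_actG col_actG split: nat.split)
  qed (simp add: shift_def actH_def shifted_def config_def case_prod_unfold)
  then show ?thesis by blast
qed

text \<open>By the cocycle identity for displacements, the view from \<open>x \<cdot> inv g\<close> agrees with the shift of the
  view from \<open>x\<close> in any given finite set of coordinates.\<close>

lemma shifted_view:
  assumes g: "g \<in> carrier G" and J: "finite J"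
  shows "pr (\<lambda>n x. \<exists>m\<in>J. view n (pactG n x (inv\<^sub>G g)) m \<noteq> shifted g (view n x) m) = 0"
proof -
  let ?g = "inv\<^sub>G g"
  let ?keys = "{k \<in> carrier G. eG k \<in> fst ` prod_decode ` J}"
  let ?K = "insert ?g ((\<lambda>k. ?g \<cdot> k) ` ?keys)"
  have K0: "finite ?keys" "?keys \<subseteq> carrier G" 
    using J inj_on_subset[OF inj_eG] by (auto intro: inj_on_finite[of eG _ "fst ` prod_decode ` J"])
  show ?thesis
  proof (rule pr_zero_nice[of ?K])
    show "finite ?K" "?K \<subseteq> carrier G" using K0 g by auto
    fix C
    let ?S = "\<Sum>k\<in>?keys. GG.len k"
    have "view n (pactG n x ?g) m = shifted g (view n x) m"
      if R': "R' \<ge> 3 * C + GG.len ?g + ?S" and x: "nice ?K C R' n x" and m: "m \<in> J" for R' n x m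
    proof (cases "fst (prod_decode m) \<in> eG ` carrier G")
      case False
      then show ?thesis by (simp add: view_def shifted_def config_def case_prod_unfold)
    next
      case True
      then obtain k where k: "k \<in> carrier G" "fst (prod_decode m) = eG k" by blast
      have kK: "k \<in> ?keys"
        using k m by (force simp: k(2)[symmetric])
      have "GG.len k \<le> ?S" using kK K0(1) by (intro member_le_sum) auto
      then have len: "GG.len ?g + GG.len k \<le> R'" using R' by simp
      have c: "cayG n R' x" "cayH n R' (u n x)" using x by (auto simp: nice_def)
      have gk: "?g \<cdot> k \<in> carrier G" "?g \<in> carrier G" using g k by auto
      have p: "pactG n (pactG n x ?g) k = pactG n x (?g \<cdot> k)"
        by (rule GG.pact_mult(1)[OF fin_G c(1) gk(2) k(1) len])
      have "reach (\<H> n) C (u n x) (u n (pactG n x ?g))"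
        "reach (\<H> n) C (u n x) (u n (pactG n x (?g \<cdot> k)))"
        using x kK unfolding nice_def by blast+
      then have "dispH n (u n x) (u n (pactG n x (?g \<cdot> k))) = dispH n (u n x) (u n (pactG n x ?g)) \<star>
          dispH n (u n (pactG n x ?g)) (u n (pactG n x (?g \<cdot> k)))"
        using R' by (intro HH.displacement_cocycle[OF fin_H c(2)]) auto
      then have d: "inv\<^sub>H (dispH n (u n x) (u n (pactG n x ?g))) \<star> dispH n (u n x) (u n (pactG n x (?g \<cdot> k)))
          = dispH n (u n (pactG n x ?g)) (u n (pactG n x (?g \<cdot> k)))"
        using dispH_closed by (simp add: HH.m_assoc[symmetric])
      show ?thesis
        using k gk unfolding view_def[of n "pactG n x ?g"] shifted_def config_def
        by (simp add: case_prod_unfold inv_into_f_f[OF inj_eG] loc_view col_view p d split: nat.split)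
    qed
    then show "\<exists>R. \<forall>R'\<ge>R. \<forall>n x. x \<in> VG n \<longrightarrow> nice ?K C R' n x \<longrightarrow>
      \<not> (\<exists>m\<in>J. view n (pactG n x ?g) m \<noteq> shifted g (view n x) m)" by blast
  qed
qed

text \<open>The preceding lemmas give one inequality. Applying it to the complement gives the other;
  this takes the place of surjectivity of \<open>x \<mapsto> x \<cdot> g\<close>.\<close>

lemma pr_shifted:
  assumes g: "g \<in> carrier G" and fd: "cylinder {w. P w}"
  shows "pr (\<lambda>n x. P (shifted g (view n x))) = pr (\<lambda>n x. P (view n x))"
proof -
  let ?g = "inv\<^sub>G g"
  have le: "pr (\<lambda>n x. P (shifted g (view n x))) \<le> pr (\<lambda>n x. P (view n x))"
    if fd: "cylinder {w. P w}" for P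
  proof -
    obtain J where J: "finite J" "\<And>w w'. (\<forall>i\<in>J. w i = w' i) \<Longrightarrow> P w \<Longrightarrow> P w'"
      using fd unfolding cylinder_def by auto
    let ?bad = "\<lambda>n x. \<exists>m\<in>J. view n (pactG n x ?g) m \<noteq> shifted g (view n x) m"
    have "pr (\<lambda>n x. P (shifted g (view n x))) \<le> pr (\<lambda>n x. P (view n (pactG n x ?g)) \<or> ?bad n x)"
    proof (rule A.pr_mono')
      fix n x assume P: "P (shifted g (view n x))"
      show "P (view n (pactG n x ?g)) \<or> ?bad n x"
        using J(2)[OF _ P, of "view n (pactG n x ?g)"] by auto
    qed
    also have "\<dots> \<le> pr (\<lambda>n x. P (view n (pactG n x ?g))) + pr ?bad" by (rule A.pr_disj_le)
    also have "\<dots> \<le> pr (\<lambda>n x. P (view n x))"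
      using shifted_view[OF g J(1)] pr_pact_le[of ?g "\<lambda>n x. P (view n x)"] g by simp
    finally show ?thesis .
  qed
  have "cylinder {w. \<not> P w}"
    using cylinder_compl[OF fd] by (simp add: Collect_neg_eq)
  from le[OF this] have "pr (\<lambda>n x. P (view n x)) \<le> pr (\<lambda>n x. P (shifted g (view n x)))"
    using A.pr_not[of "\<lambda>n x. P (view n x)"] A.pr_not[of "\<lambda>n x. P (shifted g (view n x))"] by simp
  with le[OF fd] show ?thesis by (rule antisym)
qed

lemma cylinder_shifted:
  assumes fd: "cylinder {w. P w}" shows "cylinder {w. P (shifted g w)}"
proof -
  obtain J where J: "finite J" "\<And>w w'. (\<forall>i\<in>J. w i = w' i) \<Longrightarrow> P w \<Longrightarrow> P w'"
    using fd unfolding cylinder_def by auto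
  let ?key = "\<lambda>m. inv_into (carrier G) eG (fst (prod_decode m))"
  let ?K = "insert (inv\<^sub>G g) ((\<lambda>m. inv\<^sub>G g \<cdot> ?key m) ` J)"
  let ?R = "\<Sum>m\<in>J. snd (prod_decode m)"
  show ?thesis
  proof (rule cylinder_config[of ?K ?R])
    fix w w' :: "nat \<Rightarrow> nat"
    assume l: "\<And>k. k \<in> ?K \<Longrightarrow> loc w k = loc w' k"
      and c: "\<And>k r. k \<in> ?K \<Longrightarrow> r \<le> ?R \<Longrightarrow> col w k r = col w' k r"
    have "shifted g w m = shifted g w' m" if m: "m \<in> J" for m
    proof -
      have "snd (prod_decode m) \<le> ?R" using m J(1) by (intro member_le_sum) auto
      moreover have "inv\<^sub>G g \<cdot> ?key m \<in> ?K" using m by blast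
      ultimately show ?thesis
        using l[of "inv\<^sub>G g"] l[of "inv\<^sub>G g \<cdot> ?key m"] c[of "inv\<^sub>G g \<cdot> ?key m"]
        unfolding shifted_def config_def case_prod_unfold by (auto split: nat.split)
    qed
    then show "P (shifted g w) = P (shifted g w')"
      using J(2)[of "shifted g w" "shifted g w'"] J(2)[of "shifted g w'" "shifted g w"] by auto
  qed (use J in auto)
qed

lemma emeasure_nu_Omega: "emeasure nu Omega = 1"
  using emeasure_nu_cylinder[of "\<lambda>w. True"] A.pr_True by (simp add: cylinder_UNIV)

lemma shift_invariant:
  assumes g: "g \<in> carrier G"
  shows "distr nu BOmega (shift g) = nu"
    (is "distr nu BOmega ?T = nu")
proof -
  let ?E = "{{w \<in> Omega. P w} |P. cylinder {w :: nat \<Rightarrow> nat. P w}}"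
  have T: "?T \<in> nu \<rightarrow>\<^sub>M BOmega"
    using measurable_shift[OF g] measurable_cong_sets[OF sets_nu refl] by blast
  have gen: "sets BOmega = sigma_sets Omega ?E"
  proof -
    have "sets BOmega = (\<inter>) Omega ` sigma_sets UNIV {A :: (nat \<Rightarrow> nat) set. cylinder A}"
      by (simp add: BOmega_def sets_restrict_space sigma_sets_cylinder)
    also have "\<dots> = sigma_sets Omega ((\<inter>) Omega ` {A. cylinder A})"
      by (rule restricted_sigma) (auto simp: sigma_sets_cylinder Omega_borel)
    also have "(\<inter>) Omega ` {A. cylinder A} = ?E"
    proof (intro equalityI subsetI)
      fix B assume "B \<in> (\<inter>) Omega ` {A. cylinder A}"
      then obtain A where "B = Omega \<inter> A" "cylinder A" by blast
      then have "B = {w \<in> Omega. w \<in> A} \<and> cylinder {w. w \<in> A}" by auto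
      then show "B \<in> ?E" by (intro CollectI exI[of _ "\<lambda>w. w \<in> A"])
    next
      fix B assume "B \<in> ?E"
      then obtain P where "B = Omega \<inter> {w. P w}" "cylinder {w. P w}" by blast
      then show "B \<in> (\<inter>) Omega ` {A. cylinder A}" by blast
    qed
    finally show ?thesis .
  qed
  show ?thesis
  proof (rule measure_eqI_generator_eq[where E = ?E and \<Omega> = Omega and A = "\<lambda>_. Omega"])
    show "Int_stable ?E"
    proof (rule Int_stableI)
      fix A B assume "A \<in> ?E" "B \<in> ?E"
      then obtain P Q where PQ: "A = {w \<in> Omega. P w}" "cylinder {w. P w}"
        "B = {w \<in> Omega. Q w}" "cylinder {w. Q w}" by blast
      have "cylinder {w. P w \<and> Q w}"
        using cylinder_compl[OF cylinder_Un[OF cylinder_compl[OF PQ(2)]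
              cylinder_compl[OF PQ(4)]]]
        by (simp add: Collect_conj_eq)
      moreover have "A \<inter> B = {w \<in> Omega. P w \<and> Q w}" unfolding PQ by blast
      ultimately show "A \<inter> B \<in> ?E" by (intro CollectI exI[of _ "\<lambda>w. P w \<and> Q w"] conjI)
    qed
    fix A assume "A \<in> ?E"
    then obtain P where P: "A = {w \<in> Omega. P w}" "cylinder {w. P w}" by blast
    have "emeasure (distr nu BOmega ?T) A = emeasure nu (?T -` A \<inter> space nu)"
      using sets_BOmega_cylinder[OF P(2)] P(1) by (intro emeasure_distr[OF T]) simp
    also have "?T -` A \<inter> space nu = {w \<in> Omega. P (shifted g w)}"
    proof -
      have "shift g w \<in> Omega" if "w \<in> Omega" for w
        using measurable_space[OF measurable_shift[OF g], of w] that by simp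
      then have "(shift g w \<in> Omega \<and> P (shift g w)) = P (shifted g w)" if "w \<in> Omega" for w
        using shifted_eq[OF g that] that by metis
      then show ?thesis unfolding P(1) space_nu by blast
    qed
    also have "emeasure nu \<dots> = emeasure nu A"
      unfolding P(1) emeasure_nu_cylinder[OF P(2)]
        emeasure_nu_cylinder[OF cylinder_shifted[OF P(2)]] pr_shifted[OF g P(2)] ..
    finally show "emeasure (distr nu BOmega ?T) A = emeasure nu A" .
  next
    have "Omega \<in> ?E"
      by (intro CollectI exI[of _ "\<lambda>w. True"]) (simp add: cylinder_UNIV)
    then show "range (\<lambda>_. Omega) \<subseteq> ?E" by (intro image_subsetI)
    have "emeasure (distr nu BOmega ?T) Omega \<le> 1"
      using emeasure_space[of "distr nu BOmega ?T" Omega] emeasure_distr[OF T, of "space BOmega"]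
        emeasure_space[of nu "?T -` Omega \<inter> space nu"] emeasure_nu_Omega
        sets.top[of BOmega] by (simp add: space_nu)
    then show "emeasure (distr nu BOmega ?T) Omega \<noteq> \<infinity>" by (auto simp: top_unique)
    show "?E \<subseteq> Pow Omega" by blast
  qed (simp_all add: gen sets_nu)
qed

end

section \<open>The coupling and its properties\<close>

context sofic_coarse_equivalence
begin

lemma AE_nu_XH: "AE w in nu. w \<in> XH"
proof -
  have "AE w in nu. loc w \<one>\<^sub>G = \<one>\<^sub>H"
    using pr_False by (intro AE_nu cylinder_loc) (simp add: loc_view)
  then show ?thesis using AE_space[of nu] by eventually_elim (simp add: XH_def space_nu)
qed

sublocale coupling_law G SG H SH nu
  by unfold_locales (rule sets_nu emeasure_nu_Omega AE_nu_XH shift_invariant; assumption?)+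

text \<open>The exceptional vertices of the expansiveness condition: some \<open>y\<close> far away from \<open>x\<close> is sent
  near the image of \<open>x\<close>.\<close>

abbreviation "torn n R r x \<equiv> \<exists>y\<in>VG n. reach (\<H> n) r (u n x) (u n y) \<and> \<not> reach (\<G> n) R x y"

lemma emeasure_nu_le:
  "cylinder {w. P w} \<Longrightarrow> pr (\<lambda>n x. P (view n x)) \<le> e \<Longrightarrow> emeasure nu {w \<in> Omega. P w} \<le> ennreal e"
  by (simp add: emeasure_nu_cylinder ennreal_leI)

lemma nu_null_if_small:
  assumes "\<And>e :: real. e > 0 \<Longrightarrow> \<exists>B. N \<subseteq> B \<and> B \<in> sets nu \<and> emeasure nu B \<le> ennreal e"
  shows "AE w in nu. w \<notin> N"
proof -
  have "\<forall>i. \<exists>B. N \<subseteq> B \<and> B \<in> sets nu \<and> emeasure nu B \<le> ennreal (inverse (real (Suc i)))"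
    by (intro allI assms) simp
  then obtain B where B: "\<And>i. N \<subseteq> B i" "\<And>i. B i \<in> sets nu" "\<And>i. emeasure nu (B i) \<le> ennreal (inverse (real (Suc i)))"
    unfolding choice_iff by blast
  have "emeasure nu (\<Inter>i. B i) \<le> ennreal (inverse (real (Suc i)))" for i
    using B(2) by (intro order_trans[OF emeasure_mono B(3)]) auto
  then have "emeasure nu (\<Inter>i. B i) \<le> 0"
    using tendsto_lowerbound[OF tendsto_ennrealI[OF LIMSEQ_inverse_real_of_nat], of "emeasure nu (\<Inter>i. B i)"]
    by simp
  then have "emeasure nu (\<Inter>i. B i) = 0" by simp
  then show ?thesis using B(1,2) by (intro AE_I[of _ _ "\<Inter>i. B i"]) auto
qed

text \<open>If an element \<open>k\<close> far from the unit has the value \<open>h\<close>, then \<open>x \<cdot> k\<close> is far from \<open>x\<close>, but its image is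
  at distance at most \<open>len h\<close> from the image of \<open>x\<close>.\<close>

lemma torn_if_far:
  assumes K: "R \<le> R'" "HH.len h + C \<le> R'" and nice: "nice K C R' n x"
    and k: "k \<in> K" "k \<in> carrier G" "k \<notin> GG.wball R" and h: "h \<in> carrier H" "loc (view n x) k = h"
  shows "torn n R (HH.len h) x"
proof -
  have c: "cayG n R' x" "cayH n R' (u n x)" and kl: "GG.len k \<le> R'"
    and r: "reach (\<H> n) C (u n x) (u n (pactG n x k))"
    using nice k(1) by (auto simp: nice_def)
  have "pactH n (u n x) h = u n (pactG n x k)"
    using HH.pact_displacement(1)[OF fin_H c(2) r] K(2) h(2) k(2) by (simp add: loc_view)
  then have "reach (\<H> n) (HH.len h) (u n x) (u n (pactG n x k))"
    using HH.reach_pact[OF fin_H c(2) h(1)] K(2) by simp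
  moreover have "\<not> reach (\<G> n) R x (pactG n x k)"
    using GG.pact_displacement(2)[OF fin_G c(1) _ K(1)] GG.displacement_pact[OF fin_G c(1) k(2) kl] k(3)
    by metis
  moreover have "pactG n x k \<in> VG n" by (rule pactG_VG[OF c(1) k(2) kl])
  ultimately show ?thesis by blast
qed

lemma pr_far_le:
  assumes h: "h \<in> carrier H" and K: "finite K" "K \<subseteq> carrier G"
  shows "pr (\<lambda>n x. \<exists>k\<in>K. k \<notin> GG.wball R \<and> loc (view n x) k = h) \<le> pr (\<lambda>n x. torn n R (HH.len h) x)"
proof (rule pr_le_nice[OF K])
  fix C
  show "\<exists>S. \<forall>R'\<ge>S. \<forall>n x. x \<in> VG n \<longrightarrow> nice K C R' n x \<longrightarrow>
      (\<exists>k\<in>K. k \<notin> GG.wball R \<and> loc (view n x) k = h) \<longrightarrow> torn n R (HH.len h) x"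
  proof (intro exI[of _ "R + (HH.len h + C)"] allI impI)
    fix R' n x assume R': "R + (HH.len h + C) \<le> R'" and "nice K C R' n x"
      and "\<exists>k\<in>K. k \<notin> GG.wball R \<and> loc (view n x) k = h"
    then show "torn n R (HH.len h) x"
      using torn_if_far[of R R' h C K n x] K(2) h by auto
  qed
qed

text \<open>By expansiveness, for large \<open>R\<close> the event that the fibre over \<open>h\<close> is not contained in the
  ball of radius \<open>R\<close> has small measure. It is not a cylinder, but an increasing union of cylinders that
  are all bounded by the same probability.\<close>

lemma AE_nu_finite_fibre:
  assumes h: "h \<in> carrier H" shows "AE w in nu. \<exists>R. \<forall>k\<in>carrier G. k \<notin> GG.wball R \<longrightarrow> loc w k \<noteq> h"
proof -
  let ?far = "\<lambda>R w k. k \<notin> GG.wball R \<and> loc w k = h"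
  have fd: "cylinder {w. \<exists>k\<in>GG.wball j. ?far R w k}" for j R
    by (rule cylinder_config[of "GG.wball j" 0]) (simp_all add: GG.finite_wball)
  let ?A = "\<lambda>R j. {w \<in> Omega. \<exists>k\<in>GG.wball j. ?far R w k}"
  have A: "?A R j \<in> sets nu" for R j
    using sets_BOmega_cylinder[OF fd] by (simp add: sets_nu)
  have "AE w in nu. w \<notin> {w \<in> Omega. \<forall>R. \<exists>k\<in>carrier G. ?far R w k}"
  proof (rule nu_null_if_small)
    fix e :: real assume "e > 0"
    then obtain R where R: "pr (\<lambda>n x. torn n R (HH.len h) x) < e" using expansive[of e "HH.len h"] by blast
    have "emeasure nu (?A R j) \<le> ennreal e" for j
      using R pr_far_le[OF h, of "GG.wball j" R] GG.finite_wball GG.wball_closed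
      by (intro emeasure_nu_le fd) force
    moreover have "incseq (?A R)" by (force simp: incseq_def GG.wball_def)
    ultimately have "emeasure nu (\<Union>j. ?A R j) \<le> ennreal e"
      using SUP_emeasure_incseq[of "?A R" nu] A by (subst SUP_emeasure_incseq[symmetric]) (auto intro: SUP_least)
    moreover have "{w \<in> Omega. \<forall>R. \<exists>k\<in>carrier G. ?far R w k} \<subseteq> (\<Union>j. ?A R j)"
    proof
      fix w assume w: "w \<in> {w \<in> Omega. \<forall>R. \<exists>k\<in>carrier G. ?far R w k}"
      then obtain k where k: "k \<in> carrier G" "?far R w k" by blast
      then have "k \<in> GG.wball (GG.len k)" by (simp add: GG.wball_def)
      then show "w \<in> (\<Union>j. ?A R j)" using w k(2) by blast
    qed
    moreover have "(\<Union>j. ?A R j) \<in> sets nu" using A by auto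
    ultimately show "\<exists>B. {w \<in> Omega. \<forall>R. \<exists>k\<in>carrier G. ?far R w k} \<subseteq> B \<and> B \<in> sets nu \<and> emeasure nu B \<le> ennreal e"
      by blast
  qed
  then show ?thesis using AE_space[of nu] by eventually_elim (auto simp: space_nu)
qed

lemma pred_finite_fibre:
  "Measurable.pred BOmega (\<lambda>w. \<exists>R. \<forall>k\<in>carrier G. k \<notin> GG.wball R \<longrightarrow> loc w k \<noteq> h)"
  by (intro pred_intros_countable(2) pred_Ball_countable[OF GG.countable_carrier] pred_BOmega
      cylinder_config[of "{_}" 0]) auto

lemma AE_mu_finite_fibres: "AE w in \<mu>. finite_fibres w"
proof -
  let ?P = "\<lambda>w. \<forall>h\<in>carrier H. \<exists>R. \<forall>k\<in>carrier G. k \<notin> GG.wball R \<longrightarrow> loc w k \<noteq> h"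
  have "AE w in \<mu>. ?P w"
  proof (rule AE_muI)
    have "Measurable.pred BOmega ?P"
      by (intro pred_Ball_countable[OF HH.countable_carrier] pred_finite_fibre)
    then show "{w \<in> Omega. ?P w} \<in> sets BOmega" by (simp add: pred_def)
    show "AE w in nu. ?P w"
      using AE_nu_finite_fibre by (simp add: AE_ball_countable HH.countable_carrier)
    fix h w assume h: "h \<in> carrier H" and w: "w \<in> Omega" and P: "?P w"
    show "?P (actH h w)"
    proof
      fix h' assume h': "h' \<in> carrier H"
      then obtain R where R: "\<forall>k\<in>carrier G. k \<notin> GG.wball R \<longrightarrow> loc w k \<noteq> inv\<^sub>H h \<star> h'"
        using P h by blast
      have "loc (actH h w) k \<noteq> h'" if "k \<in> carrier G" "k \<notin> GG.wball R" for k
        using R that h h' w loc_closed[OF w that(1)] by (auto simp: loc_actH HH.m_assoc[symmetric])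
      then show "\<exists>R. \<forall>k\<in>carrier G. k \<notin> GG.wball R \<longrightarrow> loc (actH h w) k \<noteq> h'" by blast
    qed
  qed
  then show ?thesis
  proof eventually_elim
    case (elim w)
    show ?case unfolding finite_fibres_def
    proof
      fix h assume "h \<in> carrier H"
      then obtain R where "\<forall>k\<in>carrier G. k \<notin> GG.wball R \<longrightarrow> loc w k \<noteq> h" using elim by blast
      then have "{k \<in> carrier G. loc w k = h} \<subseteq> GG.wball R" by blast
      then show "finite {k \<in> carrier G. loc w k = h}" using GG.finite_wball finite_subset by blast
    qed
  qed
qed

text \<open>For \<open>w\<close> in \<open>XH\<close>, a consequence of \<open>actH h w \<in> XG\<close> that can be checked in the ball of radius \<open>R\<close> and on
  the colours for distances up to \<open>R\<close>, and hence at vertices of the finite graphs.\<close>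

definition locally_leading :: "nat \<Rightarrow> 'h \<Rightarrow> (nat \<Rightarrow> nat) \<Rightarrow> bool" where
  "locally_leading R h w \<longleftrightarrow> (\<forall>k\<in>GG.wball R. eH h \<le> eH (h \<star> loc w k)) \<and>
     (\<forall>k\<in>GG.wball R. k \<noteq> \<one>\<^sub>G \<longrightarrow> loc w k = \<one>\<^sub>H \<longrightarrow>
        (\<exists>t\<le>R. col w \<one>\<^sub>G t < col w k t \<and> (\<forall>s<t. col w \<one>\<^sub>G s = col w k s)))"

lemma cylinder_locally_leading: "cylinder {w. locally_leading R h w}"
proof (rule cylinder_config[of "insert \<one>\<^sub>G (GG.wball R)" R])
  fix w w' :: "nat \<Rightarrow> nat"
  assume l: "\<And>k. k \<in> insert \<one>\<^sub>G (GG.wball R) \<Longrightarrow> loc w k = loc w' k"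
    and c: "\<And>k r. k \<in> insert \<one>\<^sub>G (GG.wball R) \<Longrightarrow> r \<le> R \<Longrightarrow> col w k r = col w' k r"
  have "(\<exists>t\<le>R. col w \<one>\<^sub>G t < col w k t \<and> (\<forall>s<t. col w \<one>\<^sub>G s = col w k s))
    \<longleftrightarrow> (\<exists>t\<le>R. col w' \<one>\<^sub>G t < col w' k t \<and> (\<forall>s<t. col w' \<one>\<^sub>G s = col w' k s))" if "k \<in> GG.wball R" for k
    using c[of k] c[of "\<one>\<^sub>G"] that by (intro ex_cong1 conj_cong refl) auto
  then show "locally_leading R h w = locally_leading R h w'"
    unfolding locally_leading_def using l by (intro arg_cong2[of _ _ _ _ "(\<and>)"] ball_cong imp_cong refl) auto
qed (simp add: GG.finite_wball)

lemma locally_leading_if_XG: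
  assumes w: "w \<in> XH" and h: "h \<in> carrier H" and lead: "actH h w \<in> XG"
  shows "locally_leading R h w"
proof -
  have w': "w \<in> Omega" "loc w \<one>\<^sub>G = \<one>\<^sub>H" using w by (auto simp: XH_def)
  have lead': "leading (actH h w) \<one>\<^sub>G" using lead by (simp add: XG_def)
  have "\<exists>t\<le>R. col w \<one>\<^sub>G t < col w k t \<and> (\<forall>s<t. col w \<one>\<^sub>G s = col w k s)"
    if k: "k \<in> GG.wball R" "k \<noteq> \<one>\<^sub>G" "loc w k = \<one>\<^sub>H" for k
  proof -
    have kc: "k \<in> carrier G" using k GG.wball_closed by blast
    have "lex_less (col w \<one>\<^sub>G) (col w k)"
      using lead' k kc w' h unfolding leading_def by (auto simp: loc_actH col_actH)
    then have n: "\<not> lex_less (col w k) (col w \<one>\<^sub>G)" by (rule lex_less_asym)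
    have "col w \<one>\<^sub>G R \<noteq> col w (\<one>\<^sub>G \<cdot> k) R"
      using separated_col[OF w'(1)] k unfolding separated_def by blast
    then have ne: "col w \<one>\<^sub>G R \<noteq> col w k R" using kc by simp
    show ?thesis
      using lex_less_total[of "col w \<one>\<^sub>G" R "col w k", OF ne] n lex_lessI by blast
  qed
  moreover have "eH h \<le> eH (h \<star> loc w k)" if "k \<in> GG.wball R" for k
    using lead' GG.wball_closed[OF that] w' h unfolding leading_def by (auto simp: loc_actH)
  ultimately show ?thesis unfolding locally_leading_def by blast
qed

lemma sum_pr_le:
  assumes "finite J" "eventually (\<lambda>n. real (\<Sum>h\<in>J. card {x \<in> VG n. Q h n x}) \<le> K * real (card (VG n))) U"
  shows "(\<Sum>h\<in>J. pr (Q h)) \<le> K"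
proof (rule tendsto_upperbound[OF tendsto_sum[OF A.pr_tendsto] _ A.U_nontrivial])
  show "eventually (\<lambda>n. (\<Sum>h\<in>J. real (card {x \<in> VG n. Q h n x}) / real (card (VG n))) \<le> K) U"
    using assms(2) A.nonempty
  proof eventually_elim
    case (elim n)
    then have "real (card (VG n)) > 0" using finite_VG[of n] by (simp add: card_gt_0_iff)
    then show ?case using elim(1) by (simp add: sum_divide_distrib[symmetric] divide_le_eq)
  qed
qed

text \<open>The images of \<open>x\<close> and \<open>x'\<close> are both near \<open>z\<close>, so \<open>x' = x \<cdot> k\<close> for some \<open>k\<close> in the ball of
  radius \<open>R\<close>, and the value of the view at \<open>k\<close> is \<open>inv h \<cdot> h'\<close>. As \<open>x\<close> is leading, \<open>h\<close> does not come
  after \<open>h'\<close>; and if they are equal, then \<open>x'\<close> lies in the fibre of \<open>x\<close> and has larger colours.\<close>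

lemma leading_vertices_distinct:
  assumes h: "h \<in> carrier H" "h' \<in> carrier H"
    and x: "x \<in> VG n" "x' \<in> VG n" and cay: "cayG n R x" "cayG n R x'"
      "cayH n (3 * \<rho>) (u n x)" "cayH n (3 * \<rho>) (u n x')"
    and \<rho>: "2 * HH.len (inv\<^sub>H h) \<le> \<rho>" "2 * HH.len (inv\<^sub>H h') \<le> \<rho>"
    and not_torn: "\<not> torn n R \<rho> x" "\<not> torn n R \<rho> x'"
    and lead: "locally_leading R h (view n x)" "locally_leading R h' (view n x')"
    and eq: "pactH n (u n x) (inv\<^sub>H h) = pactH n (u n x') (inv\<^sub>H h')"
  shows "eH h \<le> eH h' \<and> (h = h' \<longrightarrow> x \<noteq> x' \<longrightarrow>
     (\<exists>t. colour n t x < colour n t x' \<and> (\<forall>s<t. colour n s x = colour n s x')))"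
proof -
  let ?z = "pactH n (u n x) (inv\<^sub>H h)"
  have z: "reach (\<H> n) (HH.len (inv\<^sub>H h)) (u n x) ?z"
    using HH.reach_pact[OF fin_H cay(3), of "inv\<^sub>H h"] h \<rho> by simp
  have z': "reach (\<H> n) (HH.len (inv\<^sub>H h')) (u n x') ?z"
    unfolding eq using HH.reach_pact[OF fin_H cay(4), of "inv\<^sub>H h'"] h \<rho> by simp
  have zz: "reach (\<H> n) \<rho> (u n x) ?z" using reach_mono[OF z] \<rho> by simp
  have r: "reach (\<H> n) \<rho> (u n x) (u n x')"
    using reach_mono[OF reach_trans[OF z reach_sym[OF z']]] \<rho> by simp
  then have rG: "reach (\<G> n) R x x'" using not_torn(1) x(2) by blast
  let ?k = "dispG n x x'"
  have k: "pactG n x ?k = x'" "?k \<in> GG.wball R" "?k \<in> carrier G"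
    using GG.pact_displacement[OF fin_G cay(1) rG order_refl] GG.wball_closed by auto
  have "dispH n (u n x) ?z = dispH n (u n x) (u n x') \<star> dispH n (u n x') ?z"
    by (rule HH.displacement_cocycle[OF fin_H cay(3) r zz order_refl])
  moreover have "dispH n (u n x) ?z = inv\<^sub>H h"
    using HH.displacement_pact[OF fin_H cay(3), of "inv\<^sub>H h"] h \<rho> by simp
  moreover have "dispH n (u n x') ?z = inv\<^sub>H h'"
    unfolding eq using HH.displacement_pact[OF fin_H cay(4), of "inv\<^sub>H h'"] h \<rho> by simp
  ultimately have "inv\<^sub>H h = loc (view n x) ?k \<star> inv\<^sub>H h'"
    using k by (simp add: loc_view)
  then have "inv\<^sub>H h \<star> h' = loc (view n x) ?k"
    using h dispH_closed k(3) by (simp add: loc_view HH.m_assoc)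
  note d0 = this[symmetric]
  have d: "h \<star> loc (view n x) ?k = h'" "h = h' \<Longrightarrow> loc (view n x) ?k = \<one>\<^sub>H"
    unfolding d0 using h by (simp_all add: HH.m_assoc[symmetric])
  have "eH h \<le> eH h'" using lead(1) k(2) d(1) unfolding locally_leading_def by metis
  moreover have "\<exists>t. colour n t x < colour n t x' \<and> (\<forall>s<t. colour n s x = colour n s x')"
    if "h = h'" "x \<noteq> x'"
  proof -
    have "?k \<noteq> \<one>\<^sub>G" using k(1) that(2) by force
    then have "\<exists>t\<le>R. col (view n x) \<one>\<^sub>G t < col (view n x) ?k t \<and>
        (\<forall>s<t. col (view n x) \<one>\<^sub>G s = col (view n x) ?k s)"
      using lead(1) k(2) d(2)[OF that(1)] unfolding locally_leading_def by blast
    then show ?thesis using k by (auto simp: col_view)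
  qed
  ultimately show ?thesis by blast
qed

text \<open>Mass transport: the pair \<open>(h, x)\<close> is sent to the vertex \<open>z\<close> of \<open>\<H> n\<close> from which \<open>h\<close> leads to the
  image of \<open>x\<close>. As seen from \<open>z\<close>, \<open>x\<close> is the leading vertex. Using the previous lemma in both
  directions, this is injective.\<close>

lemma sum_card_leading_le:
  assumes J: "finite J" "J \<subseteq> carrier H" and \<rho>: "\<And>h. h \<in> J \<Longrightarrow> 2 * HH.len (inv\<^sub>H h) \<le> \<rho>"
  shows "(\<Sum>h\<in>J. card {x \<in> VG n. locally_leading R h (view n x) \<and> cayG n R x \<and> cayH n (3 * \<rho>) (u n x) \<and>
     \<not> torn n R \<rho> x}) \<le> card (VH n)"
proof -
  let ?F = "\<lambda>h. {x \<in> VG n. locally_leading R h (view n x) \<and> cayG n R x \<and> cayH n (3 * \<rho>) (u n x) \<and>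
     \<not> torn n R \<rho> x}"
  let ?z = "\<lambda>(h, x). pactH n (u n x) (inv\<^sub>H h)"
  have "(\<Sum>h\<in>J. card (?F h)) = card (Sigma J ?F)"
    using J(1) finite_VG by (intro card_SigmaI[symmetric]) auto
  also have "\<dots> \<le> card (VH n)"
  proof (rule card_inj_on_le[of ?z])
    show "inj_on ?z (Sigma J ?F)"
    proof (rule inj_onI, clarify)
      fix h x h' x'
      assume h: "h \<in> J" "h' \<in> J" and x: "x \<in> VG n" "locally_leading R h (view n x)" "cayG n R x"
          "cayH n (3 * \<rho>) (u n x)" "\<not> torn n R \<rho> x"
        and x': "x' \<in> VG n" "locally_leading R h' (view n x')" "cayG n R x'"
          "cayH n (3 * \<rho>) (u n x')" "\<not> torn n R \<rho> x'"
        and eq: "pactH n (u n x) (inv\<^sub>H h) = pactH n (u n x') (inv\<^sub>H h')"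
      have hc: "h \<in> carrier H" "h' \<in> carrier H" using h J(2) by auto
      note 1 = leading_vertices_distinct[OF hc x(1) x'(1) x(3) x'(3) x(4) x'(4) \<rho>[OF h(1)] \<rho>[OF h(2)] x(5) x'(5) x(2) x'(2) eq]
      note 2 = leading_vertices_distinct[OF hc(2,1) x'(1) x(1) x'(3) x(3) x'(4) x(4) \<rho>[OF h(2)] \<rho>[OF h(1)] x'(5) x(5) x'(2) x(2) eq[symmetric]]
      have "eH h = eH h'" using 1 2 by linarith
      then have hh: "h = h'" using inj_eH hc by (simp add: inj_on_def)
      have "x = x'"
      proof (rule ccontr)
        assume "x \<noteq> x'"
        then have "lex_less (\<lambda>t. colour n t x) (\<lambda>t. colour n t x')" "lex_less (\<lambda>t. colour n t x') (\<lambda>t. colour n t x)"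
          using 1 2 hh unfolding lex_less_def by auto
        then show False using lex_less_asym by blast
      qed
      then show "h = h' \<and> x = x'" using hh by blast
    qed
    show "?z ` Sigma J ?F \<subseteq> VH n"
    proof (rule image_subsetI, clarify)
      fix h x assume h: "h \<in> J" and x: "x \<in> VG n" "cayH n (3 * \<rho>) (u n x)"
      have "reach (\<H> n) (HH.len (inv\<^sub>H h)) (u n x) (pactH n (u n x) (inv\<^sub>H h))"
        using HH.reach_pact[OF fin_H x(2), of "inv\<^sub>H h"] h J(2) \<rho>[OF h] by auto
      then show "pactH n (u n x) (inv\<^sub>H h) \<in> VH n" using reach_lverts[OF fin_H _ u_in[OF x(1)]] by blast
    qed
  qed (rule finite_VH)
  finally show ?thesis .
qed

text \<open>The error made by discarding bad vertices is paid once for each \<open>h\<close> in \<open>J\<close>. Since \<open>J\<close> is fixed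
  before \<open>R\<close>, it can be made arbitrarily small.\<close>

lemma emeasure_mu_XG_finite: "emeasure \<mu> XG < \<infinity>"
proof -
  obtain K where K: "K > 0" "eventually (\<lambda>n. real (card (VH n)) \<le> K * real (card (VG n))) U"
    using card_VH_le by blast
  have "emeasure \<mu> XG \<le> ennreal K"
  proof (rule emeasure_mu_XG_le)
    fix J assume J: "finite J" "J \<subseteq> carrier H"
    let ?\<rho> = "\<Sum>h\<in>J. 2 * HH.len (inv\<^sub>H h)"
    have \<rho>: "2 * HH.len (inv\<^sub>H h) \<le> ?\<rho>" if "h \<in> J" for h
      using that J(1) by (intro member_le_sum[of h J "\<lambda>h. 2 * HH.len (inv\<^sub>H h)"]) auto
    have le: "(\<Sum>h\<in>J. emeasure nu {w \<in> Omega. actH h w \<in> XG}) \<le> ennreal (K + e)" if e: "e > 0" for e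
    proof -
      have e': "e / (real (card J) + 1) > 0" using e by simp
      obtain R where R: "pr (\<lambda>n x. torn n R ?\<rho> x) < e / (real (card J) + 1)"
        using expansive[OF e', of ?\<rho>] by blast
      let ?ok = "\<lambda>n x. cayG n R x \<and> cayH n (3 * ?\<rho>) (u n x) \<and> \<not> torn n R ?\<rho> x"
      have ok: "pr (\<lambda>n x. \<not> ?ok n x) \<le> e / (real (card J) + 1)"
      proof -
        have "pr (\<lambda>n x. \<not> ?ok n x) \<le> pr (\<lambda>n x. \<not> cayG n R x \<or> (\<not> cayH n (3 * ?\<rho>) (u n x) \<or> torn n R ?\<rho> x))"
          by (rule A.pr_mono') blast
        also have "\<dots> \<le> pr (\<lambda>n x. \<not> cayG n R x) + pr (\<lambda>n x. \<not> cayH n (3 * ?\<rho>) (u n x) \<or> torn n R ?\<rho> x)"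
          by (rule A.pr_disj_le)
        also have "\<dots> \<le> pr (\<lambda>n x. \<not> cayG n R x) + (pr (\<lambda>n x. \<not> cayH n (3 * ?\<rho>) (u n x)) + pr (\<lambda>n x. torn n R ?\<rho> x))"
          by (intro add_left_mono A.pr_disj_le)
        finally show ?thesis using R pr_cayG[of R] pr_cayH[of "3 * ?\<rho>"] by linarith
      qed
      let ?Q = "\<lambda>h n x. locally_leading R h (view n x) \<and> ?ok n x"
      have main: "(\<Sum>h\<in>J. pr (?Q h)) \<le> K"
      proof (rule sum_pr_le[OF J(1)])
        show "eventually (\<lambda>n. real (\<Sum>h\<in>J. card {x \<in> VG n. ?Q h n x}) \<le> K * real (card (VG n))) U"
          using K(2)
        proof eventually_elim
          case (elim n)
          have "(\<Sum>h\<in>J. card {x \<in> VG n. ?Q h n x}) \<le> card (VH n)"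
            by (rule sum_card_leading_le[OF J \<rho>])
          then show ?case using elim by linarith
        qed
      qed
      have "(\<Sum>h\<in>J. emeasure nu {w \<in> Omega. actH h w \<in> XG}) \<le> (\<Sum>h\<in>J. ennreal (pr (\<lambda>n x. locally_leading R h (view n x))))"
      proof (rule sum_mono)
        fix h assume "h \<in> J"
        then have h: "h \<in> carrier H" using J(2) by blast
        have "emeasure nu {w \<in> Omega. actH h w \<in> XG} \<le> emeasure nu {w \<in> Omega. locally_leading R h w}"
        proof (rule emeasure_mono_AE)
          show "AE w in nu. w \<in> {w \<in> Omega. actH h w \<in> XG} \<longrightarrow> w \<in> {w \<in> Omega. locally_leading R h w}"
            using AE_nu_XH by eventually_elim (use locally_leading_if_XG[OF _ h] in auto)
          show "{w \<in> Omega. locally_leading R h w} \<in> sets nu"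
            using sets_BOmega_cylinder[OF cylinder_locally_leading] by (simp add: sets_nu)
        qed
        then show "emeasure nu {w \<in> Omega. actH h w \<in> XG} \<le> ennreal (pr (\<lambda>n x. locally_leading R h (view n x)))"
          by (simp add: emeasure_nu_cylinder cylinder_locally_leading)
      qed
      also have "\<dots> = ennreal (\<Sum>h\<in>J. pr (\<lambda>n x. locally_leading R h (view n x)))"
        by (rule sum_ennreal) (rule A.pr_nonneg)
      also have "\<dots> \<le> ennreal (\<Sum>h\<in>J. pr (?Q h) + e / (real (card J) + 1))"
      proof (intro ennreal_leI sum_mono)
        fix h
        have "pr (\<lambda>n x. locally_leading R h (view n x)) \<le> pr (\<lambda>n x. ?Q h n x \<or> \<not> ?ok n x)"
          by (rule A.pr_mono') blast
        also have "\<dots> \<le> pr (?Q h) + pr (\<lambda>n x. \<not> ?ok n x)" by (rule A.pr_disj_le)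
        finally show "pr (\<lambda>n x. locally_leading R h (view n x)) \<le> pr (?Q h) + e / (real (card J) + 1)"
          using ok by linarith
      qed
      also have "\<dots> \<le> ennreal (K + e)"
      proof (intro ennreal_leI)
        have "real (card J) * (e / (real (card J) + 1)) \<le> e" using e by (simp add: field_simps)
        then show "(\<Sum>h\<in>J. pr (?Q h) + e / (real (card J) + 1)) \<le> K + e"
          using main by (simp add: sum.distrib)
      qed
      finally show ?thesis .
    qed
    show "(\<Sum>h\<in>J. emeasure nu {w \<in> Omega. actH h w \<in> XG}) \<le> ennreal K"
    proof (rule ennreal_le_epsilon)
      fix e :: real assume "0 < e"
      then show "(\<Sum>h\<in>J. emeasure nu {w \<in> Omega. actH h w \<in> XG}) \<le> ennreal K + ennreal e"
        using le[of e] K(1) by simp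
    qed
  qed
  then show ?thesis using order_le_less_trans ennreal_less_top by (metis infinity_ennreal_def)
qed

theorem me_coupling: "me_coupling G H \<mu> \<phi> \<psi> XG XH"
  by (rule me_coupling_mu[OF AE_mu_finite_fibres emeasure_mu_XG_finite])

text \<open>Let \<open>z\<close> be the image of \<open>x\<close> translated by \<open>h\<close>. Some \<open>y\<close> has its image at distance at most \<open>c\<close> from \<open>z\<close>.
  Unless \<open>x\<close> is torn, \<open>y = x \<cdot> k\<close> with \<open>k\<close> in the ball of radius \<open>R\<close>. So with high probability the
  view from \<open>x\<close> has a value in the ball of radius \<open>c\<close> around \<open>h\<close> already within this ball.\<close>

lemma AE_mu_dense:
  assumes dense: "\<forall>n. \<forall>z\<in>VH n. \<exists>y\<in>VG n. reach (\<H> n) c z (u n y)"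
  shows "AE w in \<mu>. \<forall>h\<in>carrier H. \<exists>k\<in>carrier G. inv\<^sub>H h \<star> loc w k \<in> HH.wball c"
proof (rule AE_muI)
  let ?P = "\<lambda>w. \<forall>h\<in>carrier H. \<exists>k\<in>carrier G. inv\<^sub>H h \<star> loc w k \<in> HH.wball c"
  have "Measurable.pred BOmega (\<lambda>w. \<not> (\<forall>k\<in>carrier G. inv\<^sub>H h \<star> loc w k \<notin> HH.wball c))" for h
    by (intro pred_intros_logic pred_Ball_countable[OF GG.countable_carrier] pred_BOmega cylinder_loc)
  then have "Measurable.pred BOmega ?P"
    by (intro pred_Ball_countable[OF HH.countable_carrier]) simp
  then show "{w \<in> Omega. ?P w} \<in> sets BOmega" by (simp add: pred_def)
  have "AE w in nu. \<exists>k\<in>carrier G. inv\<^sub>H h \<star> loc w k \<in> HH.wball c" if h: "h \<in> carrier H" for h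
  proof -
    let ?miss = "\<lambda>R w. \<forall>k\<in>GG.wball R. inv\<^sub>H h \<star> loc w k \<notin> HH.wball c"
    let ?r = "HH.len h + c"
    have fd: "cylinder {w. ?miss R w}" for R
      by (rule cylinder_config[of "GG.wball R" 0]) (simp_all add: GG.finite_wball)
    have "pr (\<lambda>n x. ?miss R (view n x)) \<le> pr (\<lambda>n x. torn n R ?r x)" for R
    proof (rule pr_le_nice[of "{}"])
      fix C
      show "\<exists>S. \<forall>R'\<ge>S. \<forall>n x. x \<in> VG n \<longrightarrow> nice {} C R' n x \<longrightarrow> ?miss R (view n x) \<longrightarrow> torn n R ?r x"
      proof (intro exI[of _ "R + 3 * ?r"] allI impI)
        fix R' n x assume R': "R + 3 * ?r \<le> R'" and x: "x \<in> VG n" and nice: "nice {} C R' n x"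
          and miss: "?miss R (view n x)"
        have c: "cayG n R' x" "cayH n R' (u n x)" using nice by (auto simp: nice_def)
        let ?z = "pactH n (u n x) h"
        have z: "reach (\<H> n) (HH.len h) (u n x) ?z"
          using HH.reach_pact[OF fin_H c(2) h] R' by simp
        then have "?z \<in> VH n" using reach_lverts[OF fin_H _ u_in[OF x]] by blast
        then obtain y where y: "y \<in> VG n" "reach (\<H> n) c ?z (u n y)" using dense by blast
        have r: "reach (\<H> n) ?r (u n x) (u n y)" by (rule reach_trans[OF z y(2)])
        have "\<not> reach (\<G> n) R x y"
        proof
          assume rG: "reach (\<G> n) R x y"
          let ?k = "dispG n x y"
          have "R \<le> R'" using R' by simp
          then have k: "pactG n x ?k = y" "?k \<in> GG.wball R"
            using GG.pact_displacement[OF fin_G c(1) rG] by auto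
          have "dispH n (u n x) (u n y) = dispH n (u n x) ?z \<star> dispH n ?z (u n y)"
            using R' by (intro HH.displacement_cocycle[OF fin_H c(2) _ r] reach_mono[OF z]) auto
          moreover have "dispH n (u n x) ?z = h"
            using HH.displacement_pact[OF fin_H c(2) h] R' by simp
          ultimately have "inv\<^sub>H h \<star> loc (view n x) ?k = dispH n ?z (u n y)"
            using k h dispH_closed GG.wball_closed[OF k(2)] by (simp add: loc_view HH.m_assoc[symmetric])
          then have "inv\<^sub>H h \<star> loc (view n x) ?k \<in> HH.wball c"
            using HH.displacement_wball[OF fin_H y(2)] by simp
          then show False using miss k(2) by blast
        qed
        then show "torn n R ?r x" using y(1) r by blast
      qed
    qed auto
    note small = this
    have "AE w in nu. w \<notin> {w \<in> Omega. \<forall>k\<in>carrier G. inv\<^sub>H h \<star> loc w k \<notin> HH.wball c}"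
    proof (rule nu_null_if_small)
      fix e :: real assume "e > 0"
      then obtain R where "pr (\<lambda>n x. torn n R ?r x) < e" using expansive[of e ?r] by blast
      then have "emeasure nu {w \<in> Omega. ?miss R w} \<le> ennreal e"
        using small[of R] by (intro emeasure_nu_le fd) linarith
      moreover have "{w \<in> Omega. ?miss R w} \<in> sets nu"
        using sets_BOmega_cylinder[OF fd] by (simp add: sets_nu)
      moreover have "{w \<in> Omega. \<forall>k\<in>carrier G. inv\<^sub>H h \<star> loc w k \<notin> HH.wball c} \<subseteq> {w \<in> Omega. ?miss R w}"
        using GG.wball_closed by blast
      ultimately show "\<exists>B. {w \<in> Omega. \<forall>k\<in>carrier G. inv\<^sub>H h \<star> loc w k \<notin> HH.wball c} \<subseteq> B \<and>
          B \<in> sets nu \<and> emeasure nu B \<le> ennreal e" by blast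
    qed
    then show ?thesis using AE_space[of nu] by eventually_elim (auto simp: space_nu)
  qed
  then show "AE w in nu. ?P w" by (simp add: AE_ball_countable HH.countable_carrier)
  fix h w assume h: "h \<in> carrier H" and w: "w \<in> Omega" and P: "?P w"
  show "?P (actH h w)"
  proof
    fix h' assume h': "h' \<in> carrier H"
    then obtain k where k: "k \<in> carrier G" "inv\<^sub>H (inv\<^sub>H h \<star> h') \<star> loc w k \<in> HH.wball c"
      using P h by blast
    have "inv\<^sub>H h' \<star> loc (actH h w) k = inv\<^sub>H (inv\<^sub>H h \<star> h') \<star> loc w k"
      using h h' w k(1) loc_closed[OF w k(1)] by (simp add: loc_actH HH.inv_mult_group HH.m_assoc)
    then have "inv\<^sub>H h' \<star> loc (actH h w) k \<in> HH.wball c" using k(2) by simp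
    then show "\<exists>k\<in>carrier G. inv\<^sub>H h' \<star> loc (actH h w) k \<in> HH.wball c" using k(1) by blast
  qed
qed

lemma cobounded_G_to_H_if_dense:
  assumes "\<forall>n. \<forall>z\<in>VH n. \<exists>y\<in>VG n. reach (\<H> n) c z (u n y)"
  shows "AE w in \<mu>. w \<in> XG \<longrightarrow> eH (loc w \<one>\<^sub>G) \<le> Max (eH ` HH.wball c)"
  using AE_mu_dense[OF assms] AE_space[of \<mu>]
proof eventually_elim
  case (elim w)
  show ?case
  proof
    assume XG: "w \<in> XG"
    have w: "w \<in> Omega" using elim by simp
    obtain k where k: "k \<in> carrier G" "inv\<^sub>H \<one>\<^sub>H \<star> loc w k \<in> HH.wball c" using elim by blast
    have "eH (loc w \<one>\<^sub>G) \<le> eH (loc w k)" using XG k(1) by (simp add: XG_def leading_def)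
    also have "\<dots> \<le> Max (eH ` HH.wball c)"
      using k loc_closed[OF w k(1)] HH.finite_wball by (intro Max_ge) auto
    finally show "eH (loc w \<one>\<^sub>G) \<le> Max (eH ` HH.wball c)" .
  qed
qed

lemma finitely_covered_XG:
  assumes dense: "\<forall>n. \<forall>z\<in>VH n. \<exists>y\<in>VG n. reach (\<H> n) c z (u n y)"
  shows "ae_finitely_covered H \<mu> \<psi> XG XH"
proof -
  let ?F = "{h \<in> carrier H. eH h \<le> Max (eH ` HH.wball c)}"
  have "finite ?F"
    using inj_on_subset[OF inj_eH] by (intro inj_on_finite[of eH _ "{..Max (eH ` HH.wball c)}"]) auto
  moreover have "AE w in \<mu>. w \<in> XG \<longrightarrow> w \<in> (\<Union>h\<in>?F. \<psi> h ` XH)"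
    using cobounded_G_to_H_if_dense[OF dense] AE_space[of \<mu>]
  proof eventually_elim
    case (elim w)
    show ?case
    proof
      assume "w \<in> XG"
      have w: "w \<in> Omega" using elim by simp
      let ?h = "loc w \<one>\<^sub>G"
      have h: "?h \<in> ?F" "?h \<in> carrier H" using elim \<open>w \<in> XG\<close> loc_closed[OF w] by auto
      have "actH (inv\<^sub>H ?h) w \<in> XH" using h w by (simp add: XH_def actH_closed loc_actH)
      moreover have "\<psi> ?h (actH (inv\<^sub>H ?h) w) = w"
        using h w actH_mult[of ?h "inv\<^sub>H ?h" w] by (simp add: \<psi>_def actH_closed actH_one)
      ultimately have "w \<in> \<psi> ?h ` XH" by (metis imageI)
      then show "w \<in> (\<Union>h\<in>?F. \<psi> h ` XH)" using h(1) by blast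
    qed
  qed
  ultimately show ?thesis unfolding ae_finitely_covered_def by (intro exI[of _ ?F]) blast
qed

text \<open>If \<open>k\<close> lies in the fibre of the unit, then \<open>x\<close> and \<open>x \<cdot> k\<close> have the same image, so they are at
  distance at most \<open>c\<close> by hypothesis.\<close>

lemma AE_mu_small_fibres:
  assumes inj: "\<forall>n. \<forall>x\<in>VG n. \<forall>y\<in>VG n. u n x = u n y \<longrightarrow> reach (\<G> n) c x y"
  shows "AE w in \<mu>. loc w \<one>\<^sub>G = \<one>\<^sub>H \<longrightarrow> (\<forall>k\<in>carrier G. loc w k = \<one>\<^sub>H \<longrightarrow> k \<in> GG.wball c)"
proof -
  let ?P = "\<lambda>w. \<forall>k\<in>carrier G. loc w k = loc w \<one>\<^sub>G \<longrightarrow> k \<in> GG.wball c"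
  have fd: "cylinder {w. loc w k = loc w \<one>\<^sub>G \<longrightarrow> k \<in> GG.wball c}" for k
    by (rule cylinder_config[of "{k, \<one>\<^sub>G}" 0]) auto
  have "AE w in \<mu>. ?P w"
  proof (rule AE_muI)
    have "Measurable.pred BOmega ?P"
      by (intro pred_Ball_countable[OF GG.countable_carrier] pred_BOmega fd)
    then show "{w \<in> Omega. ?P w} \<in> sets BOmega" by (simp add: pred_def)
    have "AE w in nu. loc w k = loc w \<one>\<^sub>G \<longrightarrow> k \<in> GG.wball c" if k: "k \<in> carrier G" for k
    proof (rule AE_nu[OF fd], rule pr_zero_nice[of "{k}"])
      fix C
      show "\<exists>S. \<forall>R'\<ge>S. \<forall>n x. x \<in> VG n \<longrightarrow> nice {k} C R' n x \<longrightarrow>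
          \<not> \<not> (loc (view n x) k = loc (view n x) \<one>\<^sub>G \<longrightarrow> k \<in> GG.wball c)"
      proof (intro exI[of _ "C + c"] allI impI, unfold not_not, rule impI)
        fix R' n x assume R': "C + c \<le> R'" and x: "x \<in> VG n" and nice: "nice {k} C R' n x"
          and eq: "loc (view n x) k = loc (view n x) \<one>\<^sub>G"
        have n: "cayG n R' x" "cayH n R' (u n x)" "GG.len k \<le> R'"
          "reach (\<H> n) C (u n x) (u n (pactG n x k))" using nice by (auto simp: nice_def)
        have "dispH n (u n x) (u n (pactG n x k)) = \<one>\<^sub>H" using eq k by (simp add: loc_view)
        then have "u n (pactG n x k) = u n x"
          using HH.pact_displacement(1)[OF fin_H n(2) n(4)] R' by simp
        then have "reach (\<G> n) c x (pactG n x k)"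
          using inj x pactG_VG[OF n(1) k n(3)] by simp
        then show "k \<in> GG.wball c"
          using GG.displacement_wball[OF fin_G] GG.displacement_pact[OF fin_G n(1) k n(3)] by metis
      qed
    qed (use k in auto)
    then show "AE w in nu. ?P w" by (simp add: AE_ball_countable GG.countable_carrier)
    show "?P (actH h w)" if "h \<in> carrier H" "w \<in> Omega" "?P w" for h w
      using that loc_closed[OF that(2)] by (simp add: loc_actH)
  qed
  then show ?thesis by eventually_elim auto
qed

lemma leading_fibre:
  assumes w: "w \<in> XH" and p: "p \<in> carrier G" "leading w p"
  shows "loc w p = \<one>\<^sub>H"
proof -
  have "eH (loc w p) \<le> eH (loc w \<one>\<^sub>G)" using p by (simp add: leading_def)
  then show ?thesis using w by (simp add: XH_def eH_eq_0)
qed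

lemma finitely_covered_XH:
  assumes inj: "\<forall>n. \<forall>x\<in>VG n. \<forall>y\<in>VG n. u n x = u n y \<longrightarrow> reach (\<G> n) c x y"
  shows "ae_finitely_covered G \<mu> \<phi> XH XG"
proof -
  have "AE w in \<mu>. w \<in> XH \<longrightarrow> w \<in> (\<Union>g\<in>GG.wball c. \<phi> g ` XG)"
    using AE_mu_small_fibres[OF inj] AE_mu_finite_fibres AE_space[of \<mu>]
  proof eventually_elim
    case (elim w)
    show ?case
    proof
      assume XH: "w \<in> XH"
      have w: "w \<in> Omega" using elim by simp
      obtain p where p: "p \<in> carrier G" "leading w p" using leading_ex1[OF w elim(2)] by blast
      have "p \<in> GG.wball c" using elim(1) XH p leading_fibre[OF XH p] by (simp add: XH_def)
      moreover have "actG (inv\<^sub>G p) w \<in> XG" using p w by (simp add: XG_actG_iff)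
      moreover have "\<phi> p (actG (inv\<^sub>G p) w) = w"
        using p w actG_mult[of p "inv\<^sub>G p" w] by (simp add: \<phi>_def actG_closed actG_one)
      ultimately show "w \<in> (\<Union>g\<in>GG.wball c. \<phi> g ` XG)" by (metis UN_I imageI)
    qed
  qed
  then show ?thesis unfolding ae_finitely_covered_def
    using GG.finite_wball GG.wball_closed by (intro exI[of _ "GG.wball c"]) auto
qed

lemma XG_eq_XH_if_bijective:
  assumes bij: "\<And>n. bij_betw (u n) (VG n) (VH n)"
  shows "AE w in \<mu>. w \<in> XG \<longleftrightarrow> w \<in> XH"
proof -
  have dense: "\<forall>n. \<forall>z\<in>VH n. \<exists>y\<in>VG n. reach (\<H> n) 0 z (u n y)"
    using bij_betw_imp_surj_on[OF bij] by (metis imageE reach_refl)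
  have inj: "\<forall>n. \<forall>x\<in>VG n. \<forall>y\<in>VG n. u n x = u n y \<longrightarrow> reach (\<G> n) 0 x y"
    using inj_on_eq_iff[OF bij_betw_imp_inj_on[OF bij]] by simp
  have one: "k = \<one>\<^sub>G" if "k \<in> GG.wball 0" for k
    using that GG.geodesic(2)[of k] by (simp add: GG.wball_def GG.len_def)
  have oneH: "h = \<one>\<^sub>H" if "h \<in> HH.wball 0" for h
    using that HH.geodesic(2)[of h] by (simp add: HH.wball_def HH.len_def)
  have "HH.wball 0 = {\<one>\<^sub>H}" using oneH by (auto simp: HH.wball_def HH.len_def)
  then have max: "Max (eH ` HH.wball 0) = 0" by simp
  show ?thesis
    using AE_mu_small_fibres[OF inj] cobounded_G_to_H_if_dense[OF dense] AE_mu_finite_fibres AE_space[of \<mu>]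
  proof eventually_elim
    case (elim w)
    have w: "w \<in> Omega" using elim by simp
    show ?case
    proof
      assume "w \<in> XG"
      then have "eH (loc w \<one>\<^sub>G) = 0" using elim(2) max by simp
      then show "w \<in> XH" using w by (simp add: XH_def eH_eq_0)
    next
      assume XH: "w \<in> XH"
      obtain p where p: "p \<in> carrier G" "leading w p" using leading_ex1[OF w elim(3)] by blast
      have "p \<in> GG.wball 0" using elim(1) XH p leading_fibre[OF XH p] by (simp add: XH_def)
      then show "w \<in> XG" using one p(2) w by (auto simp: XG_def)
    qed
  qed
qed

end

theorem theorem1p7:
  fixes G :: "('g, 'a) monoid_scheme" and H :: "('h, 'b) monoid_scheme"
    and S\<^sub>G :: "'g set" and S\<^sub>H :: "'h set"
    and \<G> :: "nat \<Rightarrow> ('v, 'g) lgraph" and \<H> :: "nat \<Rightarrow> ('w, 'h) lgraph"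
    and U :: "nat filter"
    and u :: "nat \<Rightarrow> 'v \<Rightarrow> 'w"
  assumes "group G" and "group H"
    and "finite_generating_set G S\<^sub>G" and "finite_generating_set H S\<^sub>H"
    and "sofic_approximation G S\<^sub>G \<G>" and "sofic_approximation H S\<^sub>H \<H>"
    and "nonprincipal_ultrafilter U"
    and "\<And>n. u n \<in> lverts (\<G> n) \<rightarrow> lverts (\<H> n)"
    and "map_sequence.stat_coarse_equivalence U
      (\<lambda>n. lverts (\<G> n)) (\<lambda>n. gdist (\<G> n)) (\<lambda>n. lverts (\<H> n)) (\<lambda>n. gdist (\<H> n)) u"
  shows "\<exists>(M :: (nat \<Rightarrow> nat) measure) \<phi> \<psi> X\<^sub>G X\<^sub>H.
    me_coupling G H M \<phi> \<psi> X\<^sub>G X\<^sub>H \<and>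
    ((\<exists>C>0. \<forall>n. \<forall>z\<in>lverts (\<H> n).
        esetdist (gdist (\<H> n)) z (u n ` lverts (\<G> n)) \<le> ennreal C)
      \<longrightarrow> cobounded_G_to_H G H M \<phi> \<psi> X\<^sub>G X\<^sub>H) \<and>
    ((\<exists>C>0. \<forall>n. \<forall>z\<in>lverts (\<H> n).
        ediam (gdist (\<G> n)) (u n -` {z} \<inter> lverts (\<G> n)) \<le> ennreal C)
      \<longrightarrow> cobounded_H_to_G G H M \<phi> \<psi> X\<^sub>G X\<^sub>H) \<and>
    ((\<forall>n. bij_betw (u n) (lverts (\<G> n)) (lverts (\<H> n)))
      \<longrightarrow> oe_coupling G H M \<phi> \<psi> X\<^sub>G X\<^sub>H)"
proof -
  interpret sofic_coarse_equivalence G S\<^sub>G H S\<^sub>H \<G> \<H> U u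
    by (intro sofic_coarse_equivalence.intro sofic_coarse_equivalence_axioms.intro group_pair.intro
        marked_group.intro marked_group_axioms.intro assms)
  have "cobounded_G_to_H G H \<mu> \<phi> \<psi> XG XH"
    if C: "\<forall>n. \<forall>z\<in>lverts (\<H> n). esetdist (gdist (\<H> n)) z (u n ` lverts (\<G> n)) \<le> ennreal C" for C
  proof -
    let ?c = "Suc (nat \<lceil>C\<rceil>)"
    have "\<exists>y\<in>VG n. reach (\<H> n) ?c z (u n y)" if "z \<in> VH n" for n z
    proof -
      have "C < real ?c" by linarith
      then have "ennreal C < ennreal (real ?c)" by (rule ennreal_lessI[rotated]) simp
      moreover have "esetdist (gdist (\<H> n)) z (u n ` VG n) \<le> ennreal C" using C that by blast
      ultimately have "esetdist (gdist (\<H> n)) z (u n ` VG n) < ennreal (real ?c)"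
        by (rule order_le_less_trans[rotated])
      then obtain y where "y \<in> VG n" "gdist (\<H> n) z (u n y) < ennreal (real ?c)"
        unfolding esetdist_def by (auto simp: INF_less_iff simp del: of_nat_Suc)
      then have "gdist (\<H> n) z (u n y) \<le> ennreal (real ?c)" by simp
      then show ?thesis using \<open>y \<in> VG n\<close> unfolding gdist_le_iff_reach by blast
    qed
    then have "ae_finitely_covered H \<mu> \<psi> XG XH" by (intro finitely_covered_XG[of ?c]) blast
    then show ?thesis using me_coupling by (simp add: cobounded_G_to_H_def)
  qed
  moreover have "cobounded_H_to_G G H \<mu> \<phi> \<psi> XG XH"
    if C: "\<forall>n. \<forall>z\<in>lverts (\<H> n). ediam (gdist (\<G> n)) (u n -` {z} \<inter> lverts (\<G> n)) \<le> ennreal C" for C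
  proof -
    have "reach (\<G> n) (nat \<lfloor>C\<rfloor>) x y" if xy: "x \<in> VG n" "y \<in> VG n" "u n x = u n y" for n x y
    proof -
      let ?A = "u n -` {u n x} \<inter> VG n"
      have "gdist (\<G> n) x y \<le> ediam (gdist (\<G> n)) ?A"
        unfolding ediam_def using xy by (intro SUP_upper2[of x] SUP_upper2[of y]) auto
      also have "\<dots> \<le> ennreal C" using C u_in[OF xy(1)] by blast
      finally show ?thesis by (rule gdist_imp_reach)
    qed
    then have "ae_finitely_covered G \<mu> \<phi> XH XG"
      by (intro finitely_covered_XH[of "nat \<lfloor>C\<rfloor>"]) blast
    then show ?thesis using me_coupling by (simp add: cobounded_H_to_G_def)
  qed
  moreover have "oe_coupling G H \<mu> \<phi> \<psi> XG XH" if "\<forall>n. bij_betw (u n) (lverts (\<G> n)) (lverts (\<H> n))"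
    using XG_eq_XH_if_bijective that me_coupling by (simp add: oe_coupling_def)
  ultimately show ?thesis
    using me_coupling by (intro exI[of _ \<mu>] exI[of _ \<phi>] exI[of _ \<psi>] exI[of _ XG] exI[of _ XH]) blast
qed

end
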